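(* Let $I \subsetneq R=\mathbb{K}[x_1,\ldots,x_n]$ and $J\subsetneq S=\mathbb{K}[y_1,\ldots,y_m]$ be proper ideals. Then $I$ and $J$ are both geometrically vertex decomposable if and only if $I+J$ is geometrically vertex decomposable in $R\otimes_{\mathbb{K}} S=\mathbb{K}[x_1,\ldots,x_n,y_1,\ldots,y_m]$.
   Context: $\mathbb{K}$ is an algebraically closed field of characteristic zero. Here $I+J$ denotes the ideal of $R\otimes_{\mathbb{K}}S$ generated by the images of $I$ and $J$ under the natural inclusions. Geometric vertex decomposability. Let $R=\mathbb{K}[x_1,\ldots,x_n]$ and fix a variable $y=x_i$. Write $0\neq f\in R$ as $f=\sum_j\alpha_jy^j$ with $\alpha_j$ not involving $y$; if $d$ is the largest index with $\alpha_d\neq0$, put $\mathrm{in}_y(f)=\alpha_dy^d$. For an ideal $I$, $\mathrm{in}_y(I)=\langle \mathrm{in}_y(f)\mid f\in I\rangle$. A monomial order $<$ is $y$-compatible if $\mathrm{in}_<(f)=\mathrm{in}_<(\mathrm{in}_y(f))$ for all $f$. Given a $y$-compatible order $<$ and a Gröbner basis $\{g_1,\ldots,g_m\}$ of $I$ with respect to $<$, write $g_j=y^{d_j}q_j+r_j$ with $\mathrm{in}_y(g_j)=y^{d_j}q_j$ and $y$ dividing no term of $q_j$, and set $C_{y,I}=\langle q_1,\ldots,q_m\rangle$ and $N_{y,I}=\langle q_j\mid d_j=0\rangle$. An ideal $I$ is unmixed if $\dim(R/I)=\dim(R/P)$ for all $P\in\mathrm{Ass}_R(R/I)$. The ideal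 $I$ is geometrically vertex decomposable if $I$ is unmixed and either (1) $I=\langle1\rangle$ or $I$ is generated by a (possibly empty) subset of the variables of $R$; or (2) there are a variable $y=x_i$ and a $y$-compatible monomial order $<$ such that $\mathrm{in}_y(I)=C_{y,I}\cap(N_{y,I}+\langle y\rangle)$ and the contractions of $C_{y,I}$ and $N_{y,I}$ to $\mathbb{K}[x_1,\ldots,\hat{x}_i,\ldots,x_n]$ are geometrically vertex decomposable. By convention the ideals $\langle0\rangle$ and $\langle1\rangle$ of the ring $\mathbb{K}$ are geometrically vertex decomposable. *)

theory Defs
  imports
    "HOL-Library.Poly_Mapping"
    "HOL-Library.Extended_Real"
    "HOL-Computational_Algebra.Polynomial"
    "HOL-Algebra.QuotRing"
begin

section \<open>Polynomial rings in a set of variables\<close>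

text \<open>
  A monomial is a finitely supported exponent function, a polynomial a finitely supported
  function from monomials to coefficients, multiplied by convolution. The ring
  \<open>\<bbbK>[V]\<close> is the subring of the polynomials in which only variables of \<open>V\<close> occur, so that for
  \<open>U \<subseteq> V\<close> the natural inclusion of \<open>\<bbbK>[U]\<close> into \<open>\<bbbK>[V]\<close> is the inclusion of carriers, and for
  disjoint \<open>X\<close>, \<open>Y\<close> the ring \<open>\<bbbK>[X \<union> Y]\<close> is \<open>\<bbbK>[X] \<otimes> \<bbbK>[Y]\<close>.
\<close>

type_synonym 'v monomial = "'v \<Rightarrow>\<^sub>0 nat"
type_synonym ('v, 'k) mpolynomial = "'v monomial \<Rightarrow>\<^sub>0 'k"

definition monomials :: "'v set \<Rightarrow> 'v monomial set" where
  "monomials V = {m. Poly_Mapping.keys m \<subseteq> V}"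

definition mpoly_ring :: "'v set \<Rightarrow> ('v, 'k::field) mpolynomial ring" where
  "mpoly_ring V =
     \<lparr>carrier = {f. Poly_Mapping.keys f \<subseteq> monomials V},
      monoid.mult = (*), one = 1, ring.zero = 0, add = (+)\<rparr>"

definition mvar :: "'v \<Rightarrow> ('v, 'k::field) mpolynomial" where
  "mvar v = Poly_Mapping.single (Poly_Mapping.single v 1) 1"


section \<open>Krull dimension, associated primes, unmixed ideals\<close>

text \<open>The supremum is taken in \<^typ>\<open>ereal\<close>, so the zero ring has dimension \<open>-\<infinity>\<close>.\<close>

definition krull_dim :: "('a, 'b) ring_scheme \<Rightarrow> ereal" where
  "krull_dim R =
     (SUP n \<in> {n. \<exists>P :: nat \<Rightarrow> 'a set.
                   (\<forall>i\<le>n. primeideal (P i) R) \<and> (\<forall>i<n. P i \<subset> P (Suc i))}. ereal (real n))"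

text \<open>
  \<open>Ass\<^bsub>R\<^esub>(R/I)\<close>: the prime ideals of \<open>R\<close> that are the annihilator of some element \<open>a\<close> of the
  \<open>R\<close>-module \<open>R/I\<close>, on which \<open>r\<close> acts as multiplication by its residue class.
\<close>

definition associated_primes :: "('a, 'b) ring_scheme \<Rightarrow> 'a set \<Rightarrow> 'a set set" where
  "associated_primes R I =
     {P. primeideal P R \<and>
         (\<exists>a \<in> carrier (R Quot I).
            P = {r \<in> carrier R. (I +>\<^bsub>R\<^esub> r) \<otimes>\<^bsub>R Quot I\<^esub> a = \<zero>\<^bsub>R Quot I\<^esub>})}"

definition unmixed :: "('a, 'b) ring_scheme \<Rightarrow> 'a set \<Rightarrow> bool" where
  "unmixed R I \<longleftrightarrow> (\<forall>P \<in> associated_primes R I. krull_dim (R Quot I) = krull_dim (R Quot P))"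


section \<open>Initial forms with respect to a variable\<close>

text \<open>
  \<open>y_coeff y f j\<close> is \<open>\<alpha>\<^sub>j\<close> in the expansion \<open>f = \<Sum>\<^sub>j \<alpha>\<^sub>j y\<^sup>j\<close> whose coefficients do not involve \<open>y\<close>.
\<close>

definition y_coeff ::
    "'v \<Rightarrow> ('v, 'k::field) mpolynomial \<Rightarrow> nat \<Rightarrow> ('v, 'k) mpolynomial" where
  "y_coeff y f j =
     (\<Sum>m \<in> {m \<in> Poly_Mapping.keys f. Poly_Mapping.lookup m y = j}.
        Poly_Mapping.single (m - Poly_Mapping.single y j) (Poly_Mapping.lookup f m))"

definition y_degree :: "'v \<Rightarrow> ('v, 'k::field) mpolynomial \<Rightarrow> nat" where
  "y_degree y f = Max {j. y_coeff y f j \<noteq> 0}"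

definition y_lead_coeff :: "'v \<Rightarrow> ('v, 'k::field) mpolynomial \<Rightarrow> ('v, 'k) mpolynomial" where
  "y_lead_coeff y f = y_coeff y f (y_degree y f)"

text \<open>
  As with the leading terms below, this is only meaningful for \<open>f \<noteq> 0\<close>, and only used there.
\<close>

definition y_initial :: "'v \<Rightarrow> ('v, 'k::field) mpolynomial \<Rightarrow> ('v, 'k) mpolynomial" where
  "y_initial y f = y_lead_coeff y f * mvar y ^ y_degree y f"

definition y_initial_ideal ::
    "'v set \<Rightarrow> 'v \<Rightarrow> ('v, 'k::field) mpolynomial set \<Rightarrow> ('v, 'k) mpolynomial set" where
  "y_initial_ideal V y I = Idl\<^bsub>mpoly_ring V\<^esub> {y_initial y f |f. f \<in> I \<and> f \<noteq> 0}"


section \<open>Monomial orders and Groebner bases\<close>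

text \<open>An order is the set of pairs \<open>(a, b)\<close> with \<open>a \<le> b\<close>; multiplying monomials adds exponents.\<close>

definition monomial_order :: "'v set \<Rightarrow> 'v monomial rel \<Rightarrow> bool" where
  "monomial_order V ord \<longleftrightarrow>
     well_order_on (monomials V) ord \<and>
     (\<forall>a b. \<forall>c \<in> monomials V. (a, b) \<in> ord \<longrightarrow> (a + c, b + c) \<in> ord)"

definition lead_monomial ::
    "'v monomial rel \<Rightarrow> ('v, 'k::field) mpolynomial \<Rightarrow> 'v monomial" where
  "lead_monomial ord f =
     (THE m. m \<in> Poly_Mapping.keys f \<and> (\<forall>m' \<in> Poly_Mapping.keys f. (m', m) \<in> ord))"

definition lead_term ::
    "'v monomial rel \<Rightarrow> ('v, 'k::field) mpolynomial \<Rightarrow> ('v, 'k) mpolynomial" where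
  "lead_term ord f =
     Poly_Mapping.single (lead_monomial ord f) (Poly_Mapping.lookup f (lead_monomial ord f))"

definition y_compatible :: "'k::field itself \<Rightarrow> 'v set \<Rightarrow> 'v \<Rightarrow> 'v monomial rel \<Rightarrow> bool" where
  "y_compatible _ V y ord \<longleftrightarrow>
     (\<forall>f \<in> carrier (mpoly_ring V :: ('v, 'k) mpolynomial ring).
        f \<noteq> 0 \<longrightarrow> lead_term ord f = lead_term ord (y_initial y f))"

definition groebner_basis ::
    "'v set \<Rightarrow> 'v monomial rel \<Rightarrow> ('v, 'k::field) mpolynomial set
      \<Rightarrow> ('v, 'k) mpolynomial set \<Rightarrow> bool" where
  "groebner_basis V ord I G \<longleftrightarrow>
     finite G \<and> G \<subseteq> I - {0} \<and>
     Idl\<^bsub>mpoly_ring V\<^esub> (lead_term ord ` G) =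
       Idl\<^bsub>mpoly_ring V\<^esub> {lead_term ord f |f. f \<in> I \<and> f \<noteq> 0}"


section \<open>Geometric vertex decomposability\<close>

text \<open>\<open>C\<^bsub>y,I\<^esub>\<close> and \<open>N\<^bsub>y,I\<^esub>\<close>, computed from a Groebner basis \<open>G\<close> of \<open>I\<close>.\<close>

definition C_ideal ::
    "'v set \<Rightarrow> 'v \<Rightarrow> ('v, 'k::field) mpolynomial set \<Rightarrow> ('v, 'k) mpolynomial set" where
  "C_ideal V y G = Idl\<^bsub>mpoly_ring V\<^esub> {y_lead_coeff y g |g. g \<in> G}"

definition N_ideal ::
    "'v set \<Rightarrow> 'v \<Rightarrow> ('v, 'k::field) mpolynomial set \<Rightarrow> ('v, 'k) mpolynomial set" where
  "N_ideal V y G = Idl\<^bsub>mpoly_ring V\<^esub> {y_lead_coeff y g |g. g \<in> G \<and> y_degree y g = 0}"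

text \<open>
  \<open>geom_vertex_decomp V I\<close>: the ideal \<open>I\<close> of \<open>\<bbbK>[V]\<close> is geometrically vertex decomposable. For
  \<open>V = {}\<close> the first two rules make the ideals \<open>\<langle>0\<rangle>\<close> and \<open>\<langle>1\<rangle>\<close> of \<open>\<bbbK>\<close> geometrically vertex
  decomposable, in accordance with the usual convention.
\<close>

inductive geom_vertex_decomp :: "'v set \<Rightarrow> ('v, 'k::field) mpolynomial set \<Rightarrow> bool" where
  unit:
    "\<lbrakk>ideal I (mpoly_ring V); unmixed (mpoly_ring V) I;
      I = Idl\<^bsub>mpoly_ring V\<^esub> {1}\<rbrakk>
     \<Longrightarrow> geom_vertex_decomp V I"
| variables:
    "\<lbrakk>ideal I (mpoly_ring V); unmixed (mpoly_ring V) I;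
      B \<subseteq> V; I = Idl\<^bsub>mpoly_ring V\<^esub> (mvar ` B)\<rbrakk>
     \<Longrightarrow> geom_vertex_decomp V I"
| decompose:
    "\<lbrakk>ideal I (mpoly_ring V); unmixed (mpoly_ring V) I;
      y \<in> V; monomial_order V ord; y_compatible TYPE('k) V y ord;
      groebner_basis V ord I G;
      y_initial_ideal V y I =
        C_ideal V y G \<inter> (N_ideal V y G <+>\<^bsub>mpoly_ring V\<^esub> Idl\<^bsub>mpoly_ring V\<^esub> {mvar y});
      geom_vertex_decomp (V - {y}) (C_ideal V y G \<inter> carrier (mpoly_ring (V - {y})));
      geom_vertex_decomp (V - {y}) (N_ideal V y G \<inter> carrier (mpoly_ring (V - {y})))\<rbrakk>
     \<Longrightarrow> geom_vertex_decomp V I"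

end

theory Submission
  imports Defs
begin

text \<open>
  Write \<open>R = \<bbbk>[X]\<close>, \<open>S = \<bbbk>[Y]\<close> and \<open>T = R \<otimes> S\<close>, so that \<open>T/(I + J) = R/I \<otimes> S/J\<close>. Four ideas carry the
  proof.

  \<^item> A decomposition needs neither a monomial order nor a Groebner basis. Whatever the choices,
    \<open>C\<close> and \<open>N\<close> contract to the ideal of all leading coefficients in \<open>y\<close> of elements of \<open>I\<close>, and to
    \<open>I \<inter> \<bbbk>[V - {y}]\<close>; the equation \<open>in\<^sub>y(I) = C \<inter> (N + \<langle>y\<rangle>)\<close> holds if and only if every such leading
    coefficient already occurs in \<open>y\<close>-degree at most one
    (\<open>decomposition_iff_degree_one_leads\<close>). As compatible orders and finite Groebner bases always
    exist, decomposability obeys the order-free rules \<open>gvd_decomposeI\<close> and \<open>gvd_induct\<close>.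

  \<^item> A linear functional on \<open>S\<close> that vanishes on \<open>J\<close> induces an \<open>R\<close>-linear map \<open>T \<rightarrow> R\<close> (a ``slice''),
    and an element of \<open>T\<close> lies in \<open>I + J\<close> if and only if all these maps send it into \<open>I\<close>
    (\<open>slice_ideal_join\<close>, \<open>ideal_joinI\<close>). As slices commute with taking coefficients of powers of
    \<open>y \<in> X\<close>, the data of a decomposition of \<open>I + J\<close> at \<open>y\<close> are those of \<open>I\<close> with \<open>J\<close> added; for
    proper \<open>J\<close>, the condition on leading coefficients holds for \<open>I + J\<close> if and only if it holds for
    \<open>I\<close> (\<open>degree_one_leads_ideal_join\<close>).

  \<^item> Unmixedness is compatible with sums. For a proper ideal, the dimension of \<open>\<bbbk>[V]/I\<close> is the largest number of variables
    that are independent modulo \<open>I\<close> (\<open>krull_dim_Quot\<close>), and this number is additive for \<open>I + J\<close>. Over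
    an algebraically closed field the sum of primes \<open>P\<close> of \<open>R\<close> and \<open>Q\<close> of \<open>S\<close> is prime, because
    products can be tested at the points of \<open>P\<close> (\<open>nullstellensatz\<close>, \<open>prime_ideal_join\<close>). Hence
    \<open>P + Q\<close> is associated to \<open>I + J\<close> if \<open>P\<close> and \<open>Q\<close> are associated to \<open>I\<close> and \<open>J\<close>; every associated
    prime of \<open>I + J\<close> has this form if \<open>I + J\<close> is radical, and geometrically vertex decomposable
    ideals are radical (\<open>gvd_semiprime\<close>).

  \<^item> Both directions are inductions over a decomposition. If \<open>I\<close> and \<open>J\<close> decompose, first all steps for
    \<open>I\<close> are carried out in \<open>T\<close>, which reduces \<open>I\<close> to ideals generated by variables, and then those for
    \<open>J\<close>. If \<open>I + J\<close> decomposes at \<open>y \<in> X\<close>, then so does \<open>I\<close>; the ideal \<open>N\<close> of \<open>I\<close> is proper,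
    being contained in \<open>I\<close>, and so passes decomposability on to \<open>J\<close> by induction, while \<open>C\<close> may become
    the unit ideal, which is decomposable anyway.
\<close>

section \<open>Polynomials as finite sums of terms\<close>

abbreviation keys where "keys \<equiv> Poly_Mapping.keys"
abbreviation lookup where "lookup \<equiv> Poly_Mapping.lookup"
abbreviation single where "single \<equiv> Poly_Mapping.single"

abbreviation Pol :: "'v set \<Rightarrow> ('v, 'k::field) mpolynomial set" where
  "Pol V \<equiv> carrier (mpoly_ring V)"

abbreviation idl :: "'v set \<Rightarrow> ('v, 'k::field) mpolynomial set \<Rightarrow> ('v, 'k) mpolynomial set" where
  "idl V S \<equiv> Idl\<^bsub>mpoly_ring V\<^esub> S"

definition cst :: "'k::field \<Rightarrow> ('v, 'k) mpolynomial" where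
  "cst c = single 0 c"

lemma cst_simps [simp]:
  "cst 0 = 0" "cst 1 = 1" "cst (a + b) = cst a + cst b" "cst (a * b) = cst a * cst b"
  "cst (- a) = - cst a" "cst (a - b) = cst a - cst b"
  by (simp_all add: cst_def single_add mult_single single_uminus single_diff)

lemma cst_eq_iff [simp]: "cst a = cst b \<longleftrightarrow> a = b"
  unfolding cst_def by (metis lookup_single_eq)

lemma cst_eq_0_iff [simp]: "cst a = 0 \<longleftrightarrow> a = 0"
  using cst_eq_iff[of a 0] by simp

lemma Pol_iff: "f \<in> Pol V \<longleftrightarrow> (\<forall>m\<in>keys f. keys m \<subseteq> V)"
  by (auto simp: mpoly_ring_def monomials_def)

lemma mpoly_ring_simps [simp]:
  "f \<otimes>\<^bsub>mpoly_ring V\<^esub> g = f * g" "f \<oplus>\<^bsub>mpoly_ring V\<^esub> g = f + g"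
  "\<one>\<^bsub>mpoly_ring V\<^esub> = 1" "\<zero>\<^bsub>mpoly_ring V\<^esub> = 0"
  by (simp_all add: mpoly_ring_def)

lemma keys_add_monomial [simp]: "keys ((m :: 'v monomial) + n) = keys m \<union> keys n"
  by (auto simp: in_keys_iff lookup_add)

lemma Pol_zero [simp]: "0 \<in> Pol V" by (simp add: Pol_iff)
lemma Pol_one [simp]: "1 \<in> Pol V" by (simp add: Pol_iff)
lemma Pol_add [intro]: "f \<in> Pol V \<Longrightarrow> g \<in> Pol V \<Longrightarrow> f + g \<in> Pol V"
  using keys_add[of f g] by (auto simp: Pol_iff)
lemma Pol_mult [intro]: "f \<in> Pol V \<Longrightarrow> g \<in> Pol V \<Longrightarrow> f * g \<in> Pol V"
  using keys_mult[of f g] by (fastforce simp: Pol_iff)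
lemma Pol_single [intro]: "keys m \<subseteq> V \<Longrightarrow> single m c \<in> Pol V"
  by (auto simp: Pol_iff)
lemma Pol_cst [simp]: "cst c \<in> Pol V"
  by (auto simp: cst_def)
lemma Pol_uminus [intro]: "f \<in> Pol V \<Longrightarrow> - f \<in> Pol V"
  by (simp add: Pol_iff in_keys_iff)
lemma Pol_diff [intro]: "f \<in> Pol V \<Longrightarrow> g \<in> Pol V \<Longrightarrow> f - g \<in> Pol V"
  using Pol_add[of f V "- g"] Pol_uminus[of g V] by simp
lemma Pol_sum [intro]: "(\<And>i. i \<in> A \<Longrightarrow> f i \<in> Pol V) \<Longrightarrow> sum f A \<in> Pol V"
  by (induct A rule: infinite_finite_induct) auto
lemma Pol_prod [intro]: "(\<And>i. i \<in> A \<Longrightarrow> f i \<in> Pol V) \<Longrightarrow> prod f A \<in> Pol V"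
  by (induct A rule: infinite_finite_induct) auto
lemma Pol_power [intro]: "f \<in> Pol V \<Longrightarrow> f ^ n \<in> Pol V"
  by (induct n) auto
lemma Pol_mono: "V \<subseteq> W \<Longrightarrow> Pol V \<subseteq> Pol W"
  by (fastforce simp: Pol_iff)
lemma Pol_mono' : "f \<in> Pol V \<Longrightarrow> V \<subseteq> W \<Longrightarrow> f \<in> Pol W"
  using Pol_mono by blast
lemma Pol_mvar [intro]: "v \<in> V \<Longrightarrow> mvar v \<in> Pol V"
  by (auto simp: mvar_def)

lemma mpoly_cring: "cring (mpoly_ring V :: ('v, 'k::field) mpolynomial ring)"
proof (rule cringI)
  show "abelian_group (mpoly_ring V :: ('v, 'k) mpolynomial ring)"
  proof (rule abelian_groupI)
    fix x :: "('v, 'k) mpolynomial" assume "x \<in> Pol V"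
    then show "\<exists>y\<in>Pol V. y \<oplus>\<^bsub>mpoly_ring V\<^esub> x = \<zero>\<^bsub>mpoly_ring V\<^esub>"
      by (intro bexI[of _ "- x"]) (auto intro: Pol_uminus)
  qed (auto simp: algebra_simps)
  show "Group.comm_monoid (mpoly_ring V :: ('v, 'k) mpolynomial ring)"
    by (rule comm_monoidI) (auto simp: algebra_simps)
qed (auto simp: algebra_simps)

lemma mpoly_ring_ring: "ring (mpoly_ring V)"
  using mpoly_cring cring.axioms(1) by blast

lemma mpoly_expand: "f = (\<Sum>m\<in>keys f. single m (lookup f m))"
  by (rule poly_mapping_eqI) (simp add: lookup_sum lookup_single when_def in_keys_iff)

lemma Pol_induct [consumes 1, case_names zero single add]:
  assumes f: "f \<in> Pol V"
    and "P 0" and "\<And>m c. keys m \<subseteq> V \<Longrightarrow> P (single m c)"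
    and "\<And>f g. f \<in> Pol V \<Longrightarrow> g \<in> Pol V \<Longrightarrow> P f \<Longrightarrow> P g \<Longrightarrow> P (f + g)"
  shows "P f"
proof -
  have "finite A \<Longrightarrow> A \<subseteq> keys f \<Longrightarrow>
      (\<Sum>m\<in>A. single m (lookup f m)) \<in> Pol V \<and> P (\<Sum>m\<in>A. single m (lookup f m))" for A
  proof (induct A rule: finite_induct)
    case (insert m A)
    have "keys m \<subseteq> V" using f insert by (auto simp: Pol_iff)
    with insert show ?case using assms by (simp add: Pol_single Pol_add)
  qed (use assms in simp)
  from this[of "keys f"] show ?thesis using mpoly_expand[of f] by simp
qed

lemma mpoly_induct [case_names zero single add]:
  assumes "P 0" and "\<And>m c. P (single m c)" and "\<And>f g. P f \<Longrightarrow> P g \<Longrightarrow> P (f + g)"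
  shows "P (f :: ('v, 'k::field) mpolynomial)"
proof -
  have "f \<in> Pol UNIV" by (simp add: Pol_iff)
  then show ?thesis by (induct rule: Pol_induct) (use assms in auto)
qed

section \<open>Slices\<close>

lift_definition mres :: "'v set \<Rightarrow> 'v monomial \<Rightarrow> 'v monomial" is
  "\<lambda>Y m v. if v \<in> Y then m v else 0"
  by (rule finite_subset) auto

lemma lookup_mres [simp]: "lookup (mres Y m) v = (if v \<in> Y then lookup m v else 0)"
  by transfer simp

lemma mres_add [simp]: "mres Y (m + n) = mres Y m + mres Y n"
  by (rule poly_mapping_eqI) (simp add: lookup_add)
lemma mres_zero [simp]: "mres Y 0 = 0"
  by (rule poly_mapping_eqI) simp
lemma keys_mres [simp]: "keys (mres Y m) = keys m \<inter> Y"
  by (auto simp: in_keys_iff split: if_splits)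
lemma mres_split: "mres Y m + mres (- Y) m = m" "mres (- Y) m + mres Y m = m"
  by (rule poly_mapping_eqI, simp add: lookup_add)+
lemma mres_id: "keys m \<subseteq> Y \<Longrightarrow> mres Y m = m"
  by (rule poly_mapping_eqI) (auto simp: in_keys_iff)
lemma mres_none: "keys m \<inter> Y = {} \<Longrightarrow> mres Y m = 0"
  by (rule poly_mapping_eqI) (auto simp: in_keys_iff)
lemma mres_mres [simp]: "mres Y (mres Z m) = mres (Y \<inter> Z) m"
  by (rule poly_mapping_eqI) auto

text \<open>
  A function \<open>\<xi>\<close> on the monomials in \<open>Y\<close> is a linear functional on \<open>\<bbbk>[Y]\<close>; the slice is the map
  \<open>id \<otimes> \<xi>\<close> on \<open>\<bbbk>[V - Y] \<otimes> \<bbbk>[Y]\<close>. Evaluating the variables of \<open>Y\<close> (for multiplicative \<open>\<xi>\<close>) and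
  extracting the coefficient of a power of \<open>y\<close> (for \<open>Y = {y}\<close>, see \<open>y_coeff_slice\<close> below) are both of
  this form, so that the few rules for slices serve everywhere.
\<close>

definition slice :: "'v set \<Rightarrow> ('v monomial \<Rightarrow> 'k) \<Rightarrow> ('v, 'k::field) mpolynomial \<Rightarrow> ('v, 'k) mpolynomial" where
  "slice Y \<xi> f = (\<Sum>m\<in>keys f. single (mres (- Y) m) (lookup f m * \<xi> (mres Y m)))"

lemma slice_zero [simp]: "slice Y \<xi> 0 = 0"
  by (simp add: slice_def)

lemma slice_add [simp]: "slice Y \<xi> (f + g) = slice Y \<xi> f + slice Y \<xi> g"
  unfolding slice_def
  by (rule setsum_keys_plus_distrib[where f = "\<lambda>m c. single (mres (- Y) m) (c * \<xi> (mres Y m))"])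
     (simp_all add: algebra_simps single_add)

lemma slice_single [simp]: "slice Y \<xi> (single m c) = single (mres (- Y) m) (c * \<xi> (mres Y m))"
  by (cases "c = 0") (simp_all add: slice_def)

lemma slice_uminus [simp]: "slice Y \<xi> (- f) = - slice Y \<xi> f"
proof -
  have "slice Y \<xi> (- f) + slice Y \<xi> f = 0" by (simp flip: slice_add)
  then show ?thesis by (simp add: eq_neg_iff_add_eq_0)
qed

lemma slice_diff [simp]: "slice Y \<xi> (f - g) = slice Y \<xi> f - slice Y \<xi> g"
  using slice_add[of Y \<xi> f "- g"] by (simp del: slice_add)

lemma slice_sum: "slice Y \<xi> (sum f A) = (\<Sum>i\<in>A. slice Y \<xi> (f i))"
  by (induct A rule: infinite_finite_induct) auto

lemma slice_linear_left:
  assumes "r \<in> Pol W" "W \<inter> Y = {}"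
  shows "slice Y \<xi> (r * f) = r * slice Y \<xi> f"
  using assms(1)
proof (induct rule: Pol_induct)
  case (single m c)
  then have m: "mres Y m = 0" "mres (- Y) m = m"
    using assms(2) by (auto intro!: mres_none mres_id)
  show ?case
    by (induct f rule: mpoly_induct) (auto simp: mult_single m algebra_simps)
qed (auto simp: algebra_simps)

lemma slice_in_Pol [intro]: "f \<in> Pol V \<Longrightarrow> slice Y \<xi> f \<in> Pol (V - Y)"
proof (induct rule: Pol_induct)
  case (single m c)
  then show ?case by (auto intro!: Pol_single)
qed auto

lemma slice_commute:
  assumes "Y \<inter> Z = {}"
  shows "slice Y \<xi> (slice Z \<zeta> f) = slice Z \<zeta> (slice Y \<xi> f)"
proof (induct f rule: mpoly_induct)
  case (single m c)
  have "Y \<inter> - Z = Y" "Z \<inter> - Y = Z" "- Y \<inter> - Z = - Z \<inter> - Y" using assms by auto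
  then show ?case by (simp add: algebra_simps)
qed auto

lemma slice_single_mult:
  "slice Y \<xi> (single m c * f) = single (mres (- Y) m) c * slice Y (\<lambda>k. \<xi> (mres Y m + k)) f"
  by (induct f rule: mpoly_induct) (auto simp: mult_single distrib_left mult.assoc)

lemma slice_scale: "slice Y (\<lambda>n. c * \<xi> n) f = cst c * slice Y \<xi> f"
  by (induct f rule: mpoly_induct) (auto simp: cst_def mult_single distrib_left mult.left_commute)

lemma slice_monomial_mult:
  assumes "keys n \<subseteq> Y"
  shows "slice Y \<xi> (single n c * f) = cst c * slice Y (\<lambda>k. \<xi> (n + k)) f"
proof -
  have "mres Y n = n" "mres (- Y) n = 0" using assms by (auto intro!: mres_id mres_none)
  then show ?thesis by (simp add: slice_single_mult cst_def)
qed

lemma slice_none: "f \<in> Pol V \<Longrightarrow> V \<inter> Y = {} \<Longrightarrow> slice Y \<xi> f = cst (\<xi> 0) * f"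
proof (induct rule: Pol_induct)
  case (single m c)
  then have "mres Y m = 0" "mres (- Y) m = m" by (auto intro!: mres_none mres_id)
  then show ?case by (simp add: mult_single cst_def algebra_simps)
qed (auto simp: algebra_simps)

lemma slice_one: "slice Y \<xi> 1 = cst (\<xi> 0)"
  using slice_none[of 1 "{}" Y \<xi>] by simp

lemma slice_Pol_left: "f \<in> Pol (X \<union> Y) \<Longrightarrow> slice Y \<xi> f \<in> Pol X"
  using slice_in_Pol[of f "X \<union> Y" Y \<xi>] by (rule Pol_mono') auto

definition multiplicative :: "('v monomial \<Rightarrow> 'k::field) \<Rightarrow> bool" where
  "multiplicative \<xi> \<longleftrightarrow> \<xi> 0 = 1 \<and> (\<forall>m n. \<xi> (m + n) = \<xi> m * \<xi> n)"

lemma slice_mult: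
  assumes "multiplicative \<xi>"
  shows "slice Y \<xi> (f * g) = slice Y \<xi> f * slice Y \<xi> g"
proof (induct f rule: mpoly_induct)
  case (single m c)
  show ?case
    using assms by (induct g rule: mpoly_induct) (auto simp: mult_single multiplicative_def algebra_simps)
qed (auto simp: algebra_simps)

lemma slice_one_multiplicative [simp]: "multiplicative \<xi> \<Longrightarrow> slice Y \<xi> 1 = 1"
  by (simp add: slice_one multiplicative_def)

lemma slice_power: "multiplicative \<xi> \<Longrightarrow> slice Y \<xi> (f ^ n) = slice Y \<xi> f ^ n"
  by (induct n) (auto simp: slice_mult)

lemma slice_fixes: "multiplicative \<xi> \<Longrightarrow> f \<in> Pol V \<Longrightarrow> V \<inter> Y = {} \<Longrightarrow> slice Y \<xi> f = f"
  by (simp add: slice_none multiplicative_def)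

definition point :: "('v \<Rightarrow> 'k::field) \<Rightarrow> 'v monomial \<Rightarrow> 'k" where
  "point x m = (\<Prod>v\<in>keys m. x v ^ lookup m v)"

lemma multiplicative_point [simp]: "multiplicative (point x)"
proof -
  have *: "point x m = (\<Prod>v\<in>A. x v ^ lookup m v)" if "finite A" "keys m \<subseteq> A" for A m
    unfolding point_def by (rule prod.mono_neutral_left) (use that in \<open>auto simp: in_keys_iff\<close>)
  show ?thesis
    unfolding multiplicative_def
  proof (intro conjI allI)
    show "point x 0 = 1" by (simp add: point_def)
    show "point x (m + n) = point x m * point x n" for m n
      using *[of "keys m \<union> keys n" "m + n"] *[of "keys m \<union> keys n" m] *[of "keys m \<union> keys n" n]
      by (simp add: lookup_add power_add prod.distrib)
  qed
qed

lemma point_single [simp]: "point x (single v n) = x v ^ n"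
  by (simp add: point_def)

lemma Pol_empty: "f \<in> Pol {} \<Longrightarrow> \<exists>c. f = cst c"
proof (induct rule: Pol_induct)
  case (single m c)
  then show ?case by (auto simp: cst_def intro!: exI[of _ c])
next
  case (add f g)
  then show ?case by (metis cst_simps(3))
qed (auto intro: exI[of _ 0])

section \<open>Ideals\<close>

lemma ideal_iff:
  "ideal I (mpoly_ring V) \<longleftrightarrow>
     I \<subseteq> Pol V \<and> 0 \<in> I \<and> (\<forall>a\<in>I. \<forall>b\<in>I. a + b \<in> I) \<and> (\<forall>r\<in>Pol V. \<forall>a\<in>I. r * a \<in> I)"
  (is "_ \<longleftrightarrow> ?R")
proof
  assume "ideal I (mpoly_ring V)"
  then have I: "ideal I (mpoly_ring V)" .
  note A = ideal.axioms(1)[OF I]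
  show ?R
    using additive_subgroup.a_subset[OF A] additive_subgroup.zero_closed[OF A]
      additive_subgroup.a_closed[OF A] ideal.I_l_closed[OF I] by auto
next
  assume R: ?R
  interpret cring "mpoly_ring V :: ('a, 'b) mpolynomial ring" by (rule mpoly_cring)
  have um: "- a \<in> I" if "a \<in> I" for a
  proof -
    have "- 1 \<in> Pol V" by (rule Pol_uminus) simp
    then have "- 1 * a \<in> I" using R that by blast
    then show ?thesis by simp
  qed
  have inv: "\<ominus>\<^bsub>mpoly_ring V\<^esub> a = - a" if "a \<in> I" for a
    using that R um by (intro sum_zero_eq_neg[symmetric, of "- a" a, simplified]) auto
  show "ideal I (mpoly_ring V)"
  proof (rule idealI[OF mpoly_ring_ring])
    show "subgroup I (add_monoid (mpoly_ring V))"
      by (rule add.subgroupI) (use R inv um in \<open>auto simp flip: a_inv_def\<close>)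
  next
    fix a x :: "('a, 'b) mpolynomial" assume "a \<in> I" "x \<in> Pol V"
    then have "x * a \<in> I" using R by blast
    then show "x \<otimes>\<^bsub>mpoly_ring V\<^esub> a \<in> I" "a \<otimes>\<^bsub>mpoly_ring V\<^esub> x \<in> I"
      by (simp_all add: mult.commute)
  qed
qed

lemma idealD:
  assumes "ideal I (mpoly_ring V)"
  shows ideal_subset: "I \<subseteq> Pol V" and ideal_zero: "0 \<in> I"
    and ideal_add: "a \<in> I \<Longrightarrow> b \<in> I \<Longrightarrow> a + b \<in> I"
    and ideal_mult: "r \<in> Pol V \<Longrightarrow> a \<in> I \<Longrightarrow> r * a \<in> I"
    and ideal_mult': "r \<in> Pol V \<Longrightarrow> a \<in> I \<Longrightarrow> a * r \<in> I"
  using assms by (auto simp: ideal_iff mult.commute)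

lemma ideal_uminus: "ideal I (mpoly_ring V) \<Longrightarrow> a \<in> I \<Longrightarrow> - a \<in> I"
  using ideal_mult[of I V "- 1" a] Pol_uminus[OF Pol_one] by auto

lemma ideal_diff: "ideal I (mpoly_ring V) \<Longrightarrow> a \<in> I \<Longrightarrow> b \<in> I \<Longrightarrow> a - b \<in> I"
  using ideal_add[of I V a "- b"] ideal_uminus[of I V b] by auto

lemma ideal_sum:
  "ideal I (mpoly_ring V) \<Longrightarrow> (\<And>i. i \<in> A \<Longrightarrow> f i \<in> I) \<Longrightarrow> sum f A \<in> I"
  by (induct A rule: infinite_finite_induct) (auto intro: ideal_add ideal_zero)

text \<open>
  The workhorse for congruences: membership in an ideal only depends on the residue class.
\<close>

lemma ideal_diff_iff: "ideal I (mpoly_ring V) \<Longrightarrow> a - b \<in> I \<Longrightarrow> a \<in> I \<longleftrightarrow> b \<in> I"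
  using ideal_add[of I V "a - b" b] ideal_diff[of I V a "a - b"] by auto

lemma ideal_unit_iff: "ideal I (mpoly_ring V) \<Longrightarrow> I = Pol V \<longleftrightarrow> 1 \<in> I"
proof
  assume I: "ideal I (mpoly_ring V)" and "1 \<in> I"
  then have "r \<in> I" if "r \<in> Pol V" for r using ideal_mult[OF I that, of 1] by simp
  then show "I = Pol V" using ideal_subset[OF I] by auto
qed simp

lemma ideal_idl: "S \<subseteq> Pol V \<Longrightarrow> ideal (idl V S) (mpoly_ring V)"
  by (rule ring.genideal_ideal[OF mpoly_ring_ring])
lemma idl_superset: "S \<subseteq> Pol V \<Longrightarrow> S \<subseteq> idl V S"
  by (rule ring.genideal_self[OF mpoly_ring_ring])
lemma idl_minimal: "ideal I (mpoly_ring V) \<Longrightarrow> S \<subseteq> I \<Longrightarrow> idl V S \<subseteq> I"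
  by (rule ring.genideal_minimal[OF mpoly_ring_ring])

lemma idl_one: "idl V {1} = Pol V"
  using ring.genideal_one[OF mpoly_ring_ring, of V] by simp

lemma idl_mono: "S \<subseteq> T \<Longrightarrow> T \<subseteq> Pol V \<Longrightarrow> idl V S \<subseteq> idl V T"
  by (meson ideal_idl idl_minimal idl_superset order_trans)

lemma primeideal_iff:
  "primeideal P (mpoly_ring V) \<longleftrightarrow> ideal P (mpoly_ring V) \<and> 1 \<notin> P \<and>
     (\<forall>a\<in>Pol V. \<forall>b\<in>Pol V. a * b \<in> P \<longrightarrow> a \<in> P \<or> b \<in> P)" (is "_ \<longleftrightarrow> ?R")
proof
  assume "primeideal P (mpoly_ring V)"
  then interpret primeideal P "mpoly_ring V" .
  show ?R using is_ideal I_notcarr I_prime ideal_unit_iff[OF is_ideal] by auto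
next
  assume ?R
  then show "primeideal P (mpoly_ring V)"
    by (intro primeidealI mpoly_cring) (auto simp: ideal_unit_iff)
qed

lemma prime_ideal: "primeideal P (mpoly_ring V) \<Longrightarrow> ideal P (mpoly_ring V)"
  by (simp add: primeideal_iff)
lemma prime_one: "primeideal P (mpoly_ring V) \<Longrightarrow> 1 \<notin> P"
  by (simp add: primeideal_iff)
lemma prime_mult:
  "primeideal P (mpoly_ring V) \<Longrightarrow> a * b \<in> P \<Longrightarrow> a \<in> Pol V \<Longrightarrow> b \<in> Pol V \<Longrightarrow> a \<in> P \<or> b \<in> P"
  by (auto simp: primeideal_iff)
lemma prime_power:
  "primeideal P (mpoly_ring V) \<Longrightarrow> a ^ n \<in> P \<Longrightarrow> a \<in> Pol V \<Longrightarrow> a \<in> P"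
  by (induct n) (auto dest: prime_one prime_mult)

lemma prime_cst:
  assumes "primeideal P (mpoly_ring V)" "cst c \<in> P" shows "c = 0"
proof (rule ccontr)
  assume "c \<noteq> 0"
  then have "cst (inverse c) * cst c = (1 :: ('a, 'b) mpolynomial)"
    by (metis cst_simps(2) cst_simps(4) left_inverse)
  then show False
    using ideal_mult[OF prime_ideal[OF assms(1)] Pol_cst assms(2)] prime_one[OF assms(1)] by metis
qed

lemma ideal_contract:
  assumes "ideal I (mpoly_ring V)" "U \<subseteq> V"
  shows "ideal (I \<inter> Pol U) (mpoly_ring U)"
  unfolding ideal_iff
  using assms(1) Pol_mono[OF assms(2)] by (auto intro: ideal_zero ideal_add ideal_mult)

lemma ideal_power_diff:
  assumes P: "ideal P (mpoly_ring V)" and xy: "x \<in> Pol V" "y \<in> Pol V" "x - y \<in> P"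
  shows "x ^ n - y ^ n \<in> P"
proof (induct n)
  case 0
  then show ?case using ideal_zero[OF P] by simp
next
  case (Suc n)
  have "x * (x ^ n - y ^ n) + y ^ n * (x - y) \<in> P"
    using Suc xy by (intro ideal_add[OF P] ideal_mult[OF P]) auto
  then show ?case by (simp add: algebra_simps)
qed

lemma ideal_singleton_zero: "ideal {0} (mpoly_ring V)"
  by (auto simp: ideal_iff)

lemma idl_subset_larger:
  assumes "S \<subseteq> Pol U" "U \<subseteq> V" shows "idl U S \<subseteq> idl V S"
proof -
  have SV: "S \<subseteq> Pol V" using assms Pol_mono by blast
  have "idl U S \<subseteq> idl V S \<inter> Pol U"
    using idl_superset[OF SV] assms by (intro idl_minimal ideal_contract[OF ideal_idl[OF SV]]) auto
  then show ?thesis by blast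
qed

section \<open>Expansion in powers of one variable\<close>

text \<open>
  A bound on the \<open>y\<close>-degree. Unlike \<^const>\<open>y_degree\<close> it is meaningful for the zero polynomial and is
  preserved by sums, so leading coefficients are studied as coefficients at a bound, which may vanish.
\<close>

definition y_le :: "'v \<Rightarrow> nat \<Rightarrow> ('v, 'k::field) mpolynomial \<Rightarrow> bool" where
  "y_le y d f \<longleftrightarrow> (\<forall>m\<in>keys f. lookup m y \<le> d)"

lemma mres_singleton: "mres {y} m = single y (lookup m y)"
  by (rule poly_mapping_eqI) (simp add: lookup_single when_def)

lemma y_coeff_slice:
  "y_coeff y f j = slice {y} (\<lambda>n. if n = single y j then 1 else 0) f"
proof -
  have inj: "single y i = single y j \<longleftrightarrow> i = j" for i :: nat
    by (metis lookup_single_eq)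
  have eq: "m - single y j = mres (- {y}) m" if "lookup m y = j" for m
    by (rule poly_mapping_eqI) (use that in \<open>auto simp: lookup_minus lookup_single when_def\<close>)
  show ?thesis
    unfolding y_coeff_def slice_def
    by (rule sum.mono_neutral_cong_left) (auto simp: eq mres_singleton inj)
qed

lemma y_coeff_zero [simp]: "y_coeff y 0 j = 0"
  and y_coeff_add [simp]: "y_coeff y (f + g) j = y_coeff y f j + y_coeff y g j"
  and y_coeff_diff [simp]: "y_coeff y (f - g) j = y_coeff y f j - y_coeff y g j"
  and y_coeff_in_Pol [intro]: "f \<in> Pol V \<Longrightarrow> y_coeff y f j \<in> Pol (V - {y})"
  and y_coeff_linear: "r \<in> Pol W \<Longrightarrow> y \<notin> W \<Longrightarrow> y_coeff y (r * f) j = r * y_coeff y f j"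
  and y_coeff_slice_commute: "y \<notin> Y \<Longrightarrow> y_coeff y (slice Y \<xi> f) j = slice Y \<xi> (y_coeff y f j)"
  by (auto simp: y_coeff_slice slice_linear_left slice_commute)

lemma y_coeff_single:
  "y_coeff y (single m c) j = (if lookup m y = j then single (mres (- {y}) m) c else 0)"
proof -
  have inj: "single y i = single y j \<longleftrightarrow> i = j" for i :: nat
    by (metis lookup_single_eq)
  show ?thesis by (simp add: y_coeff_slice mres_singleton inj)
qed

lemma y_coeff_sum: "y_coeff y (sum f A) j = (\<Sum>i\<in>A. y_coeff y (f i) j)"
  by (simp add: y_coeff_slice slice_sum)

lemma lookup_y_coeff:
  "lookup (y_coeff y f j) n = (if lookup n y = 0 then lookup f (n + single y j) else 0)"
proof (induct f rule: mpoly_induct)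
  case (single m c)
  have "m = n + single y j \<longleftrightarrow> lookup m y = j \<and> mres (- {y}) m = n" if "lookup n y = 0"
    using that by (auto simp: poly_mapping_eq_iff fun_eq_iff lookup_add lookup_single when_def)
  then show ?case by (auto simp: y_coeff_single lookup_single when_def)
qed (auto simp: lookup_add)

lemma mvar_power: "mvar y ^ j = (single (single y j) 1 :: ('v, 'k::field) mpolynomial)"
proof (induct j)
  case (Suc j)
  then show ?case by (simp add: mvar_def mult_single flip: single_add)
qed simp

lemma mres_add_single: "lookup m y = j \<Longrightarrow> mres (- {y}) m + single y j = m"
  by (rule poly_mapping_eqI) (auto simp: lookup_add lookup_single when_def)

lemma y_le_add [intro]: "y_le y d f \<Longrightarrow> y_le y d g \<Longrightarrow> y_le y d (f + g)"
  using keys_add[of f g] by (auto simp: y_le_def)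
lemma y_le_uminus [intro]: "y_le y d f \<Longrightarrow> y_le y d (- f)"
  by (simp add: y_le_def in_keys_iff)
lemma y_le_diff [intro]: "y_le y d f \<Longrightarrow> y_le y d g \<Longrightarrow> y_le y d (f - g)"
  using y_le_add[of y d f "- g"] by auto
lemma y_le_zero [simp]: "y_le y d 0" by (simp add: y_le_def)
lemma y_le_mono: "y_le y d f \<Longrightarrow> d \<le> e \<Longrightarrow> y_le y e f"
  by (auto simp: y_le_def)
lemma y_le_mult: "y_le y d f \<Longrightarrow> y_le y e g \<Longrightarrow> y_le y (d + e) (f * g)"
  using keys_mult[of f g] by (fastforce simp: y_le_def lookup_add intro: add_mono)
lemma y_le_Pol: "f \<in> Pol V \<Longrightarrow> y \<notin> V \<Longrightarrow> y_le y d f"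
  unfolding y_le_def Pol_iff by (metis in_keys_iff in_mono zero_le)
lemma y_le_0_Pol: "f \<in> Pol V \<Longrightarrow> y_le y 0 f \<Longrightarrow> f \<in> Pol (V - {y})"
  by (auto simp: y_le_def Pol_iff in_keys_iff)
lemma y_le_mvar_power: "y_le y j (mvar y ^ j :: ('v, 'k::field) mpolynomial)"
  by (simp add: mvar_power y_le_def)
lemma y_le_ex: "\<exists>d. y_le y d f"
  by (auto simp: y_le_def intro!: exI[of _ "Max ((\<lambda>m. lookup m y) ` keys f)"])

lemma y_coeff_eq_0: "y_le y d f \<Longrightarrow> d < j \<Longrightarrow> y_coeff y f j = 0"
proof (rule poly_mapping_eqI)
  fix n assume f: "y_le y d f" "d < j"
  have "lookup (n + single y j) y \<ge> j" by (simp add: lookup_add)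
  then have "n + single y j \<notin> keys f" using f unfolding y_le_def by (meson leD le_trans)
  then show "lookup (y_coeff y f j) n = lookup 0 n" by (simp add: lookup_y_coeff in_keys_iff)
qed

lemma y_leI: "(\<And>j. d < j \<Longrightarrow> y_coeff y f j = 0) \<Longrightarrow> y_le y d f"
proof (unfold y_le_def, intro ballI, rule ccontr)
  fix m assume *: "\<And>j. d < j \<Longrightarrow> y_coeff y f j = 0" and m: "m \<in> keys f" "\<not> lookup m y \<le> d"
  have "lookup (y_coeff y f (lookup m y)) (mres (- {y}) m) = lookup f m"
    by (simp add: lookup_y_coeff mres_add_single)
  with * m show False by (auto simp: in_keys_iff)
qed

lemma y_le_Suc: "y_le y (Suc d) f \<Longrightarrow> y_coeff y f (Suc d) = 0 \<Longrightarrow> y_le y d f"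
  by (rule y_leI) (metis Suc_lessI y_coeff_eq_0)

lemma y_expand:
  assumes "y_le y d f"
  shows "f = (\<Sum>j\<le>d. y_coeff y f j * mvar y ^ j)"
proof -
  have "(\<Sum>j\<le>d. y_coeff y g j * mvar y ^ j) = g" if "g \<in> {g. y_le y d g}" for g
  proof -
    have "g = (\<Sum>m\<in>keys g. single m (lookup g m))" by (rule mpoly_expand)
    have "(\<Sum>j\<le>d. y_coeff y g j * mvar y ^ j)
        = (\<Sum>j\<le>d. \<Sum>m\<in>keys g. y_coeff y (single m (lookup g m)) j * mvar y ^ j)"
      by (subst mpoly_expand[of g]) (simp add: y_coeff_sum sum_distrib_right)
    also have "\<dots> = (\<Sum>m\<in>keys g. \<Sum>j\<le>d. y_coeff y (single m (lookup g m)) j * mvar y ^ j)"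
      by (rule sum.swap)
    also have "\<dots> = (\<Sum>m\<in>keys g. single m (lookup g m))"
    proof (rule sum.cong[OF refl])
      fix m assume m: "m \<in> keys g"
      have "(\<Sum>j\<le>d. y_coeff y (single m (lookup g m)) j * mvar y ^ j)
          = (\<Sum>j\<le>d. if j = lookup m y then single m (lookup g m) else 0)"
        by (rule sum.cong) (auto simp: y_coeff_single mvar_power mult_single mres_add_single)
      then show "(\<Sum>j\<le>d. y_coeff y (single m (lookup g m)) j * mvar y ^ j) = single m (lookup g m)"
        using that m by (simp add: y_le_def)
    qed
    finally show ?thesis using mpoly_expand[of g] by simp
  qed
  from this[of f] show ?thesis using assms by simp
qed

lemma y_coeff_shift: "y_coeff y (mvar y ^ k * f) (j + k) = y_coeff y f j"
proof (induct f rule: mpoly_induct)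
  case (single m c)
  have "mres (- {y}) (single y k) = 0" by (rule mres_none) auto
  then show ?case by (auto simp: mvar_power mult_single y_coeff_single lookup_add)
qed (auto simp: algebra_simps)

lemma y_coeff_Pol: "c \<in> Pol V \<Longrightarrow> y \<notin> V \<Longrightarrow> y_coeff y c j = (if j = 0 then c else 0)"
  by (subst y_coeff_slice, subst slice_none[of c V]) (auto, metis lookup_single_eq lookup_zero neq0_conv)

lemma y_coeff_monomial:
  assumes "c \<in> Pol V" "y \<notin> V"
  shows "y_coeff y (c * mvar y ^ k) j = (if j = k then c else 0)"
proof -
  have "y_coeff y (mvar y ^ k :: ('a, 'b) mpolynomial) j = (if j = k then 1 else 0)"
    by (auto simp: mvar_power y_coeff_single mres_none)
  then show ?thesis by (simp add: y_coeff_linear[OF assms])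
qed

text \<open>
  Only the product of the two top coefficients contributes to the exponent \<open>d + e\<close>.
\<close>

lemma y_coeff_top_mult:
  assumes "y_le y d f" "y_le y e g"
  shows "y_coeff y (f * g) (d + e) = y_coeff y f d * y_coeff y g e"
proof -
  have *: "y_coeff y (f * g) (d + e) = (\<Sum>i\<le>d. \<Sum>j\<le>e. y_coeff y (y_coeff y f i * y_coeff y g j * mvar y ^ (i + j)) (d + e))"
    by (subst y_expand[OF assms(1)], subst y_expand[OF assms(2)])
       (simp add: sum_product y_coeff_sum power_add mult_ac)
  have P: "y_coeff y f i * y_coeff y g j \<in> Pol (UNIV - {y})" for i j
    by (intro Pol_mult y_coeff_in_Pol) (auto simp: Pol_iff)
  have "y_coeff y (f * g) (d + e) = (\<Sum>i\<le>d. \<Sum>j\<le>e. if i = d \<and> j = e then y_coeff y f i * y_coeff y g j else 0)"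
    unfolding * by (intro sum.cong refl) (auto simp: y_coeff_monomial[OF P])
  also have "\<dots> = (\<Sum>i\<le>d. if i = d then y_coeff y f d * y_coeff y g e else 0)"
    by (intro sum.cong refl) auto
  finally show ?thesis by simp
qed

lemma y_degree_props:
  assumes "f \<noteq> 0"
  shows y_le_y_degree: "y_le y (y_degree y f) f" and y_lead_coeff_nonzero: "y_lead_coeff y f \<noteq> 0"
proof -
  let ?S = "{j. y_coeff y f j \<noteq> 0}"
  obtain d where d: "y_le y d f" using y_le_ex[of y f] by auto
  have "?S \<subseteq> {..d}" using y_coeff_eq_0[OF d] by (auto simp: not_less[symmetric])
  then have fin: "finite ?S" by (rule finite_subset) simp
  have ne: "?S \<noteq> {}"
  proof
    assume "?S = {}"
    then have "f = 0" using y_expand[OF d] by simp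
    with assms show False by simp
  qed
  show "y_lead_coeff y f \<noteq> 0"
    unfolding y_lead_coeff_def y_degree_def using Max_in[OF fin ne] by blast
  show "y_le y (y_degree y f) f"
    unfolding y_degree_def using Max_ge[OF fin] by (intro y_leI) (meson leD mem_Collect_eq)
qed

text \<open>
  By induction on the number of variables, since leading coefficients with respect to one of them
  multiply. The type of variables carries no order, so the polynomial type itself is not known to be
  an integral domain.
\<close>

lemma Pol_no_zero_divisors:
  assumes "finite V" "f \<in> Pol V" "g \<in> Pol V" "f * g = 0"
  shows "f = 0 \<or> g = 0"
  using assms
proof (induct V arbitrary: f g rule: finite_induct)
  case empty
  then obtain a b where "f = cst a" "g = cst b" using Pol_empty by metis
  with empty show ?case by (simp flip: cst_simps)
next
  case (insert v V)
  show ?case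
  proof (rule ccontr)
    assume "\<not> ?thesis"
    then have nz: "f \<noteq> 0" "g \<noteq> 0" by auto
    note le = y_le_y_degree[OF nz(1), of v] y_le_y_degree[OF nz(2), of v]
    have "y_lead_coeff v f \<noteq> 0" "y_lead_coeff v g \<noteq> 0"
      using nz by (simp_all add: y_lead_coeff_nonzero)
    moreover have "y_lead_coeff v f * y_lead_coeff v g = 0"
      using y_coeff_top_mult[OF le] insert.prems by (simp add: y_lead_coeff_def)
    moreover have "y_lead_coeff v h \<in> Pol V" if "h \<in> Pol (insert v V)" for h
      using y_coeff_in_Pol[OF that, of v] insert.hyps by (simp add: y_lead_coeff_def)
    ultimately show False using insert by blast
  qed
qed

lemma lookup_single_mult:
  fixes g :: "('v, 'k::field) mpolynomial"
  shows "lookup (single k c * g) (k + n) = c * lookup g n"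
  by (induct g rule: mpoly_induct)
     (auto simp: mult_single lookup_single when_def lookup_add distrib_left)

lemma lookup_single_mult_eq_0:
  fixes g :: "('v, 'k::field) mpolynomial"
  assumes "\<And>n. m \<noteq> k + n"
  shows "lookup (single k c * g) m = 0"
  using assms[symmetric]
  by (induct g rule: mpoly_induct)
     (auto simp: mult_single lookup_single when_def lookup_add distrib_left)

lemma lookup_y_initial:
  fixes f :: "('v, 'k::field) mpolynomial"
  shows "lookup (y_initial y f) m = (if lookup m y = y_degree y f then lookup f m else 0)"
proof -
  let ?d = "y_degree y f"
  have i: "y_initial y f = single (single y ?d) 1 * y_coeff y f ?d"
    by (simp add: y_initial_def mvar_power y_lead_coeff_def mult.commute)
  show ?thesis
  proof (cases "lookup m y \<ge> ?d")
    case True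
    then have m: "m = single y ?d + (m - single y ?d)"
      by (intro poly_mapping_eqI) (auto simp: lookup_add lookup_minus lookup_single when_def)
    have "lookup (y_initial y f) m = lookup (y_coeff y f ?d) (m - single y ?d)"
      unfolding i by (subst m, subst lookup_single_mult) simp
    then show ?thesis using True m by (auto simp: lookup_y_coeff lookup_minus add.commute)
  next
    case False
    have "lookup (y_initial y f) m = 0"
      unfolding i by (rule lookup_single_mult_eq_0) (use False in \<open>auto simp: lookup_add\<close>)
    with False show ?thesis by simp
  qed
qed

section \<open>Monomial orders\<close>

text \<open>
  The lexicographic order, in which the variables at the front of the list weigh most: an order with
  \<open>y\<close> in front compares \<open>y\<close>-degrees first and hence is \<open>y\<close>-compatible.
\<close>

definition lex_order :: "'v list \<Rightarrow> 'v monomial rel" where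
  "lex_order vs = {(a, b). a \<in> monomials (set vs) \<and> b \<in> monomials (set vs) \<and>
     (a = b \<or> (map (lookup a) vs, map (lookup b) vs) \<in> lex less_than)}"

lemma lex_less_than_total:
  "map (lookup a) vs \<noteq> map (lookup b) vs \<Longrightarrow>
     (map (lookup a) vs, map (lookup b) vs) \<in> lex less_than \<or> (map (lookup b) vs, map (lookup a) vs) \<in> lex less_than"
  by (induct vs) auto

lemma lex_less_than_translate:
  "(map (lookup a) vs, map (lookup b) vs) \<in> lex less_than \<Longrightarrow>
     (map (lookup (a + c)) vs, map (lookup (b + c)) vs) \<in> lex less_than"
  by (induct vs) (auto simp: lookup_add)

lemma monomial_order_lex: "monomial_order (set vs) (lex_order vs)"
proof -
  let ?V = "set vs" and ?e = "\<lambda>m. map (lookup m) vs"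
  have inj: "a = b" if "?e a = ?e b" "a \<in> monomials ?V" "b \<in> monomials ?V" for a b
    by (rule poly_mapping_eqI) (use that in \<open>metis (mono_tags, lifting) in_keys_iff in_mono map_eq_conv mem_Collect_eq monomials_def\<close>)
  have wf: "wf (lex less_than)" by blast
  have irr: "(xs, xs) \<notin> lex less_than" for xs using wf by (meson wf_not_refl)
  have tr: "trans (lex less_than)" by (simp add: lex_transI)
  have "lex_order vs - Id \<subseteq> inv_image (lex less_than) ?e"
    by (auto simp: lex_order_def)
  then have "wf (lex_order vs - Id)"
    using wf_subset[OF wf_inv_image[OF wf]] by blast
  moreover have "trans (lex_order vs)"
    by (rule transI) (use tr in \<open>auto simp: lex_order_def elim: transE\<close>)
  moreover have "antisym (lex_order vs)"
    by (rule antisymI) (use tr irr in \<open>auto simp: lex_order_def dest: transD\<close>)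
  moreover have "total_on (monomials ?V) (lex_order vs)"
    unfolding total_on_def lex_order_def using lex_less_than_total inj by blast
  ultimately have "well_order_on (monomials ?V) (lex_order vs)"
    unfolding order_on_defs well_order_on_def by (auto simp: refl_on_def lex_order_def)
  moreover have "(a + c, b + c) \<in> lex_order vs" if "c \<in> monomials ?V" "(a, b) \<in> lex_order vs" for a b c
    using that lex_less_than_translate[of a vs b c] by (auto simp: lex_order_def monomials_def)
  ultimately show ?thesis unfolding monomial_order_def by blast
qed

context
  fixes V :: "'v set" and ord :: "'v monomial rel"
  assumes ord: "monomial_order V ord"
begin

lemma mo_refl: "m \<in> monomials V \<Longrightarrow> (m, m) \<in> ord"
  using ord by (auto simp: monomial_order_def order_on_defs well_order_on_def refl_on_def)
lemma mo_antisym: "(m, n) \<in> ord \<Longrightarrow> (n, m) \<in> ord \<Longrightarrow> m = n"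
  using ord by (auto simp: monomial_order_def order_on_defs well_order_on_def antisym_def)
lemma mo_trans: "(m, n) \<in> ord \<Longrightarrow> (n, k) \<in> ord \<Longrightarrow> (m, k) \<in> ord"
  using ord by (auto simp: monomial_order_def order_on_defs well_order_on_def elim: transE)
lemma mo_total: "m \<in> monomials V \<Longrightarrow> n \<in> monomials V \<Longrightarrow> (m, n) \<in> ord \<or> (n, m) \<in> ord"
  using ord mo_refl by (cases "m = n") (auto simp: monomial_order_def order_on_defs well_order_on_def total_on_def)
lemma mo_wf: "wf (ord - Id)"
  using ord by (auto simp: monomial_order_def well_order_on_def)
lemma mo_translate: "(m, n) \<in> ord \<Longrightarrow> k \<in> monomials V \<Longrightarrow> (k + m, k + n) \<in> ord"
  using ord unfolding monomial_order_def by (metis add.commute)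

lemma lead_monomialI:
  "m \<in> keys f \<Longrightarrow> (\<And>m'. m' \<in> keys f \<Longrightarrow> (m', m) \<in> ord) \<Longrightarrow> lead_monomial ord f = m"
  unfolding lead_monomial_def by (rule the_equality) (auto intro: mo_antisym)

lemma finite_max: "finite S \<Longrightarrow> S \<noteq> {} \<Longrightarrow> S \<subseteq> monomials V \<Longrightarrow> \<exists>m\<in>S. \<forall>n\<in>S. (n, m) \<in> ord"
proof (induct S rule: finite_ne_induct)
  case (singleton x)
  then show ?case using mo_refl by simp
next
  case (insert x S)
  then obtain m where m: "m \<in> S" "\<forall>n\<in>S. (n, m) \<in> ord" by auto
  have "x \<in> monomials V" "m \<in> monomials V" using insert m by auto
  from mo_total[OF this] show ?case
  proof
    assume "(x, m) \<in> ord" then show ?thesis using m by auto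
  next
    assume "(m, x) \<in> ord"
    then have "\<forall>n\<in>insert x S. (n, x) \<in> ord" using m mo_refl mo_trans insert.prems by blast
    then show ?thesis by blast
  qed
qed

lemma lead_monomial_props:
  fixes f :: "('v, 'k::field) mpolynomial"
  assumes "f \<in> Pol V" "f \<noteq> 0"
  shows lead_monomial_in_keys: "lead_monomial ord f \<in> keys f"
    and lead_monomial_max: "m \<in> keys f \<Longrightarrow> (m, lead_monomial ord f) \<in> ord"
proof -
  have "keys f \<noteq> {}" "keys f \<subseteq> monomials V" using assms by (auto simp: mpoly_ring_def)
  then obtain m where m: "m \<in> keys f" "\<forall>n\<in>keys f. (n, m) \<in> ord"
    using finite_max[of "keys f"] by auto
  then have "lead_monomial ord f = m" by (intro lead_monomialI) auto
  with m show "lead_monomial ord f \<in> keys f" "m \<in> keys f \<Longrightarrow> (m, lead_monomial ord f) \<in> ord" for m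
    by auto
qed

text \<open>
  The leading monomial occurs in the initial form, so it carries the full \<open>y\<close>-degree. In this form
  compatibility enters the arguments about \<open>C\<close> and \<open>N\<close>.
\<close>

lemma y_compatible_lead_monomial:
  fixes f :: "('v, 'k::field) mpolynomial"
  assumes "y_compatible TYPE('k) V y ord" "f \<in> Pol V" "f \<noteq> 0"
  shows "lookup (lead_monomial ord f) y = y_degree y f"
proof -
  let ?i = "y_initial y f" and ?m = "lead_monomial ord f"
  have c: "lead_term ord f = lead_term ord ?i" using assms by (auto simp: y_compatible_def)
  have m: "lookup f ?m \<noteq> 0" using lead_monomial_in_keys[OF assms(2,3)] by (simp add: in_keys_iff)
  then have "lookup (lead_term ord ?i) ?m \<noteq> 0" unfolding c[symmetric] by (simp add: lead_term_def)
  then have "?m = lead_monomial ord ?i" "lookup ?i (lead_monomial ord ?i) \<noteq> 0"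
    by (auto simp: lead_term_def lookup_single when_def split: if_splits)
  then show ?thesis by (metis lookup_y_initial)
qed

end

lemma y_compatible_lex: "y_compatible TYPE('k::field) (set (y # vs)) y (lex_order (y # vs))"
  unfolding y_compatible_def
proof (intro ballI impI)
  fix f :: "('a, 'k) mpolynomial"
  let ?ord = "lex_order (y # vs)" and ?m = "lead_monomial (lex_order (y # vs)) f"
  assume f: "f \<in> Pol (set (y # vs))" "f \<noteq> 0"
  note mo = monomial_order_lex[of "y # vs"]
  note m = lead_monomial_in_keys[OF mo f] and max = lead_monomial_max[OF mo f]
  have le: "lookup n y \<le> lookup ?m y" if "n \<in> keys f" for n
    using max[OF that] by (auto simp: lex_order_def)
  have "y_degree y f = lookup ?m y"
  proof (rule antisym)
    show "lookup ?m y \<le> y_degree y f"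
      using y_le_y_degree[OF f(2)] m by (auto simp: y_le_def)
    have "y_le y (lookup ?m y) f" using le by (auto simp: y_le_def)
    then show "y_degree y f \<le> lookup ?m y"
      using y_lead_coeff_nonzero[OF f(2)] y_coeff_eq_0 unfolding y_lead_coeff_def
      by (meson linorder_not_less)
  qed
  then have k: "?m \<in> keys (y_initial y f)" and sub: "keys (y_initial y f) \<subseteq> keys f"
    using m by (auto simp: in_keys_iff lookup_y_initial split: if_splits)
  have "lead_monomial ?ord (y_initial y f) = ?m"
    by (rule lead_monomialI[OF mo k]) (use max sub in auto)
  then show "lead_term ?ord f = lead_term ?ord (y_initial y f)"
    using k by (auto simp: lead_term_def lookup_y_initial in_keys_iff split: if_splits)
qed

lemma ex_y_compatible_order:
  assumes "finite V" "y \<in> V"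
  shows "\<exists>ord. monomial_order V ord \<and> y_compatible TYPE('k::field) V y ord"
proof -
  obtain vs where "set vs = V" using finite_list[OF assms(1)] by blast
  then have "set (y # vs) = V" using assms(2) by auto
  then show ?thesis using monomial_order_lex[of "y # vs"] y_compatible_lex[of y vs] by metis
qed

section \<open>Groebner bases and Noetherianity\<close>

text \<open>
  Every sequence of naturals has a monotone subsequence, and a decreasing one is eventually constant;
  the coordinates are treated one after the other.
\<close>

lemma monotone_subsequence:
  fixes f :: "nat \<Rightarrow> 'v \<Rightarrow> nat"
  assumes "finite V"
  shows "\<exists>r :: nat \<Rightarrow> nat. strict_mono r \<and> (\<forall>v\<in>V. mono (\<lambda>n. f (r n) v))"
  using assms
proof (induct V rule: finite_induct)
  case empty
  then show ?case by (auto intro!: exI[of _ id] simp: strict_mono_def)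
next
  case (insert v V)
  then obtain r :: "nat \<Rightarrow> nat" where r: "strict_mono r" "\<forall>v\<in>V. mono (\<lambda>n. f (r n) v)" by auto
  obtain q where q: "strict_mono q" "monoseq (\<lambda>n. f (r (q n)) v)"
    using seq_monosub[of "\<lambda>n. f (r n) v"] by auto
  have "\<exists>N. \<forall>m n. N \<le> m \<and> m \<le> n \<longrightarrow> f (r (q m)) v \<le> f (r (q n)) v"
  proof (cases "\<forall>m n. m \<le> n \<longrightarrow> f (r (q m)) v \<le> f (r (q n)) v")
    case False
    then have dec: "\<forall>m n. m \<le> n \<longrightarrow> f (r (q n)) v \<le> f (r (q m)) v"
      using q(2) unfolding monoseq_def by blast
    \<comment> \<open>a decreasing sequence of naturals is constant from the point on where its minimum is attained\<close>
    obtain N where N: "\<And>n. f (r (q N)) v \<le> f (r (q n)) v"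
      using ex_has_least_nat[of "\<lambda>_. True" 0 "\<lambda>n. f (r (q n)) v"] by auto
    have "f (r (q m)) v \<le> f (r (q n)) v" if "N \<le> m" for m n
      using dec N that by (meson le_trans)
    then show ?thesis by blast
  qed auto
  then obtain N where N: "\<And>m n. N \<le> m \<Longrightarrow> m \<le> n \<Longrightarrow> f (r (q m)) v \<le> f (r (q n)) v" by blast
  let ?r = "\<lambda>n. r (q (N + n))"
  have "strict_mono ?r" using r(1) q(1) by (auto simp: strict_mono_def)
  moreover have "mono (\<lambda>n. f (?r n) v)" using N by (auto intro!: monoI)
  moreover have "mono (\<lambda>n. f (?r n) w)" if "w \<in> V" for w
  proof (rule monoI)
    fix m n :: nat assume "m \<le> n"
    then have "q (N + m) \<le> q (N + n)" using q(1) by (simp add: strict_mono_less_eq)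
    then show "f (?r m) w \<le> f (?r n) w" using r(2) that by (auto dest: monoD)
  qed
  ultimately show ?case by blast
qed

text \<open>
  The monomials of \<open>S\<close> that are minimal for divisibility dominate all others. If there were
  infinitely many, two of them would be comparable by \<open>monotone_subsequence\<close>.
\<close>

lemma dickson:
  fixes S :: "'v monomial set"
  assumes V: "finite V" and S: "S \<subseteq> monomials V"
  shows "\<exists>F. finite F \<and> F \<subseteq> S \<and> (\<forall>m\<in>S. \<exists>n\<in>F. \<exists>k\<in>monomials V. m = k + n)"
proof -
  define le where "le n m \<longleftrightarrow> (\<exists>k\<in>monomials V. m = k + n)" for n m :: "'v monomial"
  have leI: "le n m" if "n \<in> monomials V" "m \<in> monomials V" "\<And>v. v \<in> V \<Longrightarrow> lookup n v \<le> lookup m v" for n m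
  proof -
    have "lookup n v \<le> lookup m v" for v
    proof (cases "v \<in> V")
      case False
      then have "v \<notin> keys n" using that(1) by (auto simp: monomials_def)
      then show ?thesis by (simp add: in_keys_iff)
    qed (use that in simp)
    then have "m = (m - n) + n" by (intro poly_mapping_eqI) (simp add: lookup_add lookup_minus)
    moreover have "m - n \<in> monomials V"
      using that(2) by (auto simp: monomials_def in_keys_iff lookup_minus subset_iff)
    ultimately show ?thesis unfolding le_def by blast
  qed
  define F where "F = {m \<in> S. \<forall>n\<in>S. le n m \<longrightarrow> n = m}"
  have dom: "\<exists>n\<in>F. le n m" if "m \<in> S" for m
    using that
  proof (induct "\<Sum>v\<in>V. lookup m v" arbitrary: m rule: less_induct)
    case (less m)
    show ?case
    proof (cases "m \<in> F")
      case True
      then show ?thesis using leI[of m m] less S by blast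
    next
      case False
      then obtain n where n: "n \<in> S" "le n m" "n \<noteq> m" using less by (auto simp: F_def)
      then obtain k where k: "k \<in> monomials V" "m = k + n" by (auto simp: le_def)
      have "k \<noteq> 0" using k n by auto
      then obtain v where "v \<in> keys k" by (metis keys_eq_empty ex_in_conv)
      then have v: "v \<in> V" "lookup k v > 0" using k by (auto simp: monomials_def in_keys_iff)
      have "(\<Sum>v\<in>V. lookup n v) < (\<Sum>v\<in>V. lookup m v)"
        by (rule sum_strict_mono_ex1) (use v V k in \<open>auto simp: lookup_add intro!: bexI[of _ v]\<close>)
      then obtain n' where n': "n' \<in> F" "le n' n" using less n by blast
      then obtain k' where "k' \<in> monomials V" "n = k' + n'" by (auto simp: le_def)
      then have "m = (k + k') + n'" "k + k' \<in> monomials V"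
        using k by (simp_all add: add.assoc monomials_def)
      then have "le n' m" unfolding le_def by blast
      then show ?thesis using n' by blast
    qed
  qed
  have "finite F"
  proof (rule ccontr)
    assume "infinite F"
    then obtain f :: "nat \<Rightarrow> 'v monomial" where f: "inj f" "range f \<subseteq> F"
      using infinite_countable_subset by blast
    obtain r :: "nat \<Rightarrow> nat" where r: "strict_mono r" "\<forall>v\<in>V. mono (\<lambda>n. lookup (f (r n)) v)"
      using monotone_subsequence[OF V, of "\<lambda>n. lookup (f n)"] by blast
    have "f n \<in> monomials V" for n using f S by (auto simp: F_def)
    then have "le (f (r 0)) (f (r 1))"
      by (intro leI) (use r in \<open>auto dest: monoD\<close>)
    moreover have "f (r 1) \<in> F" "f (r 0) \<in> S" using f by (auto simp: F_def)
    ultimately have "f (r 0) = f (r 1)" unfolding F_def by blast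
    then have "r 0 = r 1" using f by (auto dest: injD)
    then show False using strict_monoD[OF r(1), of 0 1] by simp
  qed
  moreover have "F \<subseteq> S" by (auto simp: F_def)
  ultimately show ?thesis using dom unfolding le_def by blast
qed

lemma monomial_add_closed: "m \<in> monomials V \<Longrightarrow> n \<in> monomials V \<Longrightarrow> m + n \<in> monomials V"
  by (simp add: monomials_def)

lemma lead_monomial_Pol:
  assumes "monomial_order V ord" "f \<in> Pol V" "f \<noteq> 0"
  shows "lead_monomial ord f \<in> monomials V" and "lead_term ord f \<in> Pol V"
    and "lookup f (lead_monomial ord f) \<noteq> 0"
proof -
  have k: "lead_monomial ord f \<in> keys f" by (rule lead_monomial_in_keys[OF assms])
  then show "lead_monomial ord f \<in> monomials V" using assms(2) by (auto simp: mpoly_ring_def)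
  then show "lead_term ord f \<in> Pol V" by (auto simp: lead_term_def monomials_def)
  show "lookup f (lead_monomial ord f) \<noteq> 0" using k by (simp add: in_keys_iff)
qed

lemma ex_groebner_basis:
  fixes I :: "('v, 'k::field) mpolynomial set"
  assumes V: "finite V" and mo: "monomial_order V ord" and I: "ideal I (mpoly_ring V)"
  shows "\<exists>G. groebner_basis V ord I G"
proof -
  let ?lm = "lead_monomial ord :: ('v, 'k) mpolynomial \<Rightarrow> _"
  note P = lead_monomial_Pol[OF mo]
  have sub: "f \<in> Pol V" if "f \<in> I" for f using that ideal_subset[OF I] by blast
  have "?lm ` (I - {0}) \<subseteq> monomials V" using P sub by auto
  from dickson[OF V this] obtain F where F: "finite F" "F \<subseteq> ?lm ` (I - {0})"
    "\<forall>m\<in>?lm ` (I - {0}). \<exists>n\<in>F. \<exists>k\<in>monomials V. m = k + n" by blast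
  then obtain G where G: "finite G" "G \<subseteq> I - {0}" "F = ?lm ` G"
    by (meson finite_subset_image)
  have GI: "g \<in> I" "g \<noteq> 0" if "g \<in> G" for g using that G(2) by auto
  have GP: "lead_term ord ` G \<subseteq> Pol V" using GI P(2) sub by blast
  have "lead_term ord f \<in> idl V (lead_term ord ` G)" if f: "f \<in> I" "f \<noteq> 0" for f
  proof -
    obtain g k where g: "g \<in> G" "k \<in> monomials V" "?lm f = k + ?lm g"
      using F(3) f G(3) by blast
    have nz: "lookup g (?lm g) \<noteq> 0" using P(3) g GI sub by blast
    have "lead_term ord f = single k (lookup f (?lm f) / lookup g (?lm g)) * lead_term ord g"
      using g nz by (simp add: lead_term_def mult_single)
    moreover have "lead_term ord g \<in> idl V (lead_term ord ` G)"
      using idl_superset[OF GP] g by blast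
    moreover have "single k (lookup f (?lm f) / lookup g (?lm g)) \<in> Pol V"
      using g by (auto simp: monomials_def)
    ultimately show ?thesis using ideal_mult[OF ideal_idl[OF GP]] by metis
  qed
  then have "idl V {lead_term ord f |f. f \<in> I \<and> f \<noteq> 0} \<subseteq> idl V (lead_term ord ` G)"
    by (intro idl_minimal ideal_idl[OF GP]) auto
  moreover have "idl V (lead_term ord ` G) \<subseteq> idl V {lead_term ord f |f. f \<in> I \<and> f \<noteq> 0}"
    by (rule idl_mono) (use GI in blast, use P(2) sub in blast)
  ultimately show ?thesis using G unfolding groebner_basis_def by blast
qed

text \<open>
  The polynomials all of whose monomials are divisible by the leading monomial of some member of \<open>G\<close>
  form an ideal that contains the leading terms of \<open>G\<close>.
\<close>

lemma groebner_divides: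
  fixes I :: "('v, 'k::field) mpolynomial set"
  assumes mo: "monomial_order V ord" and I: "ideal I (mpoly_ring V)"
    and G: "groebner_basis V ord I G" and f: "f \<in> I" "f \<noteq> 0"
  shows "\<exists>g\<in>G. \<exists>k\<in>monomials V. lead_monomial ord f = k + lead_monomial ord g"
proof -
  note P = lead_monomial_Pol[OF mo]
  have GI: "G \<subseteq> I - {0}" using G by (simp add: groebner_basis_def)
  have sub: "h \<in> Pol V" if "h \<in> I" for h using that ideal_subset[OF I] by blast
  let ?D = "{p \<in> (Pol V :: ('v, 'k) mpolynomial set). \<forall>m\<in>keys p. \<exists>g\<in>G. \<exists>k\<in>monomials V. m = k + lead_monomial ord g}"
  have "ideal ?D (mpoly_ring V)"
    unfolding ideal_iff
  proof (intro conjI ballI)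
    fix a b :: "('v, 'k) mpolynomial" assume "a \<in> ?D" "b \<in> ?D"
    then show "a + b \<in> ?D" using keys_add[of a b] by blast
  next
    fix r a :: "('v, 'k) mpolynomial" assume r: "r \<in> Pol V" and a: "a \<in> ?D"
    have "\<exists>g\<in>G. \<exists>k\<in>monomials V. m = k + lead_monomial ord g" if m: "m \<in> keys (r * a)" for m
    proof -
      obtain m1 m2 where m': "m = m1 + m2" "m1 \<in> keys r" "m2 \<in> keys a"
        using m keys_mult[of r a] by blast
      obtain g k where g: "g \<in> G" "k \<in> monomials V" "m2 = k + lead_monomial ord g"
        using a m' by blast
      have "m1 \<in> monomials V" using m' r by (auto simp: mpoly_ring_def)
      then have "m1 + k \<in> monomials V" "m = (m1 + k) + lead_monomial ord g"
        using g m' by (auto simp: add.assoc monomial_add_closed)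
      then show ?thesis using g by blast
    qed
    then show "r * a \<in> ?D" using r a by auto
  qed auto
  moreover have "lead_term ord ` G \<subseteq> ?D"
  proof
    fix t assume "t \<in> lead_term ord ` G"
    then obtain g where g: "g \<in> G" "t = lead_term ord g" by blast
    have "t \<in> Pol V" using g P(2) GI sub by auto
    moreover have "keys t \<subseteq> {lead_monomial ord g}" using g by (simp add: lead_term_def)
    moreover have "lead_monomial ord g = 0 + lead_monomial ord g" "(0 :: 'v monomial) \<in> monomials V"
      by (simp_all add: monomials_def)
    ultimately show "t \<in> ?D" using g by blast
  qed
  ultimately have "idl V (lead_term ord ` G) \<subseteq> ?D" by (rule idl_minimal)
  moreover have "lead_term ord f \<in> idl V (lead_term ord ` G)"
  proof -
    have "{lead_term ord f |f. f \<in> I \<and> f \<noteq> 0} \<subseteq> Pol V" using P sub by auto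
    then have "lead_term ord f \<in> idl V {lead_term ord f |f. f \<in> I \<and> f \<noteq> 0}"
      using f idl_superset by blast
    then show ?thesis using G by (simp add: groebner_basis_def)
  qed
  ultimately have "lead_term ord f \<in> ?D" by blast
  moreover have "lead_monomial ord f \<in> keys (lead_term ord f)"
    using P(3)[OF sub[OF f(1)] f(2)] by (simp add: lead_term_def)
  ultimately show ?thesis by blast
qed

text \<open>
  Division with remainder as an induction principle: cancelling the leading term of \<open>f\<close> against a
  multiple of some \<open>g \<in> G\<close> lowers the leading monomial, which is possible finitely often.
\<close>

lemma groebner_induct:
  fixes I :: "('v, 'k::field) mpolynomial set"
  assumes mo: "monomial_order V ord" and I: "ideal I (mpoly_ring V)"
    and G: "groebner_basis V ord I G" and f: "f \<in> I"
    and zero: "Q 0"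
    and step: "\<And>f g k c. f \<in> I \<Longrightarrow> f \<noteq> 0 \<Longrightarrow> g \<in> G \<Longrightarrow> k \<in> monomials V \<Longrightarrow>
      lead_monomial ord f = k + lead_monomial ord g \<Longrightarrow> f - single k c * g \<in> I \<Longrightarrow>
      Q (f - single k c * g) \<Longrightarrow> Q f"
  shows "Q f"
proof -
  note P = lead_monomial_Pol[OF mo]
  have GI: "G \<subseteq> I - {0}" using G by (simp add: groebner_basis_def)
  have sub: "h \<in> Pol V" if "h \<in> I" for h using that ideal_subset[OF I] by blast
  have "\<forall>f\<in>I. f \<noteq> 0 \<longrightarrow> lead_monomial ord f = m \<longrightarrow> Q f" for m
  proof (induct m rule: wf_induct_rule[OF mo_wf[OF mo]])
    case (1 m)
    show ?case
    proof (intro ballI impI)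
      fix f assume f: "f \<in> I" "f \<noteq> 0" "lead_monomial ord f = m"
      obtain g k where g: "g \<in> G" "k \<in> monomials V" "m = k + lead_monomial ord g"
        using groebner_divides[OF mo I G f(1,2)] f(3) by blast
      have gI: "g \<in> I" "g \<noteq> 0" using g GI by auto
      let ?c = "lookup f m / lookup g (lead_monomial ord g)"
      let ?f = "f - single k ?c * g"
      have kP: "single k ?c \<in> Pol V" using g by (auto simp: monomials_def)
      have fI: "?f \<in> I" using ideal_diff[OF I f(1) ideal_mult[OF I kP gI(1)]] .
      have "Q ?f"
      proof (cases "?f = 0")
        case True
        then show ?thesis using zero by simp
      next
        case False
        let ?n = "lead_monomial ord ?f"
        have n: "lookup ?f ?n \<noteq> 0" using P(3)[OF sub[OF fI] False] .
        have "lookup ?f m = 0"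
          using P(3)[OF sub[OF gI(1)] gI(2)] by (simp add: lookup_minus g(3) lookup_single_mult)
        then have nm: "?n \<noteq> m" using n by auto
        have "(?n, m) \<in> ord"
        proof (cases "lookup f ?n = 0")
          case True
          then have "lookup (single k ?c * g) ?n \<noteq> 0" using n by (simp add: lookup_minus)
          then obtain j where j: "?n = k + j" by (metis lookup_single_mult_eq_0)
          then have "lookup g j \<noteq> 0" using \<open>lookup (single k ?c * g) ?n \<noteq> 0\<close> by (simp add: lookup_single_mult)
          then have "(j, lead_monomial ord g) \<in> ord"
            using lead_monomial_max[OF mo sub[OF gI(1)] gI(2)] by (simp add: in_keys_iff)
          then show ?thesis using mo_translate[OF mo _ g(2)] j g(3) by simp
        next
          case False
          then show ?thesis using lead_monomial_max[OF mo sub[OF f(1)] f(2)] f(3) by (simp add: in_keys_iff)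
        qed
        then show ?thesis using 1 nm fI False by auto
      qed
      then show "Q f" using step[OF f(1,2) g(1,2)] f(3) g(3) fI by blast
    qed
  qed
  then show ?thesis using f zero by (cases "f = 0") auto
qed

lemma groebner_generates:
  assumes "monomial_order V ord" "ideal I (mpoly_ring V)" "groebner_basis V ord I G"
    and W: "ideal W (mpoly_ring V)" "G \<subseteq> W"
  shows "I \<subseteq> W"
proof
  fix f assume f: "f \<in> I"
  show "f \<in> W"
    by (rule groebner_induct[OF assms(1-3) f])
       (use W in \<open>auto simp: monomials_def intro: ideal_zero\<close>,
        meson W Pol_single ideal_diff_iff ideal_mult monomials_def subsetD)
qed

text \<open>
  Hilbert's basis theorem in the form of a maximality principle. The union of a chain of ideals has a
  finite Groebner basis, which already lies in one member of the chain; that member is the union.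
\<close>

lemma ideals_maximal_element:
  fixes \<A> :: "('v, 'k::field) mpolynomial set set"
  assumes V: "finite V" and ne: "\<A> \<noteq> {}" and id: "\<And>I. I \<in> \<A> \<Longrightarrow> ideal I (mpoly_ring V)"
  shows "\<exists>M\<in>\<A>. \<forall>I\<in>\<A>. M \<subseteq> I \<longrightarrow> I = M"
proof (rule subset_Zorn_nonempty[OF ne])
  fix \<C> assume ne: "\<C> \<noteq> {}" and ch: "subset.chain \<A> \<C>"
  have sub: "\<C> \<subseteq> \<A>" and lin: "\<And>A B. A \<in> \<C> \<Longrightarrow> B \<in> \<C> \<Longrightarrow> A \<subseteq> B \<or> B \<subseteq> A"
    using ch by (auto simp: subset_chain_def)
  have idC: "ideal I (mpoly_ring V)" if "I \<in> \<C>" for I using that sub id by blast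
  let ?U = "\<Union>\<C>"
  have U: "ideal ?U (mpoly_ring V)"
    unfolding ideal_iff
  proof (intro conjI ballI)
    show "0 \<in> ?U" using ne idC ideal_zero by blast
    show "?U \<subseteq> Pol V" using idC ideal_subset by blast
    show "r * a \<in> ?U" if "r \<in> Pol V" "a \<in> ?U" for r a using that idC ideal_mult by blast
    show "a + b \<in> ?U" if ab: "a \<in> ?U" "b \<in> ?U" for a b
    proof -
      obtain A B where AB: "A \<in> \<C>" "B \<in> \<C>" "a \<in> A" "b \<in> B" using ab by blast
      then show ?thesis using lin[OF AB(1,2)] ideal_add[OF idC] by blast
    qed
  qed
  obtain vs where "set vs = V" using finite_list[OF V] by blast
  then have mo: "monomial_order V (lex_order vs)" using monomial_order_lex by blast
  obtain G where G: "groebner_basis V (lex_order vs) ?U G"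
    using ex_groebner_basis[OF V mo U] by blast
  then have "finite G" "G \<subseteq> ?U" by (auto simp: groebner_basis_def)
  then have "\<exists>W\<in>\<C>. G \<subseteq> W"
  proof (induct G rule: finite_induct)
    case (insert x F)
    then obtain W W' where "W \<in> \<C>" "F \<subseteq> W" "W' \<in> \<C>" "x \<in> W'" by auto
    then show ?case using lin[of W W'] by blast
  qed (use ne in auto)
  then obtain W where W: "W \<in> \<C>" "G \<subseteq> W" by blast
  then have "?U = W" using groebner_generates[OF mo U G idC[OF W(1)]] by blast
  then show "?U \<in> \<A>" using W sub by blast
qed

section \<open>Decompositions without monomial orders\<close>

text \<open>
  Also zero and elements of smaller \<open>y\<close>-degree are admitted, which makes each of these sets an ideal of
  \<open>\<bbbk>[V - {y}]\<close>. They increase with \<open>d\<close>, from \<open>I \<inter> \<bbbk>[V - {y}]\<close> for \<open>d = 0\<close> to the ideal of all leading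
  coefficients.
\<close>

definition lead_coeffs :: "'v \<Rightarrow> ('v, 'k::field) mpolynomial set \<Rightarrow> nat \<Rightarrow> ('v, 'k) mpolynomial set" where
  "lead_coeffs y I d = {y_coeff y f d |f. f \<in> I \<and> y_le y d f}"

definition all_lead_coeffs :: "'v \<Rightarrow> ('v, 'k::field) mpolynomial set \<Rightarrow> ('v, 'k) mpolynomial set" where
  "all_lead_coeffs y I = (\<Union>d. lead_coeffs y I d)"

lemma lead_coeffsI:
  "f \<in> I \<Longrightarrow> y_le y d f \<Longrightarrow> y_coeff y f d = c \<Longrightarrow> c \<in> lead_coeffs y I d"
  by (auto simp: lead_coeffs_def)

lemma lead_coeffsE:
  assumes "c \<in> lead_coeffs y I d"
  obtains f where "f \<in> I" "y_le y d f" "c = y_coeff y f d"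
  using assms by (auto simp: lead_coeffs_def)

lemma lead_coeffs_subset: "lead_coeffs y I d \<subseteq> all_lead_coeffs y I"
  by (auto simp: all_lead_coeffs_def)

lemma y_coeff_single_mult:
  "y_coeff y (single k c * g) d =
     (if lookup k y \<le> d then single (mres (- {y}) k) c * y_coeff y g (d - lookup k y) else 0)"
  by (induct g rule: mpoly_induct)
     (auto simp: mult_single y_coeff_single lookup_add distrib_left)

lemma y_le_single_mult: "y_le y e g \<Longrightarrow> lookup k y + e \<le> d \<Longrightarrow> y_le y d (single k c * g)"
  by (rule y_le_mono[OF y_le_mult[of y "lookup k y"]]) (auto simp: y_le_def)

lemma lead_coeffs_mono:
  assumes "ideal I (mpoly_ring V)" "y \<in> V" "d \<le> e"
  shows "lead_coeffs y I d \<subseteq> lead_coeffs y I e"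
proof
  fix c assume "c \<in> lead_coeffs y I d"
  then obtain f where f: "f \<in> I" "y_le y d f" "c = y_coeff y f d" by (auto simp: lead_coeffs_def)
  let ?g = "mvar y ^ (e - d) * f"
  have "?g \<in> I" using assms f by (auto intro: ideal_mult)
  moreover have "y_le y e ?g" using y_le_mult[OF y_le_mvar_power f(2), of "e - d"] assms(3) by simp
  moreover have "y_coeff y ?g e = c" using y_coeff_shift[of y "e - d" f d] f assms(3) by simp
  ultimately show "c \<in> lead_coeffs y I e" by (rule lead_coeffsI)
qed

lemma ideal_lead_coeffs:
  assumes I: "ideal I (mpoly_ring V)"
  shows "ideal (lead_coeffs y I d) (mpoly_ring (V - {y}))"
  unfolding ideal_iff
proof (intro conjI ballI)
  show "lead_coeffs y I d \<subseteq> Pol (V - {y})"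
    using ideal_subset[OF I] by (auto simp: lead_coeffs_def)
  show "0 \<in> lead_coeffs y I d"
    using ideal_zero[OF I] by (auto simp: lead_coeffs_def intro!: exI[of _ 0])
next
  fix a b assume "a \<in> lead_coeffs y I d" "b \<in> lead_coeffs y I d"
  then obtain f g where "f \<in> I" "y_le y d f" "a = y_coeff y f d" "g \<in> I" "y_le y d g" "b = y_coeff y g d"
    by (auto simp: lead_coeffs_def)
  then show "a + b \<in> lead_coeffs y I d"
    using ideal_add[OF I] by (auto simp: lead_coeffs_def intro!: exI[of _ "f + g"])
next
  fix r a :: "('a, 'b) mpolynomial" assume r: "r \<in> Pol (V - {y})" and "a \<in> lead_coeffs y I d"
  then obtain f where f: "f \<in> I" "y_le y d f" "a = y_coeff y f d" by (auto simp: lead_coeffs_def)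
  have "r * f \<in> I" using ideal_mult[OF I] f r Pol_mono'[of r "V - {y}" V] by auto
  moreover have "y_le y d (r * f)" using y_le_mult[OF y_le_Pol[OF r] f(2), of 0] by simp
  moreover have "y_coeff y (r * f) d = r * a" using y_coeff_linear[OF r] f by simp
  ultimately show "r * a \<in> lead_coeffs y I d" by (rule lead_coeffsI)
qed

lemma ideal_all_lead_coeffs:
  assumes I: "ideal I (mpoly_ring V)" and y: "y \<in> V"
  shows "ideal (all_lead_coeffs y I) (mpoly_ring (V - {y}))"
proof -
  note L = ideal_lead_coeffs[OF I, of y]
  show ?thesis
    unfolding ideal_iff
  proof (intro conjI ballI)
    show "all_lead_coeffs y I \<subseteq> Pol (V - {y})"
      using ideal_subset[OF L] by (auto simp: all_lead_coeffs_def)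
    show "0 \<in> all_lead_coeffs y I" using ideal_zero[OF L] by (auto simp: all_lead_coeffs_def)
    show "a + b \<in> all_lead_coeffs y I" if ab: "a \<in> all_lead_coeffs y I" "b \<in> all_lead_coeffs y I" for a b
    proof -
      obtain d e where "a \<in> lead_coeffs y I d" "b \<in> lead_coeffs y I e"
        using ab by (auto simp: all_lead_coeffs_def)
      then have "a \<in> lead_coeffs y I (max d e)" "b \<in> lead_coeffs y I (max d e)"
        using lead_coeffs_mono[OF I y, of d "max d e"] lead_coeffs_mono[OF I y, of e "max d e"] by auto
      then show ?thesis using ideal_add[OF L] unfolding all_lead_coeffs_def by blast
    qed
    show "r * a \<in> all_lead_coeffs y I" if "r \<in> Pol (V - {y})" "a \<in> all_lead_coeffs y I" for r a
      using that ideal_mult[OF L] unfolding all_lead_coeffs_def by blast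
  qed
qed

lemma lead_coeffs_0:
  assumes I: "ideal I (mpoly_ring V)"
  shows "lead_coeffs y I 0 = I \<inter> Pol (V - {y})"
proof
  \<comment> \<open>in degree 0 taking the coefficient changes nothing\<close>
  have "y_coeff y f 0 = f" if "y_le y 0 f" for f :: "('a, 'b) mpolynomial"
    using y_expand[OF that] by simp
  then show "lead_coeffs y I 0 \<subseteq> I \<inter> Pol (V - {y})"
    using y_le_0_Pol[OF subsetD[OF ideal_subset[OF I]]] by (auto elim!: lead_coeffsE)
  show "I \<inter> Pol (V - {y}) \<subseteq> lead_coeffs y I 0"
  proof
    fix f assume f: "f \<in> I \<inter> Pol (V - {y})"
    then have "y_coeff y f 0 = f" "y_le y 0 f"
      using y_coeff_Pol[of f "V - {y}" y 0] y_le_Pol[of f "V - {y}" y 0] by auto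
    then show "f \<in> lead_coeffs y I 0" using f unfolding lead_coeffs_def by force
  qed
qed

text \<open>
  The ideals of \<open>\<bbbk>[V]\<close> that are homogeneous with respect to \<open>y\<close> are described by the ideals of their
  coefficients. The initial ideal, \<open>C\<close>, and \<open>N + \<langle>y\<rangle>\<close> are all of this kind, so that an equation
  between them can be checked degree by degree.
\<close>

definition graded :: "'v set \<Rightarrow> 'v \<Rightarrow> (nat \<Rightarrow> ('v, 'k::field) mpolynomial set) \<Rightarrow> ('v, 'k) mpolynomial set" where
  "graded V y M = {f \<in> Pol V. \<forall>j. y_coeff y f j \<in> M j}"

lemma ideal_graded:
  assumes M: "\<And>j. ideal (M j) (mpoly_ring (V - {y}))" and mono: "\<And>i j. i \<le> j \<Longrightarrow> M i \<subseteq> M j"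
  shows "ideal (graded V y M) (mpoly_ring V)"
  unfolding ideal_iff
proof (intro conjI ballI)
  show "graded V y M \<subseteq> Pol V" by (auto simp: graded_def)
  show "0 \<in> graded V y M" using ideal_zero[OF M] by (auto simp: graded_def)
  have add: "a + b \<in> graded V y M" if "a \<in> graded V y M" "b \<in> graded V y M" for a b
    using that ideal_add[OF M] by (auto simp: graded_def)
  then show "a + b \<in> graded V y M" if "a \<in> graded V y M" "b \<in> graded V y M" for a b
    using that by blast
  show "r * a \<in> graded V y M" if r: "r \<in> Pol V" and a: "a \<in> graded V y M" for r a
    using r
  proof (induct rule: Pol_induct)
    case zero
    then show ?case using ideal_zero[OF M] by (simp add: graded_def)
  next
    case (single m c)
    have "y_coeff y (single m c * a) j \<in> M j" for j
    proof -
      have "single (mres (- {y}) m) c \<in> Pol (V - {y})" using single by (auto intro!: Pol_single)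
      then have "single (mres (- {y}) m) c * y_coeff y a (j - lookup m y) \<in> M (j - lookup m y)"
        using a ideal_mult[OF M] by (auto simp: graded_def)
      then show ?thesis
        using mono[of "j - lookup m y" j] ideal_zero[OF M] by (auto simp: y_coeff_single_mult)
    qed
    then show ?case using single a by (auto simp: graded_def)
  next
    case (add f g)
    then show ?case using that(1) \<open>\<And>a b. _ \<Longrightarrow> _ \<Longrightarrow> a + b \<in> graded V y M\<close> by (simp add: distrib_right)
  qed
qed

lemma graded_subset:
  assumes I: "ideal I (mpoly_ring V)" and y: "y \<in> V"
    and M: "\<And>j c. c \<in> M j \<Longrightarrow> c * mvar y ^ j \<in> I"
  shows "graded V y M \<subseteq> I"
proof
  fix f assume f: "f \<in> graded V y M"
  obtain d where d: "y_le y d f" using y_le_ex[of y f] by auto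
  show "f \<in> I"
    by (subst y_expand[OF d]) (rule ideal_sum[OF I], use f M in \<open>auto simp: graded_def\<close>)
qed

lemma Pol_in_graded_iff:
  assumes "f \<in> Pol (V - {y})" "\<And>j. 0 \<in> M j"
  shows "f \<in> graded V y M \<longleftrightarrow> f \<in> M 0"
  using assms Pol_mono'[of f "V - {y}" V] by (auto simp: graded_def y_coeff_Pol[OF assms(1)])

lemma monomial_in_graded_iff:
  assumes "c \<in> Pol (V - {y})" "y \<in> V" "\<And>j. 0 \<in> M j"
  shows "c * mvar y ^ d \<in> graded V y M \<longleftrightarrow> c \<in> M d"
proof -
  have "c * mvar y ^ d \<in> Pol V"
    using assms Pol_mono'[of c "V - {y}" V] by auto
  then show ?thesis using assms(3) by (auto simp: graded_def y_coeff_monomial[OF assms(1)])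
qed

text \<open>
  The order-free form of the equation \<open>in\<^sub>y(I) = C \<inter> (N + \<langle>y\<rangle>)\<close>; the equivalence is
  \<open>decomposition_iff_degree_one_leads\<close> below.
\<close>

definition degree_one_leads :: "'v \<Rightarrow> ('v, 'k::field) mpolynomial set \<Rightarrow> bool" where
  "degree_one_leads y I \<longleftrightarrow> all_lead_coeffs y I \<subseteq> lead_coeffs y I 1"

lemma y_initial_ideal_graded:
  assumes I: "ideal I (mpoly_ring V)" and y: "y \<in> V"
  shows "y_initial_ideal V y I = graded V y (lead_coeffs y I)"
proof
  note L = ideal_lead_coeffs[OF I, of y]
  have gr: "ideal (graded V y (lead_coeffs y I)) (mpoly_ring V)"
    by (rule ideal_graded[OF L]) (rule lead_coeffs_mono[OF I y])
  have lc: "y_lead_coeff y f \<in> lead_coeffs y I (y_degree y f)" if "f \<in> I" "f \<noteq> 0" for f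
    unfolding y_lead_coeff_def using that by (intro lead_coeffsI[OF _ y_le_y_degree]) auto
  have gen: "{y_initial y f |f. f \<in> I \<and> f \<noteq> 0} \<subseteq> graded V y (lead_coeffs y I)"
  proof clarify
    fix f assume f: "f \<in> I" "f \<noteq> 0"
    have "y_lead_coeff y f \<in> Pol (V - {y})" using lc[OF f] ideal_subset[OF L] by blast
    then show "y_initial y f \<in> graded V y (lead_coeffs y I)"
      unfolding y_initial_def
      by (subst monomial_in_graded_iff[OF _ y]) (use lc[OF f] ideal_zero[OF L] in auto)
  qed
  then show "y_initial_ideal V y I \<subseteq> graded V y (lead_coeffs y I)"
    unfolding y_initial_ideal_def by (rule idl_minimal[OF gr])
  have genP: "{y_initial y f |f. f \<in> I \<and> f \<noteq> 0} \<subseteq> Pol V"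
    using gen ideal_subset[OF gr] by blast
  show "graded V y (lead_coeffs y I) \<subseteq> y_initial_ideal V y I"
  proof (rule graded_subset[OF _ y])
    show id: "ideal (y_initial_ideal V y I) (mpoly_ring V)"
      unfolding y_initial_ideal_def by (rule ideal_idl[OF genP])
    fix j c assume "c \<in> lead_coeffs y I j"
    then obtain f where f: "f \<in> I" "y_le y j f" "c = y_coeff y f j" by (auto simp: lead_coeffs_def)
    show "c * mvar y ^ j \<in> y_initial_ideal V y I"
    proof (cases "c = 0")
      case True
      then show ?thesis using ideal_zero[OF id] by simp
    next
      case False
      then have "f \<noteq> 0" using f by auto
      have "y_degree y f = j"
      proof (rule antisym)
        show "y_degree y f \<le> j"
          using y_lead_coeff_nonzero[OF \<open>f \<noteq> 0\<close>] y_coeff_eq_0[OF f(2)] unfolding y_lead_coeff_def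
          by (meson linorder_not_less)
        show "j \<le> y_degree y f"
          using False f y_coeff_eq_0[OF y_le_y_degree[OF \<open>f \<noteq> 0\<close>]] by (meson linorder_not_less)
      qed
      then have "c * mvar y ^ j = y_initial y f" using f by (simp add: y_initial_def y_lead_coeff_def)
      then show ?thesis
        unfolding y_initial_ideal_def using idl_superset[OF genP] f \<open>f \<noteq> 0\<close> by blast
    qed
  qed
qed

context
  fixes V :: "'v set" and y and ord and I G :: "('v, 'k::field) mpolynomial set"
  assumes I: "ideal I (mpoly_ring V)" and y: "y \<in> V" and mo: "monomial_order V ord"
    and comp: "y_compatible TYPE('k) V y ord" and G: "groebner_basis V ord I G"
begin

private lemma groebner_subset: "g \<in> G \<Longrightarrow> g \<in> I \<and> g \<noteq> 0 \<and> g \<in> Pol V"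
  using G ideal_subset[OF I] by (auto simp: groebner_basis_def)

text \<open>
  Dividing \<open>f \<in> I\<close> by the Groebner basis changes the coefficient of a top power of \<open>y\<close> by multiples
  of leading coefficients of members of \<open>G\<close>, as the leading monomials control the \<open>y\<close>-degrees.
\<close>

lemma C_ideal_graded: "C_ideal V y G = graded V y (\<lambda>_. all_lead_coeffs y I)"
proof
  note L = ideal_all_lead_coeffs[OF I y]
  have gr: "ideal (graded V y (\<lambda>_. all_lead_coeffs y I)) (mpoly_ring V)"
    by (rule ideal_graded[OF L]) simp
  have gen: "{y_lead_coeff y g |g. g \<in> G} \<subseteq> graded V y (\<lambda>_. all_lead_coeffs y I)"
  proof clarify
    fix g assume g: "g \<in> G"
    have "y_lead_coeff y g \<in> all_lead_coeffs y I"
      unfolding y_lead_coeff_def using groebner_subset[OF g]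
      by (intro subsetD[OF lead_coeffs_subset[of y I "y_degree y g"]] lead_coeffsI[OF _ y_le_y_degree]) auto
    then show "y_lead_coeff y g \<in> graded V y (\<lambda>_. all_lead_coeffs y I)"
      using ideal_subset[OF L] ideal_zero[OF L] by (subst Pol_in_graded_iff) auto
  qed
  then show "C_ideal V y G \<subseteq> graded V y (\<lambda>_. all_lead_coeffs y I)"
    unfolding C_ideal_def by (rule idl_minimal[OF gr])
  have genP: "{y_lead_coeff y g |g. g \<in> G} \<subseteq> Pol V" using gen ideal_subset[OF gr] by blast
  have id: "ideal (C_ideal V y G) (mpoly_ring V)"
    unfolding C_ideal_def by (rule ideal_idl[OF genP])
  have red: "\<forall>d. y_le y d f \<longrightarrow> y_coeff y f d \<in> C_ideal V y G" if "f \<in> I" for f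
  proof (rule groebner_induct[OF mo I G that], goal_cases)
    case 1
    then show ?case using ideal_zero[OF id] by simp
  next
    case (2 f g k c)
    note g = groebner_subset[OF 2(3)] and deg = y_compatible_lead_monomial[OF mo comp]
    show ?case
    proof (intro allI impI)
      fix d assume d: "y_le y d f"
      have "lead_monomial ord f \<in> keys f"
        using lead_monomial_in_keys[OF mo _ 2(2)] 2(1) ideal_subset[OF I] by blast
      then have "lookup (lead_monomial ord f) y \<le> d" using d by (auto simp: y_le_def)
      then have kd: "lookup k y + y_degree y g \<le> d" using 2(5) deg g by (auto simp: lookup_add)
      have "y_le y d (single k c * g)" using g kd by (intro y_le_single_mult[OF y_le_y_degree]) auto
      then have "y_coeff y (f - single k c * g) d \<in> C_ideal V y G" using 2(7) d by blast
      moreover have "y_coeff y (single k c * g) d \<in> C_ideal V y G"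
      proof -
        have "y_coeff y g (d - lookup k y) \<in> C_ideal V y G"
        proof (cases "d - lookup k y = y_degree y g")
          case True
          then show ?thesis
            using idl_superset[OF genP] 2(3) unfolding C_ideal_def y_lead_coeff_def by auto
        next
          case False
          then have "y_degree y g < d - lookup k y" using kd by simp
          then have "y_coeff y g (d - lookup k y) = 0"
            using y_coeff_eq_0[OF y_le_y_degree[of g y]] g by simp
          then show ?thesis using ideal_zero[OF id] by simp
        qed
        moreover have "single (mres (- {y}) k) c \<in> Pol V"
          using 2(4) by (auto simp: monomials_def intro!: Pol_single)
        ultimately show ?thesis using kd ideal_mult[OF id] by (simp add: y_coeff_single_mult)
      qed
      ultimately show "y_coeff y f d \<in> C_ideal V y G" using ideal_add[OF id] by fastforce
    qed
  qed
  show "graded V y (\<lambda>_. all_lead_coeffs y I) \<subseteq> C_ideal V y G"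
  proof (rule graded_subset[OF id y])
    fix j c assume "c \<in> all_lead_coeffs y I"
    then have "c \<in> C_ideal V y G" using red by (auto simp: all_lead_coeffs_def lead_coeffs_def)
    then show "c * mvar y ^ j \<in> C_ideal V y G" using y by (auto intro!: ideal_mult'[OF id])
  qed
qed

text \<open>
  The elimination property of a \<open>y\<close>-compatible order: dividing an element without \<open>y\<close> only uses members
  of the Groebner basis without \<open>y\<close>.
\<close>

lemma N_ideal_props:
  shows ideal_N_ideal: "ideal (N_ideal V y G) (mpoly_ring V)" and "N_ideal V y G \<subseteq> I"
    and "I \<inter> Pol (V - {y}) \<subseteq> N_ideal V y G"
proof -
  have g0: "y_lead_coeff y g = g \<and> g \<in> Pol (V - {y})" if "g \<in> G" "y_degree y g = 0" for g
  proof -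
    have "y_le y 0 g" using y_le_y_degree[of g y] groebner_subset[OF that(1)] that(2) by simp
    then show ?thesis using y_expand[of y 0 g] y_le_0_Pol groebner_subset[OF that(1)] that(2)
      by (auto simp: y_lead_coeff_def)
  qed
  have gen: "{y_lead_coeff y g |g. g \<in> G \<and> y_degree y g = 0} \<subseteq> I"
    using g0 groebner_subset by auto
  then show id: "ideal (N_ideal V y G) (mpoly_ring V)"
    unfolding N_ideal_def using ideal_subset[OF I] by (intro ideal_idl) blast
  show "N_ideal V y G \<subseteq> I" unfolding N_ideal_def by (rule idl_minimal[OF I gen])
  have "f \<in> Pol (V - {y}) \<longrightarrow> f \<in> N_ideal V y G" if "f \<in> I" for f
  proof (rule groebner_induct[OF mo I G that], goal_cases)
    case 1
    then show ?case using ideal_zero[OF id] by simp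
  next
    case (2 f g k c)
    note g = groebner_subset[OF 2(3)] and deg = y_compatible_lead_monomial[OF mo comp]
    show ?case
    proof
      assume f: "f \<in> Pol (V - {y})"
      have fV: "f \<in> Pol V" using 2(1) ideal_subset[OF I] by blast
      have "lead_monomial ord f \<in> keys f" using lead_monomial_in_keys[OF mo fV 2(2)] .
      then have "lookup (lead_monomial ord f) y = 0"
        using y_le_Pol[OF f, of y 0] by (auto simp: y_le_def)
      then have "lookup k y = 0" "y_degree y g = 0" using 2(5) deg g by (auto simp: lookup_add)
      then have "keys k \<subseteq> V - {y}" using 2(4) by (auto simp: monomials_def in_keys_iff subset_iff)
      then have "single k c \<in> Pol (V - {y})" by auto
      then have "f - single k c * g \<in> Pol (V - {y})" using f g0 2(3) \<open>y_degree y g = 0\<close> by blast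
      then have "f - single k c * g \<in> N_ideal V y G" using 2(7) by blast
      moreover have "g \<in> N_ideal V y G"
      proof -
        have "g \<in> {y_lead_coeff y g |g. g \<in> G \<and> y_degree y g = 0}"
          using g0[OF 2(3) \<open>y_degree y g = 0\<close>] 2(3) \<open>y_degree y g = 0\<close> by (auto intro!: exI[of _ g])
        then show ?thesis unfolding N_ideal_def using idl_superset gen ideal_subset[OF I] by blast
      qed
      then have "single k c * g \<in> N_ideal V y G"
        using 2(4) by (intro ideal_mult[OF id]) (auto simp: monomials_def)
      ultimately show "f \<in> N_ideal V y G" using ideal_diff_iff[OF id] by blast
    qed
  qed
  then show "I \<inter> Pol (V - {y}) \<subseteq> N_ideal V y G" by blast
qed

lemma C_ideal_contract: "C_ideal V y G \<inter> Pol (V - {y}) = all_lead_coeffs y I"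
  using ideal_subset[OF ideal_all_lead_coeffs[OF I y]] ideal_zero[OF ideal_all_lead_coeffs[OF I y]]
  by (auto simp: C_ideal_graded Pol_in_graded_iff)

lemma N_ideal_contract: "N_ideal V y G \<inter> Pol (V - {y}) = I \<inter> Pol (V - {y})"
  using N_ideal_props by auto

lemma N_ideal_plus_graded:
  "N_ideal V y G <+>\<^bsub>mpoly_ring V\<^esub> idl V {mvar y} =
     graded V y (\<lambda>j. if j = 0 then I \<inter> Pol (V - {y}) else Pol (V - {y}))" (is "?S = graded V y ?M")
proof
  have yP: "{mvar y} \<subseteq> (Pol V :: ('v, 'k) mpolynomial set)" using y by auto
  note ys = ideal_idl[OF yP]
  have M: "ideal (?M j) (mpoly_ring (V - {y}))" for j
    using ideal_contract[OF I, of "V - {y}"] by (auto simp: ideal_iff[of "Pol _"])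
  have gr: "ideal (graded V y ?M) (mpoly_ring V)"
    by (rule ideal_graded[OF M]) auto
  have M0: "0 \<in> ?M j" for j using ideal_zero[OF M] .
  have "N_ideal V y G \<subseteq> graded V y ?M"
    unfolding N_ideal_def
  proof (rule idl_minimal[OF gr], clarify)
    fix g assume g: "g \<in> G" "y_degree y g = 0"
    then have "y_lead_coeff y g \<in> lead_coeffs y I 0"
      using groebner_subset[OF g(1)] y_le_y_degree[of g y] by (auto simp: y_lead_coeff_def lead_coeffs_def)
    then have "y_lead_coeff y g \<in> I \<inter> Pol (V - {y})" using lead_coeffs_0[OF I] by blast
    then show "y_lead_coeff y g \<in> graded V y ?M" by (subst Pol_in_graded_iff) (use M0 in auto)
  qed
  moreover have "mvar y \<in> graded V y ?M"
    using monomial_in_graded_iff[of 1 V y ?M 1, OF _ y M0] by simp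
  then have "idl V {mvar y} \<subseteq> graded V y ?M" by (intro idl_minimal[OF gr]) auto
  ultimately show "?S \<subseteq> graded V y ?M"
    using ideal_add[OF gr] by (force simp: set_add_def' )
  show "graded V y ?M \<subseteq> ?S"
  proof (rule graded_subset[OF _ y])
    show S: "ideal ?S (mpoly_ring V)"
      by (rule ring.add_ideals[OF mpoly_ring_ring ideal_N_ideal ys])
    fix j c assume c: "c \<in> ?M j"
    show "c * mvar y ^ j \<in> ?S"
    proof (cases j)
      case 0
      then have "c \<in> N_ideal V y G" using c N_ideal_props(3) by auto
      moreover have "(0 :: ('v, 'k) mpolynomial) \<in> idl V {mvar y}" using ideal_zero[OF ys] .
      ultimately show ?thesis using 0 by (force simp: set_add_def')
    next
      case (Suc i)
      have "(mvar y :: ('v, 'k) mpolynomial) \<in> idl V {mvar y}" using idl_superset[OF yP] by blast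
      moreover have "c * mvar y ^ i \<in> Pol V" using c Suc y Pol_mono'[of c "V - {y}" V] by auto
      ultimately have "c * mvar y ^ i * mvar y \<in> idl V {mvar y}" using ideal_mult[OF ys] by blast
      moreover have "0 \<in> N_ideal V y G" using ideal_zero[OF ideal_N_ideal] .
      ultimately show ?thesis using Suc by (force simp: set_add_def' mult_ac)
    qed
  qed
qed

text \<open>
  In degree \<open>j\<close> the left-hand side has the coefficients \<open>L\<^sub>j\<close> of \<open>lead_coeffs\<close>, the right-hand side has
  \<open>L\<^sub>0\<close> for \<open>j = 0\<close> and the union of all \<open>L\<^sub>i\<close> for \<open>j > 0\<close>. As \<open>L\<^sub>1 \<subseteq> L\<^sub>2 \<subseteq> \<dots>\<close>, equality in all degrees
  amounts to equality in degree one.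
\<close>

lemma decomposition_iff_degree_one_leads:
  "y_initial_ideal V y I = C_ideal V y G \<inter> (N_ideal V y G <+>\<^bsub>mpoly_ring V\<^esub> idl V {mvar y})
     \<longleftrightarrow> degree_one_leads y I" (is "?L \<longleftrightarrow> ?R")
proof -
  note A = ideal_all_lead_coeffs[OF I y] and L = ideal_lead_coeffs[OF I, of y]
  have eq: "?L \<longleftrightarrow> graded V y (lead_coeffs y I) = graded V y (\<lambda>_. all_lead_coeffs y I) \<inter>
      graded V y (\<lambda>j. if j = 0 then I \<inter> Pol (V - {y}) else Pol (V - {y}))" (is "_ \<longleftrightarrow> ?E")
    unfolding y_initial_ideal_graded[OF I y] C_ideal_graded N_ideal_plus_graded ..
  have LA: "lead_coeffs y I j \<subseteq> all_lead_coeffs y I" for j by (auto simp: all_lead_coeffs_def)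
  have LP: "lead_coeffs y I j \<subseteq> Pol (V - {y})" for j using ideal_subset[OF L] .
  show ?thesis
  proof
    assume ?L
    then have E: ?E using eq by simp
    show ?R
      unfolding degree_one_leads_def
    proof
      fix c assume c: "c \<in> all_lead_coeffs y I"
      then have cP: "c \<in> Pol (V - {y})" using ideal_subset[OF A] by blast
      have "c * mvar y ^ 1 \<in> graded V y (lead_coeffs y I)"
        unfolding E
        using c cP ideal_zero[OF A] ideal_zero[OF I]
        by (simp add: monomial_in_graded_iff[OF cP y, where d = 1, simplified])
      then show "c \<in> lead_coeffs y I 1"
        using monomial_in_graded_iff[OF cP y, of "lead_coeffs y I" 1] ideal_zero[OF L] by blast
    qed
  next
    assume R: ?R
    have "lead_coeffs y I j = all_lead_coeffs y I \<inter> (if j = 0 then I \<inter> Pol (V - {y}) else Pol (V - {y}))" for j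
    proof (cases "j = 0")
      case True
      then show ?thesis using lead_coeffs_0[OF I, of y] LA[of 0] by auto
    next
      case False
      then have "lead_coeffs y I 1 \<subseteq> lead_coeffs y I j" by (intro lead_coeffs_mono[OF I y]) auto
      then show ?thesis using R False LA[of j] LP[of j] unfolding degree_one_leads_def by auto
    qed
    then have ?E by (auto simp: graded_def)
    then show ?L using eq by simp
  qed
qed

end

lemma gvd_decomposeI:
  fixes I :: "('v, 'k::field) mpolynomial set"
  assumes "finite V" "ideal I (mpoly_ring V)" "unmixed (mpoly_ring V) I" "y \<in> V"
    and "degree_one_leads y I"
    and "geom_vertex_decomp (V - {y}) (all_lead_coeffs y I)"
    and "geom_vertex_decomp (V - {y}) (I \<inter> Pol (V - {y}))"
  shows "geom_vertex_decomp V I"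
proof -
  obtain ord where ord: "monomial_order V ord" "y_compatible TYPE('k) V y ord"
    using ex_y_compatible_order[OF assms(1,4)] by blast
  obtain G where G: "groebner_basis V ord I G"
    using ex_groebner_basis[OF assms(1) ord(1) assms(2)] by blast
  note ctx = assms(2,4) ord G
  show ?thesis
    by (rule geom_vertex_decomp.decompose[OF assms(2-4) ord G])
       (use assms in \<open>simp_all add: decomposition_iff_degree_one_leads[OF ctx] C_ideal_contract[OF ctx] N_ideal_contract[OF ctx]\<close>)
qed

lemma gvd_induct [consumes 2, case_names unit variables decompose]:
  fixes I :: "('v, 'k::field) mpolynomial set"
  assumes "geom_vertex_decomp V I" "finite V"
    and unit: "\<And>V. finite V \<Longrightarrow> Q V (Pol V)"
    and variables: "\<And>V B. finite V \<Longrightarrow> B \<subseteq> V \<Longrightarrow> Q V (idl V (mvar ` B))"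
    and decompose: "\<And>V y (I :: ('v, 'k) mpolynomial set). finite V \<Longrightarrow> ideal I (mpoly_ring V) \<Longrightarrow>
      unmixed (mpoly_ring V) I \<Longrightarrow> y \<in> V \<Longrightarrow> degree_one_leads y I \<Longrightarrow>
      geom_vertex_decomp (V - {y}) (all_lead_coeffs y I) \<Longrightarrow>
      geom_vertex_decomp (V - {y}) (I \<inter> Pol (V - {y})) \<Longrightarrow>
      Q (V - {y}) (all_lead_coeffs y I) \<Longrightarrow> Q (V - {y}) (I \<inter> Pol (V - {y})) \<Longrightarrow> Q V I"
  shows "Q V I"
  using assms(1,2)
proof (induct rule: geom_vertex_decomp.induct)
  case (unit I V)
  then show ?case using assms(3) by (simp add: idl_one)
next
  case (variables I V B)
  then show ?case using assms(4) by simp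
next
  case (decompose I V y ord G)
  note ctx = decompose(1,3-6)
  show ?case
    using decompose.prems decompose(1-3,7-) assms(5)[of V I y]
    by (simp add: decomposition_iff_degree_one_leads[OF ctx] C_ideal_contract[OF ctx] N_ideal_contract[OF ctx])
qed

lemma gvd_ideal: "geom_vertex_decomp V I \<Longrightarrow> ideal I (mpoly_ring V)"
  by (cases rule: geom_vertex_decomp.cases) auto

lemma gvd_unmixed: "geom_vertex_decomp V I \<Longrightarrow> unmixed (mpoly_ring V) I"
  by (cases rule: geom_vertex_decomp.cases) auto

section \<open>Sums of ideals in disjoint sets of variables\<close>

abbreviation kills :: "'v set \<Rightarrow> ('v monomial \<Rightarrow> 'k::field) \<Rightarrow> ('v, 'k) mpolynomial set \<Rightarrow> bool" where
  "kills Y \<xi> J \<equiv> \<forall>g\<in>J. slice Y \<xi> g = 0"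

text \<open>
  Extend a basis of \<open>J\<close> to a basis of \<open>\<bbbk>[Y]\<close>. Expanding \<open>t\<close> along it, the slices are taken by the
  coordinate functionals of the new basis elements, which vanish on \<open>J\<close>, and the old basis elements
  contribute a member of the ideal generated by \<open>J\<close>. Only the finitely many basis elements that
  occur in \<open>t\<close> matter.
\<close>

lemma slice_decomposition:
  fixes t :: "('v, 'k::field) mpolynomial"
  assumes J: "ideal J (mpoly_ring Y)" and t: "t \<in> Pol (X \<union> Y)"
  shows "\<exists>B \<xi>. finite B \<and> B \<subseteq> Pol Y \<and> (\<forall>b\<in>B. kills Y (\<xi> b) J) \<and>
           t - (\<Sum>b\<in>B. slice Y (\<xi> b) t * b) \<in> idl (X \<union> Y) J"
proof -
  interpret mpoly_space: vector_space "\<lambda>(c :: 'k) (f :: ('v, 'k) mpolynomial). cst c * f"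
    by unfold_locales (auto simp: algebra_simps)
  obtain BJ where BJ: "BJ \<subseteq> J" "mpoly_space.independent BJ" "J \<subseteq> mpoly_space.span BJ"
    using mpoly_space.maximal_independent_subset by blast
  have "BJ \<subseteq> Pol Y" using BJ(1) ideal_subset[OF J] by blast
  from mpoly_space.maximal_independent_subset_extend[OF this BJ(2)]
  obtain B where B: "BJ \<subseteq> B" "B \<subseteq> Pol Y" "mpoly_space.independent B" "Pol Y \<subseteq> mpoly_space.span B"
    by blast
  define R where "R = mpoly_space.representation B"
  define \<xi> where "\<xi> b n = R (single n 1) b" for b n
  have span: "f \<in> mpoly_space.span B" if "f \<in> Pol Y" for f using that B(4) by blast
  have slice_R: "slice Y (\<xi> b) g = cst (R g b)" if "g \<in> Pol Y" for g b
    using that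
  proof (induct rule: Pol_induct)
    case zero
    then show ?case by (simp add: R_def mpoly_space.representation_zero)
  next
    case (single m c)
    have "mres Y m = m" "mres (- Y) m = 0" using single by (auto intro!: mres_id mres_none)
    then have "slice Y (\<xi> b) (single m c) = cst (c * R (single m 1) b)"
      by (simp add: \<xi>_def cst_def)
    moreover have "single m c = cst c * single m 1" by (simp add: cst_def mult_single)
    moreover have "R (cst c * single m 1) b = c * R (single m 1) b"
      unfolding R_def using single by (subst mpoly_space.representation_scale[OF B(3)]) (auto intro!: span)
    ultimately show ?case by metis
  next
    case (add f g)
    then show ?case
      unfolding R_def by (subst mpoly_space.representation_add[OF B(3)]) (auto intro!: span)
  qed
  have kill: "kills Y (\<xi> b) J" if "b \<in> B" "b \<notin> BJ" for b
  proof
    fix g assume g: "g \<in> J"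
    then have "R g b = mpoly_space.representation BJ g b"
      unfolding R_def using mpoly_space.representation_extend[OF B(3) _ B(1), of g] BJ(3) by auto
    also have "\<dots> = 0" using mpoly_space.representation_ne_zero[of BJ g b] that by blast
    finally show "slice Y (\<xi> b) g = 0"
      using slice_R[of g b] ideal_subset[OF J] g by auto
  qed
  have "\<exists>S. finite S \<and> S \<subseteq> B \<and> (\<forall>S'. finite S' \<and> S \<subseteq> S' \<and> S' \<subseteq> B \<longrightarrow> t = (\<Sum>b\<in>S'. slice Y (\<xi> b) t * b))"
    using t
  proof (induct rule: Pol_induct)
    case zero
    then show ?case by auto
  next
    case (single m c)
    let ?n = "mres Y m" and ?p = "mres (- Y) m"
    let ?S = "{b. R (single ?n 1) b \<noteq> 0}"
    have n: "single ?n 1 \<in> Pol Y" by auto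
    have S: "finite ?S" "?S \<subseteq> B"
      using mpoly_space.finite_representation mpoly_space.representation_ne_zero by (auto simp: R_def)
    have "single m c = (\<Sum>b\<in>S'. slice Y (\<xi> b) (single m c) * b)"
      if S': "finite S'" "?S \<subseteq> S'" "S' \<subseteq> B" for S'
    proof -
      have "single ?n 1 = (\<Sum>b\<in>?S. cst (R (single ?n 1) b) * b)"
        unfolding R_def by (subst mpoly_space.sum_nonzero_representation_eq[OF B(3) span[OF n]]) simp
      also have "\<dots> = (\<Sum>b\<in>S'. cst (R (single ?n 1) b) * b)"
        by (rule sum.mono_neutral_left) (use S' in auto)
      finally have "single ?p c * single ?n 1 = single ?p c * (\<Sum>b\<in>S'. cst (R (single ?n 1) b) * b)"
        by (rule arg_cong)
      then have "single ?p c * single ?n 1 = (\<Sum>b\<in>S'. single ?p c * cst (R (single ?n 1) b) * b)"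
        by (simp only: sum_distrib_left mult.assoc)
      moreover have "slice Y (\<xi> b) (single m c) = single ?p c * cst (R (single ?n 1) b)" for b
        by (simp add: \<xi>_def cst_def mult_single)
      moreover have "single ?p c * single ?n 1 = single m c" by (simp add: mult_single mres_split)
      ultimately show ?thesis by simp
    qed
    then show ?case using S by blast
  next
    case (add f g)
    then obtain S1 S2 where
      S1: "finite S1" "S1 \<subseteq> B" "\<forall>S'. finite S' \<and> S1 \<subseteq> S' \<and> S' \<subseteq> B \<longrightarrow> f = (\<Sum>b\<in>S'. slice Y (\<xi> b) f * b)" and
      S2: "finite S2" "S2 \<subseteq> B" "\<forall>S'. finite S' \<and> S2 \<subseteq> S' \<and> S' \<subseteq> B \<longrightarrow> g = (\<Sum>b\<in>S'. slice Y (\<xi> b) g * b)"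
      by blast
    have "f + g = (\<Sum>b\<in>S'. slice Y (\<xi> b) (f + g) * b)"
      if "finite S'" "S1 \<union> S2 \<subseteq> S'" "S' \<subseteq> B" for S'
    proof -
      have "f = (\<Sum>b\<in>S'. slice Y (\<xi> b) f * b)" "g = (\<Sum>b\<in>S'. slice Y (\<xi> b) g * b)"
        using that S1(3) S2(3) by auto
      then show ?thesis by (simp add: distrib_right sum.distrib)
    qed
    then show ?case using S1(1,2) S2(1,2) by (intro exI[of _ "S1 \<union> S2"]) auto
  qed
  then obtain S where S: "finite S" "S \<subseteq> B" "t = (\<Sum>b\<in>S. slice Y (\<xi> b) t * b)" by blast
  have JP: "J \<subseteq> Pol (X \<union> Y)" using ideal_subset[OF J] Pol_mono[of Y "X \<union> Y"] by blast
  let ?s = "\<lambda>b. slice Y (\<xi> b) t * b"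
  have "t - sum ?s (S - BJ) = sum ?s S - sum ?s (S - BJ)" using S(3) by (rule arg_cong)
  also have "\<dots> = sum ?s (S \<inter> BJ)"
    by (simp only: sum.Int_Diff[OF S(1), of ?s BJ] add_diff_cancel_right')
  also have "\<dots> \<in> idl (X \<union> Y) J"
  proof (intro ideal_sum[OF ideal_idl[OF JP]] ideal_mult[OF ideal_idl[OF JP]])
    show "slice Y (\<xi> b) t \<in> Pol (X \<union> Y)" for b
      using slice_in_Pol[OF t, of Y "\<xi> b"] by (rule Pol_mono') auto
    show "b \<in> idl (X \<union> Y) J" if "b \<in> S \<inter> BJ" for b
      using that BJ(1) idl_superset[OF JP] by blast
  qed
  finally show ?thesis
    using S(1,2) kill B(2) by (intro exI[of _ "S - BJ"] exI[of _ \<xi>]) auto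
qed

text \<open>
  If all functionals that vanish on \<open>J\<close> also vanished at \<open>1\<close>, then \<open>1\<close> would lie in \<open>J\<close> by
  \<open>slice_decomposition\<close>. A normalized functional \<open>\<xi>\<close> makes the slice a retraction of \<open>\<bbbk>[X \<union> Y]\<close> onto
  \<open>\<bbbk>[X]\<close>.
\<close>

lemma ex_kills_normalized:
  fixes J :: "('v, 'k::field) mpolynomial set"
  assumes J: "ideal J (mpoly_ring Y)" and J1: "1 \<notin> J"
  shows "\<exists>\<xi>. kills Y \<xi> J \<and> \<xi> 0 = 1"
proof -
  have "1 \<in> Pol ({} \<union> Y)" by simp
  from slice_decomposition[OF J this] obtain B \<xi> where B: "finite B" "\<forall>b\<in>B. kills Y (\<xi> b) J"
    "1 - (\<Sum>b\<in>B. slice Y (\<xi> b) 1 * b) \<in> idl Y J" by auto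
  have "idl Y J \<subseteq> J" by (rule idl_minimal[OF J]) simp
  then have "(\<Sum>b\<in>B. slice Y (\<xi> b) 1 * b) \<noteq> 0" using B(3) J1 by auto
  then obtain b where b: "b \<in> B" "slice Y (\<xi> b) 1 \<noteq> 0" by (metis (no_types, lifting) mult_zero_left sum.neutral)
  then have nz: "\<xi> b 0 \<noteq> 0" by (simp add: slice_one)
  let ?\<xi> = "\<lambda>n. inverse (\<xi> b 0) * \<xi> b n"
  have "kills Y ?\<xi> J" using B(2) b(1) by (auto simp: slice_scale)
  then show ?thesis using nz by (intro exI[of _ ?\<xi>]) simp
qed

text \<open>
  The ideal \<open>I + J\<close> of \<open>\<bbbk>[X \<union> Y]\<close>.
\<close>

abbreviation ideal_join ::
    "'v set \<Rightarrow> 'v set \<Rightarrow> ('v, 'k::field) mpolynomial set \<Rightarrow> ('v, 'k) mpolynomial set \<Rightarrow> ('v, 'k) mpolynomial set" where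
  "ideal_join X Y I J \<equiv> idl (X \<union> Y) (I \<union> J)"

lemma ideal_join_commute: "ideal_join X Y I J = ideal_join Y X J I"
  by (simp add: Un_commute)

context
  fixes X Y :: "'v set" and I J :: "('v, 'k::field) mpolynomial set"
  assumes XY: "X \<inter> Y = {}" and I: "ideal I (mpoly_ring X)" and J: "ideal J (mpoly_ring Y)"
begin

lemma ideal_join_subset: "I \<union> J \<subseteq> Pol (X \<union> Y)"
  using ideal_subset[OF I] ideal_subset[OF J] Pol_mono[of X "X \<union> Y"] Pol_mono[of Y "X \<union> Y"] by blast

lemma ideal_ideal_join: "ideal (ideal_join X Y I J) (mpoly_ring (X \<union> Y))"
  by (rule ideal_idl[OF ideal_join_subset])

lemma ideal_join_superset: "I \<subseteq> ideal_join X Y I J" "J \<subseteq> ideal_join X Y I J"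
  using idl_superset[OF ideal_join_subset] by auto

text \<open>
  The elements that all such slices send into \<open>I\<close> form an ideal, since multiplying by a monomial in
  \<open>Y\<close> turns a functional that kills \<open>J\<close> into another one.
\<close>

lemma slice_ideal_join:
  assumes f: "f \<in> ideal_join X Y I J" and \<xi>: "kills Y \<xi> J"
  shows "slice Y \<xi> f \<in> I"
proof -
  let ?S = "{f \<in> Pol (X \<union> Y). \<forall>\<xi>. kills Y \<xi> J \<longrightarrow> slice Y \<xi> f \<in> I}"
  have "ideal ?S (mpoly_ring (X \<union> Y))"
    unfolding ideal_iff
  proof (intro conjI ballI)
    show "?S \<subseteq> Pol (X \<union> Y)" by blast
    show add: "a + b \<in> ?S" if "a \<in> ?S" "b \<in> ?S" for a b
      using that ideal_add[OF I] by auto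
    show zero: "0 \<in> ?S" using ideal_zero[OF I] by simp
    show "r * a \<in> ?S" if r: "r \<in> Pol (X \<union> Y)" and a: "a \<in> ?S" for r a
      using r
    proof (induct rule: Pol_induct)
      case zero
      then show ?case using \<open>0 \<in> ?S\<close> by simp
    next
      case (single m c)
      have "slice Y \<xi> (single m c * a) \<in> I" if \<xi>: "kills Y \<xi> J" for \<xi>
      proof -
        have "kills Y (\<lambda>k. \<xi> (mres Y m + k)) J"
        proof
          fix g assume "g \<in> J"
          then have "single (mres Y m) 1 * g \<in> J" by (intro ideal_mult[OF J]) auto
          then have "slice Y \<xi> (single (mres Y m) 1 * g) = 0" using \<xi> by blast
          then show "slice Y (\<lambda>k. \<xi> (mres Y m + k)) g = 0"
            by (subst (asm) slice_monomial_mult) auto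
        qed
        then have "slice Y (\<lambda>k. \<xi> (mres Y m + k)) a \<in> I" using a by blast
        then show ?thesis
          unfolding slice_single_mult using single by (intro ideal_mult[OF I] Pol_single) auto
      qed
      then show ?case using single a by auto
    next
      case (add f g)
      then show ?case using ideal_add[OF I] by (auto simp: distrib_right)
    qed
  qed
  moreover have "I \<union> J \<subseteq> ?S"
  proof -
    have "slice Y \<xi> f \<in> I" if "f \<in> I" for f \<xi>
      using that slice_none[OF subsetD[OF ideal_subset[OF I] that] XY] ideal_mult[OF I] by auto
    then show ?thesis using ideal_join_subset ideal_zero[OF I] by auto
  qed
  ultimately have "ideal_join X Y I J \<subseteq> ?S" by (rule idl_minimal)
  then show ?thesis using f \<xi> by blast
qed

lemma ideal_joinI:
  assumes f: "f \<in> Pol (X \<union> Y)" and *: "\<And>\<xi>. kills Y \<xi> J \<Longrightarrow> slice Y \<xi> f \<in> I"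
  shows "f \<in> ideal_join X Y I J"
proof -
  obtain B \<xi> where B: "B \<subseteq> Pol Y" "\<forall>b\<in>B. kills Y (\<xi> b) J"
    "f - (\<Sum>b\<in>B. slice Y (\<xi> b) f * b) \<in> idl (X \<union> Y) J"
    using slice_decomposition[OF J f] by blast
  have "f - (\<Sum>b\<in>B. slice Y (\<xi> b) f * b) \<in> ideal_join X Y I J"
    using B(3) idl_mono[of J "I \<union> J" "X \<union> Y"] ideal_join_subset by blast
  moreover have "(\<Sum>b\<in>B. slice Y (\<xi> b) f * b) \<in> ideal_join X Y I J"
  proof (intro ideal_sum[OF ideal_ideal_join] ideal_mult'[OF ideal_ideal_join])
    show "b \<in> Pol (X \<union> Y)" if "b \<in> B" for b using that B(1) Pol_mono[of Y "X \<union> Y"] by blast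
    show "slice Y (\<xi> b) f \<in> ideal_join X Y I J" if "b \<in> B" for b
      using that B(2) * ideal_join_superset by blast
  qed
  ultimately show ?thesis using ideal_diff_iff[OF ideal_ideal_join] by blast
qed

lemma ideal_join_contract:
  assumes "1 \<notin> J"
  shows "ideal_join X Y I J \<inter> Pol X = I"
proof
  obtain \<xi> where \<xi>: "kills Y \<xi> J" "\<xi> 0 = 1" using ex_kills_normalized[OF J assms] by blast
  show "ideal_join X Y I J \<inter> Pol X \<subseteq> I"
  proof
    fix f assume f: "f \<in> ideal_join X Y I J \<inter> Pol X"
    then have "slice Y \<xi> f = f" using slice_none[of f X Y \<xi>] XY \<xi>(2) by simp
    then show "f \<in> I" using slice_ideal_join[of f \<xi>] f \<xi>(1) by auto
  qed
  show "I \<subseteq> ideal_join X Y I J \<inter> Pol X" using ideal_join_superset ideal_subset[OF I] by blast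
qed

lemma ideal_join_proper: "1 \<notin> I \<Longrightarrow> 1 \<notin> J \<Longrightarrow> 1 \<notin> ideal_join X Y I J"
  by (metis IntI Pol_one ideal_join_contract)

end

lemma y_le_slice: "y \<notin> Y \<Longrightarrow> y_le y d f \<Longrightarrow> y_le y d (slice Y \<xi> f)"
  by (rule y_leI) (simp add: y_coeff_slice_commute y_coeff_eq_0)

context
  fixes X Y :: "'v set" and I J :: "('v, 'k::field) mpolynomial set" and y :: 'v
  assumes XY: "X \<inter> Y = {}" and I: "ideal I (mpoly_ring X)" and J: "ideal J (mpoly_ring Y)"
    and y: "y \<in> X"
begin

private lemma XY': "(X - {y}) \<inter> Y = {}" "X \<union> Y - {y} = (X - {y}) \<union> Y" "y \<notin> Y" "y \<in> X \<union> Y"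
  using XY y by auto

lemma ideal_join_restrict:
  "ideal_join X Y I J \<inter> Pol (X \<union> Y - {y}) = ideal_join (X - {y}) Y (I \<inter> Pol (X - {y})) J"
proof -
  note join = ideal_ideal_join[OF XY I J] and sup = ideal_join_superset[OF XY I J]
  note I' = ideal_contract[OF I, of "X - {y}", OF Diff_subset]
  show ?thesis
  proof
    show "ideal_join (X - {y}) Y (I \<inter> Pol (X - {y})) J \<subseteq> ideal_join X Y I J \<inter> Pol (X \<union> Y - {y})"
      unfolding XY'(2)
    proof (rule idl_minimal)
      show "ideal (ideal_join X Y I J \<inter> Pol (X - {y} \<union> Y)) (mpoly_ring (X - {y} \<union> Y))"
        by (rule ideal_contract[OF join]) auto
      show "I \<inter> Pol (X - {y}) \<union> J \<subseteq> ideal_join X Y I J \<inter> Pol (X - {y} \<union> Y)"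
        using sup Pol_mono[of "X - {y}" "X - {y} \<union> Y"]
          Pol_mono[of Y "X - {y} \<union> Y"] ideal_subset[OF J] by blast
    qed
    show "ideal_join X Y I J \<inter> Pol (X \<union> Y - {y}) \<subseteq> ideal_join (X - {y}) Y (I \<inter> Pol (X - {y})) J"
    proof
      fix f assume f: "f \<in> ideal_join X Y I J \<inter> Pol (X \<union> Y - {y})"
      then have fP: "f \<in> Pol (X - {y} \<union> Y)" by (simp add: XY'(2))
      show "f \<in> ideal_join (X - {y}) Y (I \<inter> Pol (X - {y})) J"
        by (rule ideal_joinI[OF XY'(1) I' J fP])
           (use f slice_ideal_join[OF XY I J] slice_Pol_left[OF fP] in auto)
    qed
  qed
qed

text \<open>
  A slice of \<open>f\<close> has the same \<open>y\<close>-degree bound as \<open>f\<close>, and its coefficients are the slices of those of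
  \<open>f\<close>; so the slices of a leading coefficient of \<open>I + J\<close> are leading coefficients of \<open>I\<close>.
\<close>

lemma lead_coeffs_ideal_join:
  "lead_coeffs y (ideal_join X Y I J) d = ideal_join (X - {y}) Y (lead_coeffs y I d) J"
proof
  note join = ideal_ideal_join[OF XY I J] and sup = ideal_join_superset[OF XY I J]
  note L = ideal_lead_coeffs[OF I, of y d]
  have L': "ideal (lead_coeffs y (ideal_join X Y I J) d) (mpoly_ring (X - {y} \<union> Y))"
    using ideal_lead_coeffs[OF join, of y d] by (simp add: XY'(2))
  show "lead_coeffs y (ideal_join X Y I J) d \<subseteq> ideal_join (X - {y}) Y (lead_coeffs y I d) J"
  proof
    fix c assume c: "c \<in> lead_coeffs y (ideal_join X Y I J) d"
    then obtain f where f: "f \<in> ideal_join X Y I J" "y_le y d f" "c = y_coeff y f d"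
      by (rule lead_coeffsE)
    show "c \<in> ideal_join (X - {y}) Y (lead_coeffs y I d) J"
    proof (rule ideal_joinI[OF XY'(1) L J])
      show "c \<in> Pol (X - {y} \<union> Y)" using c ideal_subset[OF L'] by blast
      fix \<xi> assume "kills Y \<xi> J"
      then have "slice Y \<xi> f \<in> I" by (rule slice_ideal_join[OF XY I J f(1)])
      then show "slice Y \<xi> c \<in> lead_coeffs y I d"
        using y_le_slice[OF XY'(3) f(2)] by (rule lead_coeffsI) (simp add: y_coeff_slice_commute[OF XY'(3)] f(3))
    qed
  qed
  show "ideal_join (X - {y}) Y (lead_coeffs y I d) J \<subseteq> lead_coeffs y (ideal_join X Y I J) d"
  proof (rule idl_minimal[OF L'], rule Un_least)
    show "lead_coeffs y I d \<subseteq> lead_coeffs y (ideal_join X Y I J) d"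
      using sup(1) by (auto simp: lead_coeffs_def)
    have "J \<subseteq> ideal_join X Y I J \<inter> Pol (X \<union> Y - {y})"
      using sup(2) ideal_subset[OF J] Pol_mono[of Y "X - {y} \<union> Y"] XY'(2) by auto
    also have "\<dots> = lead_coeffs y (ideal_join X Y I J) 0" by (rule lead_coeffs_0[OF join, symmetric])
    also have "\<dots> \<subseteq> lead_coeffs y (ideal_join X Y I J) d" by (rule lead_coeffs_mono[OF join XY'(4)]) simp
    finally show "J \<subseteq> lead_coeffs y (ideal_join X Y I J) d" .
  qed
qed

lemma all_lead_coeffs_ideal_join:
  "all_lead_coeffs y (ideal_join X Y I J) = ideal_join (X - {y}) Y (all_lead_coeffs y I) J"
proof
  note join = ideal_ideal_join[OF XY I J]
  note A = ideal_all_lead_coeffs[OF I y]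
  have A': "ideal (all_lead_coeffs y (ideal_join X Y I J)) (mpoly_ring (X - {y} \<union> Y))"
    using ideal_all_lead_coeffs[OF join XY'(4)] by (simp add: XY'(2))
  have "ideal_join (X - {y}) Y (lead_coeffs y I d) J \<subseteq> ideal_join (X - {y}) Y (all_lead_coeffs y I) J" for d
    by (rule idl_mono[OF _ ideal_join_subset[OF XY'(1) A J]]) (use lead_coeffs_subset[of y I d] in auto)
  then show "all_lead_coeffs y (ideal_join X Y I J) \<subseteq> ideal_join (X - {y}) Y (all_lead_coeffs y I) J"
    unfolding all_lead_coeffs_def[of y "ideal_join X Y I J"] lead_coeffs_ideal_join by blast
  show "ideal_join (X - {y}) Y (all_lead_coeffs y I) J \<subseteq> all_lead_coeffs y (ideal_join X Y I J)"
  proof (rule idl_minimal[OF A'], rule Un_least)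
    have LA: "lead_coeffs y I d \<union> J \<subseteq> all_lead_coeffs y (ideal_join X Y I J)" for d
      using lead_coeffs_subset[of y "ideal_join X Y I J" d] lead_coeffs_ideal_join[of d]
        ideal_join_superset[OF XY'(1) ideal_lead_coeffs[OF I] J, of d] by blast
    then show "all_lead_coeffs y I \<subseteq> all_lead_coeffs y (ideal_join X Y I J)"
      unfolding all_lead_coeffs_def[of y I] by blast
    show "J \<subseteq> all_lead_coeffs y (ideal_join X Y I J)" using LA[of 0] by blast
  qed
qed

lemma degree_one_leads_ideal_join:
  assumes J1: "1 \<notin> J"
  shows "degree_one_leads y (ideal_join X Y I J) \<longleftrightarrow> degree_one_leads y I"
  unfolding degree_one_leads_def all_lead_coeffs_ideal_join lead_coeffs_ideal_join
proof
  note A = ideal_all_lead_coeffs[OF I y] and L = ideal_lead_coeffs[OF I, of y 1]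
  show "all_lead_coeffs y I \<subseteq> lead_coeffs y I 1"
    if "ideal_join (X - {y}) Y (all_lead_coeffs y I) J \<subseteq> ideal_join (X - {y}) Y (lead_coeffs y I 1) J"
    using that ideal_join_contract[OF XY'(1) A J J1] ideal_join_contract[OF XY'(1) L J J1] by blast
  show "ideal_join (X - {y}) Y (all_lead_coeffs y I) J \<subseteq> ideal_join (X - {y}) Y (lead_coeffs y I 1) J"
    if "all_lead_coeffs y I \<subseteq> lead_coeffs y I 1"
    by (rule idl_mono[OF _ ideal_join_subset[OF XY'(1) L J]]) (use that in auto)
qed

end

section \<open>Independent variables modulo a prime ideal\<close>

definition indep_vars :: "('v, 'k::field) mpolynomial set \<Rightarrow> 'v set \<Rightarrow> bool" where
  "indep_vars I U \<longleftrightarrow> Pol U \<inter> I \<subseteq> {0}"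

text \<open>
  The maximum ranges over sets of variables only, not over arbitrary algebraically independent
  families. For proper ideals this makes it additive for sums, and it turns out to be the dimension.
\<close>

definition vdim :: "'v set \<Rightarrow> ('v, 'k::field) mpolynomial set \<Rightarrow> nat" where
  "vdim V I = Max (card ` {U. U \<subseteq> V \<and> indep_vars I U})"

lemma indep_varsD: "indep_vars I U \<Longrightarrow> f \<in> Pol U \<Longrightarrow> f \<in> I \<Longrightarrow> f = 0"
  by (auto simp: indep_vars_def)

lemma indep_vars_subset: "indep_vars I U \<Longrightarrow> W \<subseteq> U \<Longrightarrow> indep_vars I W"
  using Pol_mono[of W U] by (auto simp: indep_vars_def)

lemma indep_vars_antimono: "indep_vars I U \<Longrightarrow> J \<subseteq> I \<Longrightarrow> indep_vars J U"
  by (auto simp: indep_vars_def)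

lemma indep_vars_empty:
  assumes "ideal I (mpoly_ring V)" "1 \<notin> I"
  shows "indep_vars I {}"
proof -
  have "f = 0" if f: "f \<in> Pol {}" "f \<in> I" for f
  proof (rule ccontr)
    obtain c where c: "f = cst c" using Pol_empty[OF f(1)] by blast
    assume "f \<noteq> 0"
    then have "c \<noteq> 0" using c by auto
    then have "cst (inverse c) * f = 1" unfolding c by (simp flip: cst_simps)
    then show False using ideal_mult[OF assms(1) Pol_cst f(2), of "inverse c"] assms(2) by simp
  qed
  then show ?thesis by (auto simp: indep_vars_def)
qed

lemma finite_indep_sets: "finite V \<Longrightarrow> finite {U. U \<subseteq> V \<and> indep_vars I U}"
  by (rule finite_subset[of _ "Pow V"]) auto

lemma card_le_vdim: "finite V \<Longrightarrow> U \<subseteq> V \<Longrightarrow> indep_vars I U \<Longrightarrow> card U \<le> vdim V I"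
  unfolding vdim_def by (rule Max_ge) (auto simp: finite_indep_sets)

lemma vdim_attained:
  assumes "finite V" "ideal I (mpoly_ring V)" "1 \<notin> I"
  obtains U where "U \<subseteq> V" "indep_vars I U" "card U = vdim V I"
proof -
  have "{} \<in> {U. U \<subseteq> V \<and> indep_vars I U}" using indep_vars_empty[OF assms(2,3)] by auto
  then have "vdim V I \<in> card ` {U. U \<subseteq> V \<and> indep_vars I U}"
    unfolding vdim_def by (intro Max_in finite_imageI finite_indep_sets assms(1)) blast
  then show thesis using that by auto
qed

lemma vdim_antimono:
  assumes "finite V" "ideal I (mpoly_ring V)" "1 \<notin> I" "J \<subseteq> I"
  shows "vdim V I \<le> vdim V J"
proof -
  obtain U where "U \<subseteq> V" "indep_vars I U" "card U = vdim V I" using vdim_attained[OF assms(1-3)] .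
  then show ?thesis using card_le_vdim[OF assms(1), of U J] indep_vars_antimono[OF _ assms(4)] by auto
qed

lemma ex_maximal_indep:
  assumes "finite V" "U0 \<subseteq> V" "indep_vars I U0"
  obtains U where "U0 \<subseteq> U" "U \<subseteq> V" "indep_vars I U" "\<And>x. x \<in> V - U \<Longrightarrow> \<not> indep_vars I (insert x U)"
proof -
  have "U0 \<in> {U. U \<subseteq> V \<and> indep_vars I U}" using assms by auto
  from finite_has_maximal2[OF finite_indep_sets[OF assms(1)] this]
  obtain U where U: "U \<subseteq> V" "indep_vars I U" "U0 \<subseteq> U"
    "\<And>W. W \<subseteq> V \<Longrightarrow> indep_vars I W \<Longrightarrow> U \<subseteq> W \<Longrightarrow> W = U" by (auto simp: eq_commute)
  have "\<not> indep_vars I (insert x U)" if "x \<in> V - U" for x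
  proof
    assume "indep_vars I (insert x U)"
    then have "insert x U = U" using U(1) that by (intro U(4)) auto
    then show False using that by blast
  qed
  then show thesis using that U by blast
qed

lemma Pol_prod_nonzero:
  assumes "finite U" "\<And>i. i \<in> A \<Longrightarrow> f i \<in> Pol U \<and> f i \<noteq> 0"
  shows "prod f A \<noteq> 0"
  using assms(2)
proof (induct A rule: infinite_finite_induct)
  case (insert x F)
  then have "prod f F \<noteq> 0" "prod f F \<in> Pol U" by auto
  then show ?case using insert Pol_no_zero_divisors[OF assms(1), of "f x" "prod f F"] by auto
qed auto

lemma Pol_power_nonzero: "finite U \<Longrightarrow> f \<in> Pol U \<Longrightarrow> f \<noteq> 0 \<Longrightarrow> f ^ n \<noteq> 0"
  using Pol_prod_nonzero[of U "{..<n}" "\<lambda>_. f"] by simp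

lemma finite_bounded_monomials:
  assumes "finite W"
  shows "finite {m :: 'v monomial. keys m \<subseteq> W \<and> (\<forall>x\<in>W. lookup m x \<le> n x)}" (is "finite ?E")
proof -
  have "inj_on (\<lambda>m. restrict (lookup m) W) ?E"
  proof (rule inj_onI, rule poly_mapping_eqI)
    fix m k v assume mk: "m \<in> ?E" "k \<in> ?E" "restrict (lookup m) W = restrict (lookup k) W"
    show "lookup m v = lookup k v"
    proof (cases "v \<in> W")
      case True
      then show ?thesis using mk(3) by (metis restrict_apply')
    next
      case False
      then show ?thesis using mk(1,2) by (metis (mono_tags, lifting) in_keys_iff in_mono mem_Collect_eq)
    qed
  qed
  moreover have "(\<lambda>m. restrict (lookup m) W) ` ?E \<subseteq> (\<Pi>\<^sub>E x\<in>W. {..n x})" by auto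
  then have "finite ((\<lambda>m. restrict (lookup m) W) ` ?E)"
    using finite_subset finite_PiE[OF assms, of "\<lambda>x. {..n x}"] by blast
  ultimately show ?thesis using finite_imageD by blast
qed

text \<open>
  More than \<open>n\<close> vectors of length \<open>n\<close> over an integral domain are linearly dependent: Gaussian
  elimination without division.
\<close>

lemma linear_dependence:
  fixes v :: "'i \<Rightarrow> 'b \<Rightarrow> ('v, 'k::field) mpolynomial"
  assumes U: "finite U" and "finite B" "finite A" "card B < card A"
    and "\<And>i b. v i b \<in> Pol U"
  shows "\<exists>a. (\<forall>i. a i \<in> Pol U) \<and> (\<exists>i\<in>A. a i \<noteq> 0) \<and> (\<forall>b\<in>B. (\<Sum>i\<in>A. a i * v i b) = 0)"
  using assms(2-)
proof (induct B arbitrary: A v rule: finite_induct)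
  case empty
  then have "A \<noteq> {}" by auto
  then show ?case by (intro exI[of _ "\<lambda>_. 1"]) auto
next
  case (insert x B)
  show ?case
  proof (cases "\<forall>i\<in>A. v i x = 0")
    case True
    have "card B < card A" using insert by simp
    then obtain a where "\<forall>i. a i \<in> Pol U" "\<exists>i\<in>A. a i \<noteq> 0" "\<forall>b\<in>B. (\<Sum>i\<in>A. a i * v i b) = 0"
      using insert.hyps(3)[of A v] insert.prems by blast
    with True show ?thesis by (intro exI[of _ a]) auto
  next
    case False
    then obtain j where j: "j \<in> A" "v j x \<noteq> 0" by blast
    let ?A = "A - {j}" and ?w = "\<lambda>i b. v j x * v i b - v i x * v j b"
    have "card B < card ?A" using insert j by simp
    moreover have "?w i b \<in> Pol U" for i b using insert.prems by auto
    ultimately obtain a where a: "\<forall>i. a i \<in> Pol U" "\<exists>i\<in>?A. a i \<noteq> 0" "\<forall>b\<in>B. (\<Sum>i\<in>?A. a i * ?w i b) = 0"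
      using insert.hyps(3)[of ?A ?w] insert.prems by blast
    \<comment> \<open>the coefficient of the pivot row j is chosen such that the entry at x cancels\<close>
    define s where "s = (\<Sum>i\<in>?A. a i * v i x)"
    let ?a = "\<lambda>i. if i = j then - s else a i * v j x"
    have sum: "(\<Sum>i\<in>A. ?a i * v i b) = (\<Sum>i\<in>?A. a i * ?w i b)" for b
    proof -
      have "(\<Sum>i\<in>A. ?a i * v i b) = - s * v j b + (\<Sum>i\<in>?A. a i * v j x * v i b)"
        by (subst sum.remove[OF insert.prems(1) j(1)]) (simp cong: sum.cong_simp)
      also have "\<dots> = (\<Sum>i\<in>?A. a i * ?w i b)"
        by (simp add: s_def sum_distrib_right right_diff_distrib sum_subtractf mult.assoc)
      finally show ?thesis .
    qed
    have "(\<Sum>i\<in>A. ?a i * v i b) = 0" if "b \<in> insert x B" for b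
      unfolding sum using that a(3) by (auto simp: mult.commute)
    moreover have "?a i \<in> Pol U" for i
    proof -
      have "s \<in> Pol U" unfolding s_def using a(1) insert.prems by (intro Pol_sum Pol_mult) auto
      then show ?thesis using a(1) insert.prems by (auto intro: Pol_uminus)
    qed
    moreover have "\<exists>i\<in>A. ?a i \<noteq> 0"
    proof -
      obtain i where i: "i \<in> ?A" "a i \<noteq> 0" using a(2) by blast
      then have "a i * v j x \<noteq> 0"
        using Pol_no_zero_divisors[OF U, of "a i" "v j x"] a(1) insert.prems j by blast
      then show ?thesis using i by (intro bexI[of _ i]) auto
    qed
    ultimately show ?thesis by (intro exI[of _ ?a]) blast
  qed
qed

text \<open>
  The \<open>\<bbbk>[U]\<close>-span of \<open>B\<close> in \<open>\<bbbk>[V]/P\<close>, as a subset of \<open>\<bbbk>[V]\<close>.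
\<close>

definition span_mod :: "'v set \<Rightarrow> ('v, 'k::field) mpolynomial set \<Rightarrow> ('v, 'k) mpolynomial set \<Rightarrow> ('v, 'k) mpolynomial set" where
  "span_mod U P B = {f. \<exists>\<alpha>. (\<forall>b. \<alpha> b \<in> Pol U) \<and> f - (\<Sum>b\<in>B. \<alpha> b * b) \<in> P}"

definition indep_mod :: "'v set \<Rightarrow> ('v, 'k::field) mpolynomial set \<Rightarrow> ('v, 'k) mpolynomial set \<Rightarrow> bool" where
  "indep_mod U P B \<longleftrightarrow>
     (\<forall>\<alpha>. (\<forall>b. \<alpha> b \<in> Pol U) \<longrightarrow> (\<Sum>b\<in>B. \<alpha> b * b) \<in> P \<longrightarrow> (\<forall>b\<in>B. \<alpha> b = 0))"

lemma indep_modD: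
  assumes "indep_mod U P B" "\<And>b. \<alpha> b \<in> Pol U" "(\<Sum>b\<in>B. \<alpha> b * b) \<in> P" "b \<in> B"
  shows "\<alpha> b = 0"
  using assms unfolding indep_mod_def by blast

text \<open>The span after inverting \<open>c\<close>, pulled back to the polynomial ring.\<close>

definition loc_span :: "'v set \<Rightarrow> ('v, 'k::field) mpolynomial set \<Rightarrow> ('v, 'k) mpolynomial \<Rightarrow> ('v, 'k) mpolynomial set \<Rightarrow> ('v, 'k) mpolynomial set" where
  "loc_span U P c B = {f. \<exists>k. c ^ k * f \<in> span_mod U P B}"

context
  fixes V U :: "'v set" and P :: "('v, 'k::field) mpolynomial set"
  assumes P: "ideal P (mpoly_ring V)" and UV: "U \<subseteq> V"
begin

lemma span_mod_add:
  assumes "f \<in> span_mod U P B" "g \<in> span_mod U P B"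
  shows "f + g \<in> span_mod U P B"
proof -
  obtain \<alpha> \<beta> where "\<forall>b. \<alpha> b \<in> Pol U" "f - (\<Sum>b\<in>B. \<alpha> b * b) \<in> P"
    "\<forall>b. \<beta> b \<in> Pol U" "g - (\<Sum>b\<in>B. \<beta> b * b) \<in> P"
    using assms by (auto simp: span_mod_def)
  moreover from this have "f + g - (\<Sum>b\<in>B. (\<alpha> b + \<beta> b) * b) \<in> P"
    using ideal_add[OF P] by (fastforce simp: distrib_right sum.distrib algebra_simps)
  ultimately show ?thesis unfolding span_mod_def by (intro CollectI exI[of _ "\<lambda>b. \<alpha> b + \<beta> b"]) auto
qed

lemma span_mod_mult:
  assumes "f \<in> span_mod U P B" "a \<in> Pol U"
  shows "a * f \<in> span_mod U P B"
proof -
  obtain \<alpha> where \<alpha>: "\<forall>b. \<alpha> b \<in> Pol U" "f - (\<Sum>b\<in>B. \<alpha> b * b) \<in> P"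
    using assms by (auto simp: span_mod_def)
  have "a * (f - (\<Sum>b\<in>B. \<alpha> b * b)) \<in> P"
    using ideal_mult[OF P _ \<alpha>(2)] assms(2) Pol_mono[OF UV] by blast
  then have "a * f - (\<Sum>b\<in>B. (a * \<alpha> b) * b) \<in> P"
    by (simp add: right_diff_distrib sum_distrib_left mult.assoc)
  then show ?thesis
    using \<alpha>(1) assms(2) unfolding span_mod_def by (intro CollectI exI[of _ "\<lambda>b. a * \<alpha> b"]) auto
qed

lemma span_mod_ideal: "f \<in> P \<Longrightarrow> f \<in> span_mod U P B"
  unfolding span_mod_def by (intro CollectI exI[of _ "\<lambda>_. 0"]) auto

lemma span_mod_sum: "(\<And>i. i \<in> A \<Longrightarrow> f i \<in> span_mod U P B) \<Longrightarrow> sum f A \<in> span_mod U P B"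
  by (induct A rule: infinite_finite_induct) (auto intro: span_mod_add span_mod_ideal ideal_zero[OF P])

lemma span_mod_base: "finite B \<Longrightarrow> b \<in> B \<Longrightarrow> b \<in> span_mod U P B"
proof -
  assume B: "finite B" "b \<in> B"
  have "(\<Sum>x\<in>B. (if x = b then 1 else 0) * x) = (\<Sum>x\<in>B. if x = b then b else 0)"
    by (rule sum.cong) auto
  also have "\<dots> = b" using B by simp
  finally have "b - (\<Sum>x\<in>B. (if x = b then 1 else 0) * x) \<in> P" using ideal_zero[OF P] by simp
  then show ?thesis unfolding span_mod_def by (intro CollectI exI[of _ "\<lambda>x. if x = b then 1 else 0"]) auto
qed

lemma span_mod_cong: "f - g \<in> P \<Longrightarrow> g \<in> span_mod U P B \<Longrightarrow> f \<in> span_mod U P B"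
  using span_mod_add[of "f - g" B g] span_mod_ideal by simp

lemma span_mod_trans:
  assumes f: "f \<in> span_mod U P B" and d: "\<And>b. b \<in> B \<Longrightarrow> d * b \<in> span_mod U P C" and dU: "d \<in> Pol U"
  shows "d * f \<in> span_mod U P C"
proof -
  obtain \<alpha> where \<alpha>: "\<forall>b. \<alpha> b \<in> Pol U" "f - (\<Sum>b\<in>B. \<alpha> b * b) \<in> P"
    using f by (auto simp: span_mod_def)
  have "d * (f - (\<Sum>b\<in>B. \<alpha> b * b)) \<in> P"
    using ideal_mult[OF P _ \<alpha>(2)] dU Pol_mono[OF UV] by blast
  then have "d * f - (\<Sum>b\<in>B. \<alpha> b * (d * b)) \<in> P"
    by (simp add: right_diff_distrib sum_distrib_left mult_ac)
  moreover have "(\<Sum>b\<in>B. \<alpha> b * (d * b)) \<in> span_mod U P C"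
    by (rule span_mod_sum) (rule span_mod_mult[OF d], use \<alpha>(1) in auto)
  ultimately show ?thesis by (rule span_mod_cong)
qed

lemma loc_span_raise:
  assumes "c \<in> Pol U" "c ^ k * f \<in> span_mod U P B" "k \<le> l"
  shows "c ^ l * f \<in> span_mod U P B"
proof -
  have "c ^ (l - k) * (c ^ k * f) \<in> span_mod U P B" using assms(1) by (intro span_mod_mult[OF assms(2)]) auto
  moreover have "c ^ (l - k) * (c ^ k * f) = c ^ l * f" using assms(3) by (simp flip: power_add mult.assoc)
  ultimately show ?thesis by simp
qed

lemma loc_span_add: "c \<in> Pol U \<Longrightarrow> f \<in> loc_span U P c B \<Longrightarrow> g \<in> loc_span U P c B \<Longrightarrow> f + g \<in> loc_span U P c B"
proof -
  assume c: "c \<in> Pol U" and "f \<in> loc_span U P c B" "g \<in> loc_span U P c B"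
  then obtain k l where "c ^ k * f \<in> span_mod U P B" "c ^ l * g \<in> span_mod U P B"
    by (auto simp: loc_span_def)
  then have "c ^ (max k l) * f \<in> span_mod U P B" "c ^ (max k l) * g \<in> span_mod U P B"
    using loc_span_raise[OF c] by (meson max.cobounded1 max.cobounded2)+
  then show ?thesis
    using span_mod_add unfolding loc_span_def by (auto simp: distrib_left intro!: exI[of _ "max k l"])
qed

lemma loc_span_mult: "a \<in> Pol U \<Longrightarrow> f \<in> loc_span U P c B \<Longrightarrow> a * f \<in> loc_span U P c B"
  unfolding loc_span_def by (auto dest: span_mod_mult simp: mult.left_commute)

lemma loc_span_span: "f \<in> span_mod U P B \<Longrightarrow> f \<in> loc_span U P c B"
  unfolding loc_span_def by (auto intro!: exI[of _ 0])

lemma loc_span_sum: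
  "c \<in> Pol U \<Longrightarrow> (\<And>i. i \<in> A \<Longrightarrow> f i \<in> loc_span U P c B) \<Longrightarrow> sum f A \<in> loc_span U P c B"
  by (induct A rule: infinite_finite_induct)
     (auto intro: loc_span_add loc_span_span span_mod_ideal ideal_zero[OF P])

lemma loc_span_cancel: "c * f \<in> loc_span U P c B \<Longrightarrow> f \<in> loc_span U P c B"
proof -
  assume "c * f \<in> loc_span U P c B"
  then obtain k where "c ^ k * (c * f) \<in> span_mod U P B" by (auto simp: loc_span_def)
  then have "c ^ Suc k * f \<in> span_mod U P B" by (simp add: mult_ac)
  then show ?thesis unfolding loc_span_def by blast
qed

text \<open>
  The relation is a nonzero member of \<open>P \<inter> \<bbbk>[U \<union> {x}]\<close>, expanded in powers of \<open>x\<close>.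
\<close>

lemma algebraic_relation:
  assumes x: "\<not> indep_vars P (insert x U)" "x \<notin> U"
  obtains c n \<alpha> where "c \<in> Pol U" "c \<noteq> 0" "\<And>i. \<alpha> i \<in> Pol U"
    "c * mvar x ^ n - (\<Sum>i<n. \<alpha> i * mvar x ^ i) \<in> P"
proof -
  obtain f where f: "f \<in> Pol (insert x U)" "f \<in> P" "f \<noteq> 0" using x by (auto simp: indep_vars_def)
  let ?n = "y_degree x f"
  have co: "y_coeff x f i \<in> Pol U" for i using y_coeff_in_Pol[OF f(1), of x i] x(2) by simp
  have "f = (\<Sum>i\<le>?n. y_coeff x f i * mvar x ^ i)" by (rule y_expand[OF y_le_y_degree[OF f(3)]])
  also have "\<dots> = y_coeff x f ?n * mvar x ^ ?n - (\<Sum>i<?n. (- y_coeff x f i) * mvar x ^ i)"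
    by (simp add: sum_negf lessThan_Suc_atMost[symmetric])
  finally have "y_coeff x f ?n * mvar x ^ ?n - (\<Sum>i<?n. (- y_coeff x f i) * mvar x ^ i) \<in> P"
    using f(2) by simp
  moreover have "y_coeff x f ?n \<noteq> 0" using y_lead_coeff_nonzero[OF f(3), of x] by (simp add: y_lead_coeff_def)
  ultimately show thesis using that[of "y_coeff x f ?n" "\<lambda>i. - y_coeff x f i" ?n] co by auto
qed

text \<open>
  Every variable outside \<open>U\<close> is integral over \<open>\<bbbk>[U]\<close> after inverting the leading coefficient of its
  algebraic relation. Inverting the product \<open>c\<close> of these coefficients, all monomials are reduced to
  the finitely many of bounded degree in each variable outside \<open>U\<close>.
\<close>

lemma spanning_monomials:
  assumes V: "finite V" and max: "\<And>x. x \<in> V - U \<Longrightarrow> \<not> indep_vars P (insert x U)"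
  obtains c S where "c \<in> Pol U" "c \<noteq> 0" "finite S" "S \<subseteq> Pol V" "1 \<in> S" "\<And>f. f \<in> Pol V \<Longrightarrow> f \<in> loc_span U P c S"
proof -
  let ?W = "V - U"
  have fU: "finite U" using V UV finite_subset by blast
  define R where "R x = (\<lambda>(c, n, \<alpha>). c \<in> Pol U \<and> c \<noteq> 0 \<and> (\<forall>i. \<alpha> i \<in> Pol U) \<and>
      c * mvar x ^ n - (\<Sum>i<n. \<alpha> i * mvar x ^ i) \<in> P)" for x
  have "\<exists>t. R x t" if "x \<in> ?W" for x
  proof -
    have "x \<notin> U" using that by blast
    show ?thesis
    proof (rule algebraic_relation[OF max[OF that] \<open>x \<notin> U\<close>])
      fix c n \<alpha>
      assume "c \<in> Pol U" "c \<noteq> 0" "\<And>i. \<alpha> i \<in> Pol U" "c * mvar x ^ n - (\<Sum>i<n. \<alpha> i * mvar x ^ i) \<in> P"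
      then have "R x (c, n, \<alpha>)" by (simp add: R_def)
      then show ?thesis by blast
    qed
  qed
  then obtain t where t: "\<And>x. x \<in> ?W \<Longrightarrow> R x (t x)" by metis
  define c n \<alpha> where "c x = fst (t x)" and "n x = fst (snd (t x))" and "\<alpha> x = snd (snd (t x))" for x
  have rel: "c x \<in> Pol U \<and> c x \<noteq> 0 \<and> (\<forall>i. \<alpha> x i \<in> Pol U) \<and>
      c x * mvar x ^ n x - (\<Sum>i<n x. \<alpha> x i * mvar x ^ i) \<in> P" if "x \<in> ?W" for x
    using t[OF that] by (simp add: R_def c_def n_def \<alpha>_def case_prod_unfold)
  define d where "d = prod c ?W"
  have dU: "d \<in> Pol U" unfolding d_def using rel by blast
  have d0: "d \<noteq> 0" unfolding d_def by (rule Pol_prod_nonzero[OF fU]) (use rel in blast)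
  let ?E = "{m :: 'v monomial. keys m \<subseteq> ?W \<and> (\<forall>x\<in>?W. lookup m x \<le> n x)}"
  let ?S = "(\<lambda>m. single m 1) ` ?E :: ('v, 'k) mpolynomial set"
  have fS: "finite ?S" using finite_bounded_monomials[of ?W n] V by auto
  have mono: "(single m 1 :: ('v, 'k) mpolynomial) \<in> loc_span U P d ?S" if "keys m \<subseteq> ?W" for m
    using that
  proof (induct "\<Sum>x\<in>?W. lookup m x" arbitrary: m rule: less_induct)
    case (less m)
    show ?case
    proof (cases "m \<in> ?E")
      case True
      then show ?thesis by (intro loc_span_span span_mod_base[OF fS]) auto
    next
      case False
      then obtain x where x: "x \<in> ?W" "lookup m x > n x" using less.prems by (auto simp: not_le)
      let ?m = "m - single x (n x)"
      have m: "m = ?m + single x (n x)"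
        by (rule poly_mapping_eqI) (use x in \<open>auto simp: lookup_add lookup_minus lookup_single when_def\<close>)
      have km: "keys ?m \<subseteq> ?W" using m less.prems keys_add_monomial[of ?m "single x (n x)"] by auto
      have ms: "(single (?m + single x i) 1 :: ('v, 'k) mpolynomial) = single ?m 1 * mvar x ^ i" for i
        by (simp add: mvar_power mult_single)
      \<comment> \<open>d = q * c x, so the relation for x, multiplied by q and the monomial ?m, rewrites d * m\<close>
      define q where "q = prod c (?W - {x})"
      have qU: "q \<in> Pol U" unfolding q_def using rel by blast
      have d: "d = q * c x" unfolding d_def q_def using x(1) V by (subst prod.remove[of _ x]) (auto simp: mult.commute)
      have "q * single ?m 1 * (c x * mvar x ^ n x - (\<Sum>i<n x. \<alpha> x i * mvar x ^ i)) \<in> P"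
      proof (rule ideal_mult[OF P])
        show "q * single ?m 1 \<in> Pol V" using qU Pol_mono[OF UV] km by (intro Pol_mult Pol_single) auto
      qed (use rel x in blast)
      moreover have "q * single ?m 1 * (c x * mvar x ^ n x) = d * single m 1"
        using ms[of "n x"] m by (simp add: d mult_ac)
      moreover have "q * single ?m 1 * (\<Sum>i<n x. \<alpha> x i * mvar x ^ i)
          = (\<Sum>i<n x. q * \<alpha> x i * single (?m + single x i) 1)"
        unfolding sum_distrib_left by (rule sum.cong) (auto simp: ms mult_ac)
      ultimately have cong: "d * single m 1 - (\<Sum>i<n x. q * \<alpha> x i * single (?m + single x i) 1) \<in> P"
        by (simp add: right_diff_distrib)
      have "(\<Sum>i<n x. q * \<alpha> x i * single (?m + single x i) 1) \<in> loc_span U P d ?S"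
      proof (intro loc_span_sum[OF dU] loc_span_mult)
        fix i assume i: "i \<in> {..<n x}"
        show "q * \<alpha> x i \<in> Pol U" using qU rel x by blast
        show "single (?m + single x i) 1 \<in> loc_span U P d ?S"
        proof (rule less.hyps)
          show "keys (?m + single x i) \<subseteq> ?W" using km x by auto
          have "(\<Sum>v\<in>?W. lookup (?m + single x i) v) < (\<Sum>v\<in>?W. lookup (?m + single x (n x)) v)"
            by (rule sum_strict_mono_ex1)
               (use V x i in \<open>auto simp: lookup_add lookup_single when_def intro!: bexI[of _ x]\<close>)
          then show "(\<Sum>v\<in>?W. lookup (?m + single x i) v) < (\<Sum>v\<in>?W. lookup m v)" using m by simp
        qed
      qed
      from loc_span_add[OF dU loc_span_span[OF span_mod_ideal[OF cong]] this]
      have "d * single m 1 \<in> loc_span U P d ?S" by (simp only: diff_add_cancel)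
      then show ?thesis by (rule loc_span_cancel)
    qed
  qed
  have "f \<in> loc_span U P d ?S" if "f \<in> Pol V" for f
    using that
  proof (induct rule: Pol_induct)
    case zero
    then show ?case by (intro loc_span_span span_mod_ideal ideal_zero[OF P])
  next
    case (single m a)
    have "single (mres U m) a * single (mres (- U) m) 1 \<in> loc_span U P d ?S"
      using single by (intro loc_span_mult mono) auto
    then show ?case by (simp add: mult_single mres_split)
  next
    case (add f g)
    then show ?case using loc_span_add[OF dU] by blast
  qed
  moreover have "?S \<subseteq> Pol V" by auto
  moreover have "1 \<in> ?S" by (intro image_eqI[of _ _ 0]) auto
  ultimately show thesis using that[of d ?S] dU d0 fS by blast
qed

text \<open>
  Generic freeness: after inverting \<open>D\<close> in both rings, \<open>\<bbbk>[V]/P\<close> is a free module over \<open>\<bbbk>[U]\<close> with the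
  finite basis \<open>B\<close>. It is a maximal independent subset of the spanning monomials, and \<open>D\<close> also contains the
  coefficients with which the other monomials depend on \<open>B\<close>. That \<open>1\<close> is a basis element allows to
  read off the elements of \<open>\<bbbk>[U]\<close>.
\<close>

lemma generic_basis:
  assumes V: "finite V" and ind: "indep_vars P U" and max: "\<And>x. x \<in> V - U \<Longrightarrow> \<not> indep_vars P (insert x U)"
  obtains D B where "D \<in> Pol U" "D \<noteq> 0" "finite B" "B \<subseteq> Pol V" "1 \<in> B" "indep_mod U P B"
    "\<And>f. f \<in> Pol V \<Longrightarrow> \<exists>k. D ^ k * f \<in> span_mod U P B"
proof -
  have fU: "finite U" using V UV finite_subset by blast
  obtain c S where S: "c \<in> Pol U" "c \<noteq> 0" "finite S" "S \<subseteq> Pol V" "1 \<in> S" "\<And>f. f \<in> Pol V \<Longrightarrow> f \<in> loc_span U P c S"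
    using spanning_monomials[OF V max] by blast
  let ?F = "{B. B \<subseteq> S \<and> indep_mod U P B}"
  have "{1} \<in> ?F" using S(5) ind by (auto simp: indep_mod_def dest: indep_varsD)
  moreover have "finite ?F" by (rule finite_subset[of _ "Pow S"]) (use S(3) in auto)
  ultimately obtain B where B: "B \<subseteq> S" "indep_mod U P B" "{1} \<subseteq> B"
    "\<And>B'. B' \<subseteq> S \<Longrightarrow> indep_mod U P B' \<Longrightarrow> B \<subseteq> B' \<Longrightarrow> B' = B"
    using finite_has_maximal2[of ?F "{1}"] by (auto simp: eq_commute)
  have fB: "finite B" using B(1) S(3) finite_subset by blast
  have "\<exists>d. d \<in> Pol U \<and> d \<noteq> 0 \<and> d * s \<in> span_mod U P B" if s: "s \<in> S" for s
  proof (cases "s \<in> B")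
    case True
    then show ?thesis using span_mod_base[OF fB] by (intro exI[of _ 1]) auto
  next
    case False
    have "\<not> indep_mod U P (insert s B)"
    proof
      assume "indep_mod U P (insert s B)"
      then have "insert s B = B" using B(1) s by (intro B(4)) auto
      then show False using False by blast
    qed
    then obtain \<alpha> where \<alpha>: "\<forall>b. \<alpha> b \<in> Pol U" "(\<Sum>b\<in>insert s B. \<alpha> b * b) \<in> P" "\<exists>b\<in>insert s B. \<alpha> b \<noteq> 0"
      by (auto simp: indep_mod_def)
    then have sum: "\<alpha> s * s + (\<Sum>b\<in>B. \<alpha> b * b) \<in> P" using False fB by simp
    have "\<alpha> s \<noteq> 0"
    proof
      assume "\<alpha> s = 0"
      then have "\<forall>b\<in>B. \<alpha> b = 0" using sum \<alpha>(1) B(2) by (auto simp: indep_mod_def)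
      then show False using \<alpha>(3) \<open>\<alpha> s = 0\<close> by auto
    qed
    moreover have "\<alpha> s * s \<in> span_mod U P B"
      using sum \<alpha>(1) unfolding span_mod_def by (intro CollectI exI[of _ "\<lambda>b. - \<alpha> b"]) (auto simp: sum_negf)
    ultimately show ?thesis using \<alpha>(1) by blast
  qed
  then obtain d where d: "\<And>s. s \<in> S \<Longrightarrow> d s \<in> Pol U \<and> d s \<noteq> 0 \<and> d s * s \<in> span_mod U P B" by metis
  let ?d = "prod d S"
  have dU: "?d \<in> Pol U" using d by blast
  have "?d \<noteq> 0" by (rule Pol_prod_nonzero[OF fU]) (use d in blast)
  then have nz: "?d * c \<noteq> 0" using Pol_no_zero_divisors[OF fU dU S(1)] S(2) by blast
  have ds: "?d * s \<in> span_mod U P B" if "s \<in> S" for s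
  proof -
    have ds: "d s * s \<in> span_mod U P B" using d that by blast
    have "prod d (S - {s}) * (d s * s) \<in> span_mod U P B" using d by (intro span_mod_mult[OF ds]) auto
    then show ?thesis using that S(3) by (simp add: prod.remove[of S s] mult_ac)
  qed
  have "\<exists>k. (?d * c) ^ k * f \<in> span_mod U P B" if f: "f \<in> Pol V" for f
  proof -
    obtain k where "c ^ k * f \<in> span_mod U P S" using S(6)[OF f] by (auto simp: loc_span_def)
    then have "?d * (c ^ k * f) \<in> span_mod U P B" using ds dU by (rule span_mod_trans)
    then have "(?d ^ k * c) * (?d * (c ^ k * f)) \<in> span_mod U P B"
      by (rule span_mod_mult) (use dU S(1) in auto)
    moreover have "(?d ^ k * c) * (?d * (c ^ k * f)) = (?d * c) ^ Suc k * f"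
      by (simp add: power_mult_distrib mult_ac)
    ultimately show ?thesis by metis
  qed
  then show thesis using that[of "?d * c" B] nz dU S(1,4) B fB by blast
qed

end

text \<open>
  Modulo \<open>P\<close>, the powers of \<open>h\<close> are linearly dependent over \<open>\<bbbk>[U]\<close>, as they lie, up to powers of \<open>D\<close>,
  in a module of finite rank. Cancelling the lowest power of \<open>h\<close> in a relation makes the
  lowest coefficient \<open>e\<close> a multiple of \<open>h\<close>.
\<close>

lemma inverse_mod_prime:
  fixes P :: "('v, 'k::field) mpolynomial set"
  assumes V: "finite V" and prime: "primeideal P (mpoly_ring V)" and UV: "U \<subseteq> V" and ind: "indep_vars P U"
    and max: "\<And>x. x \<in> V - U \<Longrightarrow> \<not> indep_vars P (insert x U)" and h: "h \<in> Pol V" "h \<notin> P"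
  obtains h' e where "h' \<in> Pol V" "e \<in> Pol U" "e \<noteq> 0" "h * h' - e \<in> P"
proof -
  have fU: "finite U" using V UV finite_subset by blast
  note P = prime_ideal[OF prime]
  have Pol_U: "f \<in> Pol V" if "f \<in> Pol U" for f :: "('v, 'k) mpolynomial" using that UV by (rule Pol_mono')
  from generic_basis[OF P UV V ind max] obtain D B where D: "D \<in> Pol U" "D \<noteq> 0"
    and B: "finite B" "B \<subseteq> Pol V"
    and DB: "\<And>f. f \<in> Pol V \<Longrightarrow> \<exists>k. D ^ k * f \<in> span_mod U P B"
    by (metis (no_types, lifting))
  define N where "N = card B"
  have "\<exists>k. D ^ k * h ^ i \<in> span_mod U P B" for i using DB h(1) by blast
  then obtain k where k: "\<And>i. D ^ k i * h ^ i \<in> span_mod U P B" by metis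
  \<comment> \<open>one power of D that works for all powers of h at once\<close>
  define K where "K = (\<Sum>i\<le>N. k i)"
  have "\<forall>i. \<exists>\<alpha>. (\<forall>b. \<alpha> b \<in> Pol U) \<and> (i \<le> N \<longrightarrow> D ^ K * h ^ i - (\<Sum>b\<in>B. \<alpha> b * b) \<in> P)"
  proof
    fix i
    show "\<exists>\<alpha>. (\<forall>b. \<alpha> b \<in> Pol U) \<and> (i \<le> N \<longrightarrow> D ^ K * h ^ i - (\<Sum>b\<in>B. \<alpha> b * b) \<in> P)"
    proof (cases "i \<le> N")
      case True
      then have "k i \<le> K" unfolding K_def by (intro member_le_sum) auto
      then have "D ^ K * h ^ i \<in> span_mod U P B" by (rule loc_span_raise[OF P UV D(1) k])
      then show ?thesis unfolding span_mod_def by blast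
    next
      case False
      then show ?thesis by (intro exI[of _ "\<lambda>_. 0"]) auto
    qed
  qed
  from choice[OF this] obtain \<alpha> where \<alpha>: "\<And>i b. \<alpha> i b \<in> Pol U"
    and rel: "\<And>i. i \<le> N \<Longrightarrow> D ^ K * h ^ i - (\<Sum>b\<in>B. \<alpha> i b * b) \<in> P" by blast
  have "card B < card {..N}" by (simp add: N_def)
  from linear_dependence[OF fU B(1) finite_atMost this \<alpha>]
  obtain a where a0: "(\<forall>i. a i \<in> Pol U) \<and> (\<exists>i\<in>{..N}. a i \<noteq> 0) \<and> (\<forall>b\<in>B. (\<Sum>i\<le>N. a i * \<alpha> i b) = 0)"
    by (rule exE)
  have a: "\<And>i. a i \<in> Pol U" "\<exists>i\<le>N. a i \<noteq> 0" "\<And>b. b \<in> B \<Longrightarrow> (\<Sum>i\<le>N. a i * \<alpha> i b) = 0"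
    using a0 by auto
  define a' where "a' i = a i * D ^ K" for i
  have a'U: "a' i \<in> Pol U" for i using a(1) D(1) by (auto simp: a'_def)
  have sumP: "(\<Sum>i\<le>N. a' i * h ^ i) \<in> P"
  proof -
    have "(\<Sum>i\<le>N. a i * (D ^ K * h ^ i - (\<Sum>b\<in>B. \<alpha> i b * b))) \<in> P"
      using rel a(1) Pol_U by (intro ideal_sum[OF P] ideal_mult[OF P]) auto
    moreover have "(\<Sum>i\<le>N. a i * (\<Sum>b\<in>B. \<alpha> i b * b)) = (\<Sum>b\<in>B. (\<Sum>i\<le>N. a i * \<alpha> i b) * b)"
      unfolding sum_distrib_left sum_distrib_right by (subst sum.swap) (simp add: mult.assoc)
    moreover have "\<dots> = 0" using a(3) by simp
    ultimately show ?thesis by (simp add: right_diff_distrib sum_subtractf a'_def mult.assoc)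
  qed
  obtain i where i: "i \<le> N" "a i \<noteq> 0" using a(2) by blast
  have "a' i \<noteq> 0"
    using Pol_no_zero_divisors[OF fU a(1), of "D ^ K" i] Pol_power_nonzero[OF fU D, of K] i(2) D(1)
    by (auto simp: a'_def)
  define j where "j = (LEAST i. a' i \<noteq> 0)"
  have j: "a' j \<noteq> 0" "j \<le> i" unfolding j_def
    using LeastI[of "\<lambda>i. a' i \<noteq> 0" i] Least_le[of "\<lambda>i. a' i \<noteq> 0" i] \<open>a' i \<noteq> 0\<close> by auto
  have less: "a' l = 0" if "l < j" for l using not_less_Least[of l "\<lambda>i. a' i \<noteq> 0"] that unfolding j_def by blast
  define w where "w = (\<Sum>l\<in>{j<..N}. a' l * h ^ (l - j - 1))"
  have wV: "w \<in> Pol V" unfolding w_def using a'U Pol_U h(1) by (intro Pol_sum Pol_mult Pol_power) auto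
  have "(\<Sum>i\<le>N. a' i * h ^ i) = (\<Sum>i\<in>{j..N}. a' i * h ^ i)"
    by (rule sum.mono_neutral_right) (auto simp: less)
  also have "\<dots> = a' j * h ^ j + (\<Sum>i\<in>{j<..N}. a' i * h ^ i)"
    using i j(2) by (subst sum.head) auto
  also have "(\<Sum>i\<in>{j<..N}. a' i * h ^ i) = h ^ j * (h * w)"
    unfolding w_def sum_distrib_left
  proof (rule sum.cong[OF refl])
    fix l assume "l \<in> {j<..N}"
    then have "h ^ l = h ^ (j + 1 + (l - j - 1))" by simp
    then have "h ^ l = h ^ j * h * h ^ (l - j - 1)" by (simp only: power_add power_one_right)
    then show "a' l * h ^ l = h ^ j * (h * (a' l * h ^ (l - j - 1)))" by (simp add: mult_ac)
  qed
  finally have "h ^ j * (a' j + h * w) \<in> P" using sumP by (simp add: algebra_simps)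
  moreover have "h ^ j \<notin> P" using prime_power[OF prime] h by blast
  ultimately have "a' j + h * w \<in> P"
    using prime_mult[OF prime] h(1) wV a'U Pol_U by blast
  moreover have "h * (- w) - a' j = - (a' j + h * w)"
    by (simp only: diff_conv_add_uminus mult_minus_right minus_add_distrib add.commute)
  ultimately have "h * (- w) - a' j \<in> P" using ideal_uminus[OF P] by metis
  then show thesis using that[of "- w" "a' j"] wV a'U j(1) by auto
qed

text \<open>
  Otherwise some \<open>U\<close> would be a maximal independent set for both primes. An element \<open>h\<close> of \<open>Q - P\<close>
  divides a nonzero element of \<open>\<bbbk>[U]\<close> modulo \<open>P\<close>, which then lies in \<open>Q\<close>.
\<close>

lemma vdim_strict:
  fixes P Q :: "('v, 'k::field) mpolynomial set"
  assumes V: "finite V" and P: "primeideal P (mpoly_ring V)" and Q: "primeideal Q (mpoly_ring V)"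
    and PQ: "P \<subset> Q"
  shows "vdim V Q < vdim V P"
proof (rule ccontr)
  assume "\<not> ?thesis"
  obtain U where U: "U \<subseteq> V" "indep_vars Q U" "card U = vdim V Q"
    using vdim_attained[OF V prime_ideal[OF Q] prime_one[OF Q]] .
  have ind: "indep_vars P U" using U(2) PQ by (auto intro: indep_vars_antimono)
  have max: "\<not> indep_vars P (insert x U)" if "x \<in> V - U" for x
  proof
    assume "indep_vars P (insert x U)"
    then have "card (insert x U) \<le> vdim V P" using card_le_vdim[OF V, of "insert x U" P] U(1) that by auto
    moreover have "card (insert x U) = Suc (card U)" using that finite_subset[OF U(1) V] by simp
    ultimately show False using U(3) \<open>\<not> vdim V Q < vdim V P\<close> by simp
  qed
  obtain h where h: "h \<in> Q" "h \<notin> P" using PQ by blast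
  have hV: "h \<in> Pol V" using h ideal_subset[OF prime_ideal[OF Q]] by blast
  obtain h' e where e: "h' \<in> Pol V" "e \<in> Pol U" "e \<noteq> 0" "h * h' - e \<in> P"
    using inverse_mod_prime[OF V P U(1) ind max hV h(2)] by blast
  have "h * h' \<in> Q" using ideal_mult'[OF prime_ideal[OF Q] e(1) h(1)] .
  then have "e \<in> Q" using ideal_diff_iff[OF prime_ideal[OF Q], of "h * h'" e] e(4) PQ by blast
  then show False using e U(2) by (auto dest: indep_varsD)
qed

section \<open>Primes avoiding a multiplicative set\<close>

definition adjoin :: "'v set \<Rightarrow> ('v, 'k::field) mpolynomial set \<Rightarrow> ('v, 'k) mpolynomial \<Rightarrow> ('v, 'k) mpolynomial set" where
  "adjoin V I a = {p + r * a |p r. p \<in> I \<and> r \<in> Pol V}"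

lemma adjoin_props:
  assumes I: "ideal I (mpoly_ring V)" and a: "a \<in> Pol V"
  shows ideal_adjoin: "ideal (adjoin V I a) (mpoly_ring V)"
    and adjoin_superset: "I \<subseteq> adjoin V I a" and adjoin_mem: "a \<in> adjoin V I a"
proof -
  have mem: "p + r * a \<in> adjoin V I a" if "p \<in> I" "r \<in> Pol V" for p r
    using that unfolding adjoin_def by blast
  show "I \<subseteq> adjoin V I a" using mem[of _ 0] by auto
  show "a \<in> adjoin V I a" using mem[of 0 1] ideal_zero[OF I] by simp
  show "ideal (adjoin V I a) (mpoly_ring V)"
    unfolding ideal_iff
  proof (intro conjI ballI)
    show "adjoin V I a \<subseteq> Pol V" using a ideal_subset[OF I] by (auto simp: adjoin_def)
    show "0 \<in> adjoin V I a" using mem[of 0 0] ideal_zero[OF I] by simp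
  next
    fix x y assume "x \<in> adjoin V I a" "y \<in> adjoin V I a"
    then obtain p r q s where "x = p + r * a" "p \<in> I" "r \<in> Pol V" "y = q + s * a" "q \<in> I" "s \<in> Pol V"
      by (auto simp: adjoin_def)
    then show "x + y \<in> adjoin V I a"
      using mem[of "p + q" "r + s"] ideal_add[OF I] by (simp add: algebra_simps Pol_add)
  next
    fix t x :: "('a, 'b) mpolynomial" assume t: "t \<in> Pol V" and "x \<in> adjoin V I a"
    then obtain p r where "x = p + r * a" "p \<in> I" "r \<in> Pol V" by (auto simp: adjoin_def)
    moreover from this have "t * x = t * p + (t * r) * a" by (simp add: distrib_left mult.assoc)
    ultimately show "t * x \<in> adjoin V I a"
      using mem[of "t * p" "t * r"] ideal_mult[OF I] t by (metis Pol_mult)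
  qed
qed

text \<open>
  An ideal that is maximal among those that contain \<open>L\<close> and avoid \<open>M\<close> is prime: adjoining either
  factor of a product in it would meet \<open>M\<close>, and so would then the ideal itself.
\<close>

lemma ex_prime_avoiding:
  fixes L :: "('v, 'k::field) mpolynomial set"
  assumes V: "finite V" and L: "ideal L (mpoly_ring V)"
    and M: "1 \<in> M" "\<And>a b. a \<in> M \<Longrightarrow> b \<in> M \<Longrightarrow> a * b \<in> M" and disj: "L \<inter> M = {}"
  shows "\<exists>P. primeideal P (mpoly_ring V) \<and> L \<subseteq> P \<and> P \<inter> M = {}"
proof -
  let ?A = "{I. ideal I (mpoly_ring V) \<and> L \<subseteq> I \<and> I \<inter> M = {}}"
  have "L \<in> ?A" using L disj by blast
  then have "\<exists>P\<in>?A. \<forall>I\<in>?A. P \<subseteq> I \<longrightarrow> I = P"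
    by (intro ideals_maximal_element[OF V]) auto
  then obtain P where P: "P \<in> ?A" and max: "\<And>I. I \<in> ?A \<Longrightarrow> P \<subseteq> I \<Longrightarrow> I = P" by meson
  have id: "ideal P (mpoly_ring V)" and LP: "L \<subseteq> P" and PM: "P \<inter> M = {}" using P by auto
  have meet: "\<exists>p r. p \<in> P \<and> r \<in> Pol V \<and> p + r * a \<in> M" if "a \<in> Pol V" "a \<notin> P" for a
  proof -
    note adj = adjoin_props[OF id that(1)]
    have "adjoin V P a \<noteq> P" using adj(3) that(2) by auto
    then have "adjoin V P a \<notin> ?A" using max adj(2) by blast
    then have "adjoin V P a \<inter> M \<noteq> {}" using adj(1,2) LP by blast
    then show ?thesis by (auto simp: adjoin_def)
  qed
  have "a \<in> P \<or> b \<in> P" if ab: "a \<in> Pol V" "b \<in> Pol V" "a * b \<in> P" for a b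
  proof (rule ccontr)
    assume "\<not> ?thesis"
    then obtain p r q s where pr: "p \<in> P" "r \<in> Pol V" "p + r * a \<in> M" and qs: "q \<in> P" "s \<in> Pol V" "q + s * b \<in> M"
      using meet ab by meson
    have qP: "q \<in> Pol V" using qs(1) ideal_subset[OF id] by blast
    have "(p + r * a) * (q + s * b) = (q + s * b) * p + (r * a) * q + (r * s) * (a * b)"
      by (simp add: algebra_simps)
    also have "\<dots> \<in> P"
      using ideal_mult[OF id _ pr(1), of "q + s * b"] ideal_mult[OF id _ qs(1), of "r * a"]
        ideal_mult[OF id _ ab(3), of "r * s"] pr(2) qs(2) ab(1,2) qP
      by (intro ideal_add[OF id]) auto
    finally show False using M(2)[OF pr(3) qs(3)] PM by blast
  qed
  then show ?thesis using id LP PM M(1) by (intro exI[of _ P]) (auto simp: primeideal_iff)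
qed

text \<open>
  Fixing the exponents of the variables other than \<open>u\<close> singles out a nonzero polynomial in \<open>u\<close>,
  which has only finitely many roots.
\<close>

lemma ex_nonzero_specialization:
  fixes f :: "('v, 'k::field_char_0) mpolynomial"
  assumes "f \<noteq> 0"
  shows "\<exists>a. slice {u} (point (\<lambda>_. a)) f \<noteq> 0"
proof -
  obtain m0 where m0: "m0 \<in> keys f" using assms by (metis ex_in_conv keys_eq_empty)
  let ?n = "mres (- {u}) m0"
  let ?K = "{m \<in> keys f. mres (- {u}) m = ?n}"
  define p where "p = (\<Sum>m\<in>?K. monom (lookup f m) (lookup m u))"
  have uniq: "m = m0" if "m \<in> ?K" "lookup m u = lookup m0 u" for m
  proof -
    have "m = mres {u} m + mres (- {u}) m" by (simp add: mres_split)
    also have "\<dots> = mres {u} m0 + mres (- {u}) m0" using that by (simp add: mres_singleton)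
    finally show ?thesis by (simp add: mres_split)
  qed
  have "coeff p (lookup m0 u) = (\<Sum>m\<in>?K. if m = m0 then lookup f m0 else 0)"
    unfolding p_def coeff_sum by (rule sum.cong) (use uniq in auto)
  also have "\<dots> = lookup f m0" using m0 by simp
  finally have "p \<noteq> 0" using m0 by (auto simp: in_keys_iff)
  then have "finite {a. poly p a = 0}" by (rule poly_roots_finite)
  from ex_new_if_finite[OF infinite_UNIV_char_0 this] obtain a where a: "poly p a \<noteq> 0" by blast
  have "lookup (slice {u} (point (\<lambda>_. a)) f) ?n = (\<Sum>m\<in>keys f. if mres (- {u}) m = ?n then lookup f m * a ^ lookup m u else 0)"
    unfolding slice_def lookup_sum by (rule sum.cong) (auto simp: mres_singleton lookup_single when_def)
  also have "\<dots> = (\<Sum>m\<in>?K. lookup f m * a ^ lookup m u)"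
    by (simp add: sum.If_cases Int_def)
  also have "\<dots> = poly p a" by (simp add: p_def poly_sum poly_monom)
  finally show ?thesis using a by (intro exI[of _ a]) auto
qed

text \<open>
  The step from a prime to a larger one that loses only the independent variable \<open>u\<close>: add \<open>u - a\<close> to
  \<open>P\<close> for a constant \<open>a\<close>. The new prime has to avoid \<open>m h\<^sup>j\<close> for all nonzero \<open>m\<close> without \<open>u\<close>. If
  \<open>m h\<^sup>j\<close> were a multiple of \<open>u - a\<close> modulo \<open>P\<close>, so would be \<open>m e\<^sup>j\<close>, where \<open>e \<in> \<bbbk>[U]\<close> is a multiple of
  \<open>h\<close>; comparing the coordinates at the basis element \<open>1\<close>, \<open>D\<^sup>k m e\<^sup>j\<close> would be divisible by \<open>u - a\<close> in
  \<open>\<bbbk>[U]\<close>. This is impossible if \<open>a\<close> is chosen such that \<open>D e\<close> does not vanish at \<open>u = a\<close>.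

  The case \<open>h = 1\<close> yields long chains of primes, and the general case points outside the zeros of \<open>h\<close>.
\<close>

lemma ex_larger_prime:
  fixes P :: "('v, 'k::field_char_0) mpolynomial set"
  assumes V: "finite V" and prime: "primeideal P (mpoly_ring V)" and U0: "U0 \<subseteq> V" "indep_vars P U0"
    and u: "u \<in> U0" and h: "h \<in> Pol V" "h \<notin> P"
  shows "\<exists>Q. primeideal Q (mpoly_ring V) \<and> P \<subset> Q \<and> indep_vars Q (U0 - {u}) \<and> h \<notin> Q"
proof -
  note P = prime_ideal[OF prime]
  obtain U where U: "U0 \<subseteq> U" "U \<subseteq> V" "indep_vars P U" "\<And>x. x \<in> V - U \<Longrightarrow> \<not> indep_vars P (insert x U)"
    using ex_maximal_indep[OF V U0] by blast
  have fU: "finite U" using V U(2) finite_subset by blast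
  have uU: "u \<in> U" using u U(1) by blast
  have Pol_U: "f \<in> Pol V" if "f \<in> Pol U" for f :: "('v, 'k) mpolynomial" using that U(2) by (rule Pol_mono')
  from generic_basis[OF P U(2) V U(3,4)] obtain D B where D: "D \<in> Pol U" "D \<noteq> 0"
    and B: "finite B" "1 \<in> B" "indep_mod U P B"
    and DB: "\<And>f. f \<in> Pol V \<Longrightarrow> \<exists>k. D ^ k * f \<in> span_mod U P B"
    by (metis (no_types, lifting))
  obtain h' e where e: "h' \<in> Pol V" "e \<in> Pol U" "e \<noteq> 0" "h * h' - e \<in> P"
    using inverse_mod_prime[OF V prime U(2,3,4) h] by blast
  have "D * e \<noteq> 0" using Pol_no_zero_divisors[OF fU D(1) e(2)] D(2) e(3) by blast
  then obtain a where a: "slice {u} (point (\<lambda>_. a)) (D * e) \<noteq> 0"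
    using ex_nonzero_specialization[of "D * e" u] by blast
  define ev where "ev = slice {u} (point (\<lambda>_. a) :: 'v monomial \<Rightarrow> 'k)"
  have evD: "ev D \<noteq> 0" and eve: "ev e \<noteq> 0" using a by (auto simp: ev_def slice_mult)
  have ev_mult: "ev (x * y) = ev x * ev y" and ev_power: "ev (x ^ n) = ev x ^ n" for x y n
    by (simp_all add: ev_def slice_mult slice_power)
  have ev_in: "ev f \<in> Pol U" if "f \<in> Pol U" for f
    unfolding ev_def using slice_in_Pol[OF that] by (rule Pol_mono') auto
  let ?l = "mvar u - cst a :: ('v, 'k) mpolynomial"
  have lU: "?l \<in> Pol U" using uU by auto
  have ev_l: "ev ?l = 0"
    unfolding ev_def mvar_def cst_def using mres_none[of 0 "{u}"] mres_none[of "single u (1::nat)" "- {u}"]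
    by (simp add: mres_singleton point_def)
  \<comment> \<open>the larger prime has to avoid these elements\<close>
  define M where "M = {m * h ^ j |m j. m \<in> Pol (U - {u}) \<and> m \<noteq> 0}"
  have "adjoin V P ?l \<inter> M = {}"
  proof (rule ccontr)
    assume "\<not> ?thesis"
    then obtain x where x: "x \<in> adjoin V P ?l" "x \<in> M" by blast
    obtain p r where p': "p \<in> P" "r \<in> Pol V" "x = p + r * ?l" using x(1) unfolding adjoin_def by blast
    obtain m j where m: "m \<in> Pol (U - {u})" "m \<noteq> 0" and x_eq: "x = m * h ^ j"
      using x(2) unfolding M_def by blast
    have p: "p \<in> P" "r \<in> Pol V" "p + r * ?l = m * h ^ j" using p' x_eq by simp_all
    have mU: "m \<in> Pol U" using m(1) by (rule Pol_mono') auto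
    have ev_m: "ev m = m" unfolding ev_def by (rule slice_fixes[OF _ m(1)]) auto
    let ?r = "r * h' ^ j"
    have "(h * h') ^ j - e ^ j \<in> P" by (rule ideal_power_diff[OF P _ _ e(4)]) (use h e Pol_U in auto)
    then have "m * ((h * h') ^ j - e ^ j) \<in> P" by (rule ideal_mult[OF P Pol_U[OF mU]])
    moreover have "h' ^ j * p \<in> P" using p(1) e(1) by (intro ideal_mult[OF P]) auto
    ultimately have "h' ^ j * p - m * ((h * h') ^ j - e ^ j) \<in> P" by (intro ideal_diff[OF P])
    moreover have "h' ^ j * p - m * ((h * h') ^ j - e ^ j) = h' ^ j * (p + r * ?l - m * h ^ j) + m * e ^ j - ?l * ?r"
      by (simp add: algebra_simps power_mult_distrib)
    ultimately have 1: "m * e ^ j - ?l * ?r \<in> P" using p(3) by simp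
    have "?r \<in> Pol V" using p(2) e(1) by auto
    then obtain k where "D ^ k * ?r \<in> span_mod U P B" using DB by blast
    then obtain \<alpha> where \<alpha>: "\<And>b. \<alpha> b \<in> Pol U" "D ^ k * ?r - (\<Sum>b\<in>B. \<alpha> b * b) \<in> P"
      by (auto simp: span_mod_def)
    have "D ^ k * (m * e ^ j - ?l * ?r) + ?l * (D ^ k * ?r - (\<Sum>b\<in>B. \<alpha> b * b)) \<in> P"
      using 1 \<alpha>(2) D(1) lU Pol_U by (intro ideal_add[OF P] ideal_mult[OF P]) auto
    then have 2: "D ^ k * m * e ^ j - (\<Sum>b\<in>B. ?l * \<alpha> b * b) \<in> P"
      by (simp add: right_diff_distrib sum_distrib_left mult_ac)
    \<comment> \<open>the coordinates of D ^ k * m * e ^ j minus (u - a) times those of D ^ k * r\<close>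
    let ?\<beta> = "\<lambda>b. (if b = 1 then D ^ k * m * e ^ j else 0) - ?l * \<alpha> b"
    have "(\<Sum>b\<in>B. (if b = 1 then D ^ k * m * e ^ j else 0) * b) = (\<Sum>b\<in>B. if b = 1 then D ^ k * m * e ^ j else 0)"
      by (rule sum.cong) auto
    then have "(\<Sum>b\<in>B. ?\<beta> b * b) = D ^ k * m * e ^ j - (\<Sum>b\<in>B. ?l * \<alpha> b * b)"
      using B(1,2) by (simp add: left_diff_distrib sum_subtractf)
    then have "(\<Sum>b\<in>B. ?\<beta> b * b) \<in> P" using 2 by simp
    moreover have "?\<beta> b \<in> Pol U" for b
      using D(1) mU e(2) lU \<alpha>(1) by auto
    ultimately have "?\<beta> 1 = 0"
      using B(2) by (intro indep_modD[OF B(3), where \<alpha> = ?\<beta>])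
    then have "D ^ k * m * e ^ j = ?l * \<alpha> 1" by simp
    then have "ev (D ^ k * m * e ^ j) = ev (?l * \<alpha> 1)" by (rule arg_cong)
    then have "ev D ^ k * m * ev e ^ j = 0"
      by (simp only: ev_mult ev_power ev_l ev_m mult_zero_left)
    moreover have "ev D ^ k * m \<noteq> 0" "ev e ^ j \<noteq> 0"
      using Pol_no_zero_divisors[OF fU, of "ev D ^ k" m] Pol_power_nonzero[OF fU ev_in[OF D(1)] evD, of k]
        Pol_power_nonzero[OF fU ev_in[OF e(2)] eve, of j] mU m(2) ev_in[OF D(1)] by auto
    ultimately show False
      using Pol_no_zero_divisors[OF fU, of "ev D ^ k * m" "ev e ^ j"] ev_in D(1) e(2) mU by blast
  qed
  moreover have "1 \<in> M" unfolding M_def by (intro CollectI exI[of _ 1] exI[of _ 0]) auto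
  moreover have "x * y \<in> M" if xy: "x \<in> M" "y \<in> M" for x y
  proof -
    obtain m j n i where "x = m * h ^ j" "m \<in> Pol (U - {u})" "m \<noteq> 0" "y = n * h ^ i" "n \<in> Pol (U - {u})" "n \<noteq> 0"
      using xy by (auto simp: M_def)
    then have "x * y = (m * n) * h ^ (j + i)" "m * n \<in> Pol (U - {u})" "m * n \<noteq> 0"
      using Pol_no_zero_divisors[of "U - {u}" m n] fU by (auto simp: power_add mult_ac)
    then show ?thesis unfolding M_def by blast
  qed
  ultimately obtain Q where Q: "primeideal Q (mpoly_ring V)" "adjoin V P ?l \<subseteq> Q" "Q \<inter> M = {}"
    using ex_prime_avoiding[OF V ideal_adjoin[OF P Pol_U[OF lU]], of M] by blast
  note adj = adjoin_props[OF P Pol_U[OF lU]]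
  have "?l \<notin> P"
  proof
    assume "?l \<in> P"
    then have "?l = 0" using indep_varsD[OF U(3) lU] by blast
    moreover have "lookup ?l (single u 1) = 1"
      by (auto simp: mvar_def cst_def lookup_minus lookup_single when_def poly_mapping_eq_iff fun_eq_iff)
    ultimately show False by simp
  qed
  then have "P \<subset> Q" using adj(2,3) Q(2) by blast
  moreover have "indep_vars Q (U - {u})"
    unfolding indep_vars_def
  proof
    fix m assume m: "m \<in> Pol (U - {u}) \<inter> Q"
    have "m \<in> M" if "m \<noteq> 0" unfolding M_def using m that by (intro CollectI exI[of _ m] exI[of _ 0]) auto
    then show "m \<in> {0}" using m Q(3) by blast
  qed
  then have "indep_vars Q (U0 - {u})" by (rule indep_vars_subset) (use U(1) in auto)
  moreover have "h \<in> M" unfolding M_def by (intro CollectI exI[of _ 1] exI[of _ 1]) auto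
  then have "h \<notin> Q" using Q(3) by blast
  ultimately show ?thesis using Q(1) by blast
qed

section \<open>Krull dimension\<close>

lemma prime_chain_bound:
  assumes V: "finite V" and "\<forall>i\<le>n. primeideal (C i) (mpoly_ring V)" "\<forall>i<n. C i \<subset> C (Suc i)"
  shows "n \<le> vdim V (C 0 :: ('v, 'k::field) mpolynomial set)"
proof -
  have "i \<le> n \<Longrightarrow> vdim V (C i) + i \<le> vdim V (C 0)" for i
  proof (induct i)
    case (Suc i)
    then have "vdim V (C (Suc i)) < vdim V (C i)" using assms by (intro vdim_strict) auto
    then show ?case using Suc by simp
  qed simp
  from this[of n] show ?thesis by simp
qed

text \<open>
  Iterating \<open>ex_larger_prime\<close>, the independent variables are given up one by one.
\<close>

lemma prime_chain_exists:
  fixes P :: "('v, 'k::field_char_0) mpolynomial set"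
  assumes V: "finite V"
  shows "primeideal P (mpoly_ring V) \<Longrightarrow> U \<subseteq> V \<Longrightarrow> indep_vars P U \<Longrightarrow>
    \<exists>C. C 0 = P \<and> (\<forall>i\<le>card U. primeideal (C i) (mpoly_ring V)) \<and> (\<forall>i<card U. C i \<subset> C (Suc i))"
proof (induct "card U" arbitrary: U P)
  case 0
  then show ?case by (intro exI[of _ "\<lambda>_. P"]) auto
next
  case (Suc n)
  then obtain u where u: "u \<in> U" by (metis card_eq_SucD insertI1)
  have fU: "finite U" using V Suc.prems finite_subset by blast
  have "(1 :: ('v, 'k) mpolynomial) \<in> Pol V" by simp
  from ex_larger_prime[OF V Suc.prems u this prime_one[OF Suc.prems(1)]]
  obtain Q where Q: "primeideal Q (mpoly_ring V)" "P \<subset> Q" "indep_vars Q (U - {u})" by blast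
  have n: "n = card (U - {u})" using Suc.hyps(2) u fU by simp
  obtain C where C: "C 0 = Q" "\<forall>i\<le>n. primeideal (C i) (mpoly_ring V)" "\<forall>i<n. C i \<subset> C (Suc i)"
    using Suc.hyps(1)[OF n Q(1) _ Q(3)] Suc.prems(2) n by auto
  \<comment> \<open>the chain above Q, shifted by one and started with P\<close>
  let ?C = "\<lambda>i. case i of 0 \<Rightarrow> P | Suc i \<Rightarrow> C i"
  show ?case
    unfolding Suc.hyps(2)[symmetric]
    by (rule exI[of _ ?C]) (use C Q Suc.prems in \<open>auto split: nat.split simp: less_Suc_eq_le\<close>)
qed

lemma Quot_facts:
  fixes I :: "('v, 'k::field) mpolynomial set"
  assumes I: "ideal I (mpoly_ring V)"
  shows coset_eq_iff: "r \<in> Pol V \<Longrightarrow> s \<in> Pol V \<Longrightarrow> I +>\<^bsub>mpoly_ring V\<^esub> r = I +>\<^bsub>mpoly_ring V\<^esub> s \<longleftrightarrow> r - s \<in> I"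
    and coset_zero_iff: "r \<in> Pol V \<Longrightarrow> I +>\<^bsub>mpoly_ring V\<^esub> r = \<zero>\<^bsub>mpoly_ring V Quot I\<^esub> \<longleftrightarrow> r \<in> I"
    and Quot_carrier: "carrier (mpoly_ring V Quot I) = (\<lambda>r. I +>\<^bsub>mpoly_ring V\<^esub> r) ` Pol V"
    and Quot_mult: "r \<in> Pol V \<Longrightarrow> s \<in> Pol V \<Longrightarrow>
      (I +>\<^bsub>mpoly_ring V\<^esub> r) \<otimes>\<^bsub>mpoly_ring V Quot I\<^esub> (I +>\<^bsub>mpoly_ring V\<^esub> s) = I +>\<^bsub>mpoly_ring V\<^esub> (r * s)"
proof -
  have co: "I +>\<^bsub>mpoly_ring V\<^esub> r = (\<lambda>i. i + r) ` I" for r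
    by (auto simp: a_r_coset_def')
  have eq: "I +>\<^bsub>mpoly_ring V\<^esub> r = I +>\<^bsub>mpoly_ring V\<^esub> s \<longleftrightarrow> r - s \<in> I" for r s
  proof
    assume *: "I +>\<^bsub>mpoly_ring V\<^esub> r = I +>\<^bsub>mpoly_ring V\<^esub> s"
    have "0 + r \<in> (\<lambda>i. i + r) ` I" using ideal_zero[OF I] by (rule imageI)
    then have "r \<in> (\<lambda>i. i + s) ` I" using * by (simp add: co)
    then show "r - s \<in> I" by auto
  next
    assume *: "r - s \<in> I"
    have "i + r \<in> (\<lambda>i. i + s) ` I" if "i \<in> I" for i
      by (rule image_eqI[of _ _ "i + (r - s)"]) (use ideal_add[OF I that *] in auto)
    moreover have "i + s \<in> (\<lambda>i. i + r) ` I" if "i \<in> I" for i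
      by (rule image_eqI[of _ _ "i - (r - s)"]) (use ideal_diff[OF I that *] in auto)
    ultimately show "I +>\<^bsub>mpoly_ring V\<^esub> r = I +>\<^bsub>mpoly_ring V\<^esub> s" unfolding co by blast
  qed
  then show "I +>\<^bsub>mpoly_ring V\<^esub> r = I +>\<^bsub>mpoly_ring V\<^esub> s \<longleftrightarrow> r - s \<in> I" for r s .
  have "\<zero>\<^bsub>mpoly_ring V Quot I\<^esub> = I +>\<^bsub>mpoly_ring V\<^esub> 0" by (simp add: FactRing_def co)
  then show "I +>\<^bsub>mpoly_ring V\<^esub> r = \<zero>\<^bsub>mpoly_ring V Quot I\<^esub> \<longleftrightarrow> r \<in> I" for r
    using eq[of r 0] by simp
  show "carrier (mpoly_ring V Quot I) = (\<lambda>r. I +>\<^bsub>mpoly_ring V\<^esub> r) ` Pol V"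
    by (auto simp: FactRing_def A_RCOSETS_def')
  show "(I +>\<^bsub>mpoly_ring V\<^esub> r) \<otimes>\<^bsub>mpoly_ring V Quot I\<^esub> (I +>\<^bsub>mpoly_ring V\<^esub> s) = I +>\<^bsub>mpoly_ring V\<^esub> (r * s)"
    if "r \<in> Pol V" "s \<in> Pol V" for r s
    using ideal.rcoset_mult_add[OF I that] by (simp add: FactRing_def)
qed

lemma prime_Quot_preimage:
  assumes I: "ideal I (mpoly_ring V)" and P: "primeideal P (mpoly_ring V Quot I)"
  shows "primeideal {r \<in> Pol V. I +>\<^bsub>mpoly_ring V\<^esub> r \<in> P} (mpoly_ring V)"
  by (rule ring_hom_ring.primeideal_vimage[OF ideal.rcos_ring_hom_ring[OF I] mpoly_cring P])

lemma prime_Quot_image: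
  fixes I :: "('v, 'k::field) mpolynomial set"
  assumes I: "ideal I (mpoly_ring V)" and P: "primeideal P (mpoly_ring V)" and IP: "I \<subseteq> P"
  shows "primeideal ((\<lambda>r. I +>\<^bsub>mpoly_ring V\<^esub> r) ` P) (mpoly_ring V Quot I)"
    and "r \<in> Pol V \<Longrightarrow> I +>\<^bsub>mpoly_ring V\<^esub> r \<in> (\<lambda>r. I +>\<^bsub>mpoly_ring V\<^esub> r) ` P \<longleftrightarrow> r \<in> P"
proof -
  note Pi = prime_ideal[OF P]
  let ?c = "\<lambda>r. I +>\<^bsub>mpoly_ring V\<^esub> r"
  have mem: "?c r \<in> ?c ` P \<longleftrightarrow> r \<in> P" if r: "r \<in> Pol V" for r
  proof
    assume "?c r \<in> ?c ` P"
    then obtain p where p: "p \<in> P" "?c r = ?c p" by auto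
    then have "r - p \<in> P" using coset_eq_iff[OF I r, of p] ideal_subset[OF Pi] IP by blast
    then show "r \<in> P" using ideal_diff_iff[OF Pi] p by blast
  qed simp
  then show "r \<in> Pol V \<Longrightarrow> ?c r \<in> ?c ` P \<longleftrightarrow> r \<in> P" for r .
  show "primeideal (?c ` P) (mpoly_ring V Quot I)"
  proof (rule primeidealI)
    show "ideal (?c ` P) (mpoly_ring V Quot I)"
      by (rule ring.ring_ideal_imp_quot_ideal[OF mpoly_ring_ring I Pi])
    show "cring (mpoly_ring V Quot I)" by (rule ideal.quotient_is_cring[OF I mpoly_cring])
    have "?c 1 \<notin> ?c ` P" using mem[of 1] prime_one[OF P] by simp
    moreover have "?c 1 \<in> carrier (mpoly_ring V Quot I)" by (simp add: Quot_carrier[OF I])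
    ultimately show "carrier (mpoly_ring V Quot I) \<noteq> ?c ` P" by blast
  next
    fix a b assume ab: "a \<in> carrier (mpoly_ring V Quot I)" "b \<in> carrier (mpoly_ring V Quot I)"
      "a \<otimes>\<^bsub>mpoly_ring V Quot I\<^esub> b \<in> ?c ` P"
    obtain r s where rs: "a = ?c r" "r \<in> Pol V" "b = ?c s" "s \<in> Pol V"
      using ab(1,2) unfolding Quot_carrier[OF I] by blast
    then have "?c (r * s) \<in> ?c ` P" using ab(3) Quot_mult[OF I rs(2,4)] by simp
    then have "r * s \<in> P" using mem[OF Pol_mult[OF rs(2,4)]] by simp
    then show "a \<in> ?c ` P \<or> b \<in> ?c ` P" using prime_mult[OF P _ rs(2,4)] rs by auto
  qed
qed

lemma ex_prime_indep:
  fixes I :: "('v, 'k::field) mpolynomial set"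
  assumes V: "finite V" and I: "ideal I (mpoly_ring V)" and U: "U \<subseteq> V" "indep_vars I U"
  shows "\<exists>P. primeideal P (mpoly_ring V) \<and> I \<subseteq> P \<and> indep_vars P U"
proof -
  let ?M = "Pol U - {0} :: ('v, 'k) mpolynomial set"
  have fU: "finite U" using V U finite_subset by blast
  have "\<exists>P. primeideal P (mpoly_ring V) \<and> I \<subseteq> P \<and> P \<inter> ?M = {}"
    by (rule ex_prime_avoiding[OF V I])
       (use U(2) Pol_no_zero_divisors[OF fU] in \<open>auto simp: indep_vars_def\<close>)
  then show ?thesis by (auto simp: indep_vars_def)
qed

text \<open>
  Chains of primes above \<open>I\<close> have length at most \<open>vdim V I\<close> because the number of independent
  variables drops in each step. Conversely, some prime above \<open>I\<close> avoids \<open>\<bbbk>[U] - {0}\<close> for a largest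
  independent set \<open>U\<close>, and it starts a chain of length \<open>card U\<close>.
\<close>

lemma krull_dim_Quot:
  fixes I :: "('v, 'k::field_char_0) mpolynomial set"
  assumes V: "finite V" and I: "ideal I (mpoly_ring V)" and I1: "1 \<notin> I"
  shows "krull_dim (mpoly_ring V Quot I) = ereal (real (vdim V I))"
proof -
  let ?R = "mpoly_ring V :: ('v, 'k) mpolynomial ring" and ?c = "\<lambda>r. I +>\<^bsub>mpoly_ring V\<^esub> r"
  let ?N = "{n. \<exists>C. (\<forall>i\<le>n. primeideal (C i) (?R Quot I)) \<and> (\<forall>i<n. C i \<subset> C (Suc i))}"
  have upper: "n \<le> vdim V I" if n: "n \<in> ?N" for n
  proof -
    obtain C where C: "\<forall>i\<le>n. primeideal (C i) (?R Quot I)" "\<forall>i<n. C i \<subset> C (Suc i)" using n by blast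
    let ?D = "\<lambda>i. {r \<in> Pol V. ?c r \<in> C i}"
    have D: "primeideal (?D i) ?R" if "i \<le> n" for i using prime_Quot_preimage[OF I] C(1) that by blast
    have strict: "?D i \<subset> ?D (Suc i)" if "i < n" for i
    proof -
      have "ideal (C (Suc i)) (?R Quot I)" using C(1) that by (simp add: primeideal_def)
      then have sub: "C (Suc i) \<subseteq> ?c ` Pol V"
        using additive_subgroup.a_subset[OF ideal.axioms(1)] Quot_carrier[OF I] by blast
      have "C i \<subset> C (Suc i)" using C(2) that by blast
      then obtain x where x: "x \<in> C (Suc i)" "x \<notin> C i" by blast
      then obtain r where "r \<in> Pol V" "x = ?c r" using sub by blast
      then have "r \<in> ?D (Suc i)" "r \<notin> ?D i" using x by auto
      moreover have "?D i \<subseteq> ?D (Suc i)" using C(2) that by blast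
      ultimately show ?thesis by blast
    qed
    have "n \<le> vdim V (?D 0)" by (rule prime_chain_bound[OF V, of n ?D]) (use D strict in auto)
    also have "\<dots> \<le> vdim V I"
    proof (rule vdim_antimono[OF V])
      show "ideal (?D 0) ?R" "1 \<notin> ?D 0" using D[of 0] by (auto simp: primeideal_iff)
      have "ideal (C 0) (?R Quot I)" using C(1) by (simp add: primeideal_def)
      then have z: "\<zero>\<^bsub>?R Quot I\<^esub> \<in> C 0" by (rule additive_subgroup.zero_closed[OF ideal.axioms(1)])
      show "I \<subseteq> ?D 0"
      proof
        fix r assume r: "r \<in> I"
        then have rV: "r \<in> Pol V" using ideal_subset[OF I] by blast
        have "?c r = \<zero>\<^bsub>?R Quot I\<^esub>" using coset_zero_iff[OF I rV] r by simp
        then show "r \<in> ?D 0" using rV z by simp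
      qed
    qed
    finally show ?thesis .
  qed
  have lower: "vdim V I \<in> ?N"
  proof -
    obtain U where U: "U \<subseteq> V" "indep_vars I U" "card U = vdim V I" using vdim_attained[OF V I I1] .
    obtain P where P: "primeideal P ?R" "I \<subseteq> P" "indep_vars P U" using ex_prime_indep[OF V I U(1,2)] by blast
    obtain C where C: "C 0 = P" "\<forall>i\<le>card U. primeideal (C i) ?R" "\<forall>i<card U. C i \<subset> C (Suc i)"
      using prime_chain_exists[OF V P(1) U(1) P(3)] by blast
    have IC: "i \<le> card U \<Longrightarrow> I \<subseteq> C i" for i
    proof (induct i)
      case (Suc i)
      then have "I \<subseteq> C i" "C i \<subset> C (Suc i)" using C(3) by auto
      then show ?case by blast
    qed (use C P in simp)
    have "(\<lambda>r. ?c r) ` C i \<subset> ?c ` C (Suc i)" if "i < card U" for i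
    proof -
      have "C i \<subset> C (Suc i)" using C(3) that by blast
      then obtain r where r: "r \<in> C (Suc i)" "r \<notin> C i" by blast
      have pr: "primeideal (C i) ?R" "primeideal (C (Suc i)) ?R" using C(2) that by auto
      have "r \<in> Pol V" using r(1) ideal_subset[OF prime_ideal[OF pr(2)]] by blast
      then have "?c r \<notin> ?c ` C i" using prime_Quot_image(2)[OF I pr(1) IC, of r] r(2) that by simp
      then show ?thesis using r(1) C(3) that by blast
    qed
    moreover have "primeideal (?c ` C i) (?R Quot I)" if "i \<le> card U" for i
      using prime_Quot_image(1)[OF I _ IC[OF that]] C(2) that by blast
    ultimately show ?thesis
      unfolding U(3)[symmetric] by (intro CollectI exI[of _ "\<lambda>i. ?c ` C i"]) blast
  qed
  show ?thesis
    unfolding krull_dim_def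
  proof (rule antisym)
    show "(SUP n\<in>?N. ereal (real n)) \<le> ereal (real (vdim V I))"
      by (rule SUP_least) (use upper in auto)
    show "ereal (real (vdim V I)) \<le> (SUP n\<in>?N. ereal (real n))"
      by (rule SUP_upper[OF lower])
  qed
qed

section \<open>Points of a prime ideal\<close>

lemma monomial_prod:
  "single m c = cst c * (\<Prod>v\<in>keys m. mvar v ^ lookup m v :: ('v, 'k::field) mpolynomial)"
proof -
  have "finite A \<Longrightarrow> (\<Prod>v\<in>A. mvar v ^ lookup m v :: ('v, 'k) mpolynomial) = single (\<Sum>v\<in>A. single v (lookup m v)) 1" for A
    by (induct A rule: finite_induct) (auto simp: mvar_power mult_single)
  moreover have "(\<Sum>v\<in>keys m. single v (lookup m v)) = m"
    by (rule poly_mapping_eqI) (simp add: lookup_sum lookup_single when_def in_keys_iff)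
  ultimately show ?thesis by (simp add: cst_def mult_single)
qed

lemma poly_cst_add:
  "poly (map_poly cst (p + q)) (x :: ('v, 'k::field) mpolynomial) = poly (map_poly cst p) x + poly (map_poly cst q) x"
  by (induct p q rule: poly_induct2) (auto simp: map_poly_pCons algebra_simps)

lemma poly_cst_sum:
  "poly (map_poly cst (sum p A)) (x :: ('v, 'k::field) mpolynomial) = (\<Sum>i\<in>A. poly (map_poly cst (p i)) x)"
  by (induct A rule: infinite_finite_induct) (auto simp: poly_cst_add)

text \<open>
  The polynomial splits into linear factors, one of which lies in the prime.
\<close>

lemma linear_factor_in_prime:
  fixes P :: "('v, 'k::alg_closed_field) mpolynomial set"
  assumes P: "primeideal P (mpoly_ring V)" and v: "v \<in> V"
  shows "p \<noteq> 0 \<Longrightarrow> poly (map_poly cst p) (mvar v) \<in> P \<Longrightarrow> \<exists>a. mvar v - cst a \<in> P"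
proof (induct "degree p" arbitrary: p)
  case 0
  then obtain c where "p = [:c:]" by (metis degree_eq_zeroE)
  then show ?case using 0 prime_cst[OF P, of c] by (simp add: map_poly_pCons)
next
  case (Suc n)
  let ?\<Phi> = "\<lambda>p. poly (map_poly cst p) (mvar v) :: ('v, 'k) mpolynomial"
  have pCons: "?\<Phi> (pCons a q) = cst a + mvar v * ?\<Phi> q" for a q by (simp add: map_poly_pCons)
  have smult: "?\<Phi> (smult a q) = cst a * ?\<Phi> q" for a q by (simp add: map_poly_smult)
  note add = poly_cst_add
  have in_V: "?\<Phi> q \<in> Pol V" for q
    by (induct q) (use v in \<open>auto simp: pCons intro!: Pol_add Pol_mult\<close>)
  obtain a where "poly p a = 0" using alg_closed_imp_poly_has_root[of p] Suc.hyps(2) by auto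
  then obtain q where q: "p = [:- a, 1:] * q" by (auto simp: poly_eq_0_iff_dvd)
  have "q \<noteq> 0" using q Suc.prems by auto
  then have deg: "n = degree q" using Suc.hyps(2) unfolding q by (subst (asm) degree_mult_eq) auto
  have "p = smult (- a) q + pCons 0 q" by (simp add: q)
  then have "?\<Phi> p = (mvar v - cst a) * ?\<Phi> q"
    by (simp only: add smult pCons) (simp add: algebra_simps)
  then have "(mvar v - cst a) * ?\<Phi> q \<in> P" using Suc.prems(2) by simp
  then have "mvar v - cst a \<in> P \<or> ?\<Phi> q \<in> P"
    by (rule prime_mult[OF P]) (use v in_V in auto)
  then show ?case using Suc.hyps(1)[OF deg \<open>q \<noteq> 0\<close>] by blast
qed

lemma dependent_variable_constant:
  fixes P :: "('v, 'k::alg_closed_field) mpolynomial set"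
  assumes P: "primeideal P (mpoly_ring V)" and v: "v \<in> V" and dep: "\<not> indep_vars P {v}"
  shows "\<exists>a. mvar v - cst a \<in> P"
proof -
  obtain f where f: "f \<in> Pol {v}" "f \<in> P" "f \<noteq> 0" using dep by (auto simp: indep_vars_def)
  obtain d where d: "y_le v d f" using y_le_ex[of v f] by auto
  have "\<exists>c. y_coeff v f i = cst c" for i
    using y_coeff_in_Pol[OF f(1), of v i] by (intro Pol_empty) simp
  then obtain c where c: "\<And>i. y_coeff v f i = cst (c i)" by metis
  define p where "p = (\<Sum>i\<le>d. monom (c i) i)"
  have "poly (map_poly cst p) (mvar v) = (\<Sum>i\<le>d. cst (c i) * mvar v ^ i :: ('v, 'k) mpolynomial)"
    by (simp add: p_def poly_cst_sum map_poly_monom poly_monom)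
  also have "\<dots> = f" by (subst y_expand[OF d]) (simp add: c)
  finally have "poly (map_poly cst p) (mvar v) = f" .
  moreover from this have "p \<noteq> 0" using f(3) by auto
  ultimately show ?thesis using linear_factor_in_prime[OF P v] f(2) by metis
qed

text \<open>
  As long as some variable is independent modulo \<open>P\<close>, enlarge the prime without catching \<open>h\<close>. In the
  end every variable is congruent to a constant, so \<open>P\<close> is the ideal of a point.
\<close>

lemma nullstellensatz:
  fixes P :: "('v, 'k::{alg_closed_field, field_char_0}) mpolynomial set"
  assumes V: "finite V"
  shows "primeideal P (mpoly_ring V) \<Longrightarrow> h \<in> Pol V \<Longrightarrow> h \<notin> P \<Longrightarrow>
    \<exists>x. (\<forall>f\<in>P. slice V (point x) f = 0) \<and> slice V (point x) h \<noteq> 0"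
proof (induct "vdim V P" arbitrary: P rule: less_induct)
  case less
  note P = prime_ideal[OF less.prems(1)]
  show ?case
  proof (cases "\<exists>u\<in>V. indep_vars P {u}")
    case True
    then obtain u where "{u} \<subseteq> V" "indep_vars P {u}" by auto
    from ex_larger_prime[OF V less.prems(1) this insertI1 less.prems(2,3)]
    obtain Q where Q: "primeideal Q (mpoly_ring V)" "P \<subset> Q" "h \<notin> Q" by blast
    show ?thesis using less.hyps[OF vdim_strict[OF V less.prems(1) Q(1,2)] Q(1) less.prems(2) Q(3)] Q(2) by blast
  next
    case False
    then have "\<forall>v\<in>V. \<exists>a. mvar v - cst a \<in> P"
      using dependent_variable_constant[OF less.prems(1)] by blast
    then obtain x where x: "\<And>v. v \<in> V \<Longrightarrow> mvar v - cst (x v) \<in> P" by metis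
    define s where "s = slice V (point x)"
    have sm: "s (f * g) = s f * s g" for f g by (simp add: s_def slice_mult)
    have s1: "s 1 = 1" by (simp add: s_def)
    have sc: "s (cst a) = cst a" for a unfolding s_def using slice_fixes[of "point x" "cst a" "{}" V] by simp
    have sP: "s f \<in> Pol V" if "f \<in> Pol V" for f
      unfolding s_def using slice_in_Pol[OF that] by (rule Pol_mono') auto
    have mult: "f * g - s (f * g) \<in> P" if "f - s f \<in> P" "g - s g \<in> P" "f \<in> Pol V" "g \<in> Pol V" for f g
    proof -
      have "f * (g - s g) + s g * (f - s f) \<in> P"
        using that sP by (intro ideal_add[OF P] ideal_mult[OF P]) auto
      then show ?thesis by (simp add: sm algebra_simps)
    qed
    have var: "mvar v - s (mvar v) \<in> P" if "v \<in> V" for v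
    proof -
      have "s (mvar v) = cst (x v)"
        unfolding s_def mvar_def using that mres_none[of "single v (1::nat)" "- V"] mres_id[of "single v (1::nat)" V]
        by (simp add: cst_def)
      then show ?thesis using x[OF that] by simp
    qed
    have pow: "mvar v ^ n - s (mvar v ^ n) \<in> P" if "v \<in> V" for v n
    proof (induct n)
      case 0
      then show ?case using ideal_zero[OF P] by (simp add: s1)
    next
      case (Suc n)
      show ?case unfolding power_Suc by (rule mult[OF var[OF that] Suc]) (use that in auto)
    qed
    have pr: "finite A \<Longrightarrow> A \<subseteq> V \<Longrightarrow> (\<Prod>v\<in>A. mvar v ^ n v) - s (\<Prod>v\<in>A. mvar v ^ n v) \<in> P" for A and n :: "'v \<Rightarrow> nat"
    proof (induct A rule: finite_induct)
      case empty
      then show ?case using ideal_zero[OF P] by (simp add: s1)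
    next
      case (insert v A)
      have "mvar v ^ n v * (\<Prod>v\<in>A. mvar v ^ n v) - s (mvar v ^ n v * (\<Prod>v\<in>A. mvar v ^ n v)) \<in> P"
        by (rule mult[OF pow]) (use insert in auto)
      then show ?case using insert by simp
    qed
    have all: "f - s f \<in> P" if "f \<in> Pol V" for f
      using that
    proof (induct rule: Pol_induct)
      case zero
      then show ?case using ideal_zero[OF P] by (simp add: s_def)
    next
      case (single m c)
      have "cst c - s (cst c) \<in> P" using ideal_zero[OF P] by (simp add: sc)
      moreover have "(\<Prod>v\<in>keys m. mvar v ^ lookup m v :: ('v, 'k) mpolynomial) \<in> Pol V"
        using single by (intro Pol_prod Pol_power) auto
      ultimately show ?case
        unfolding monomial_prod[of m c] using pr[OF finite_keys single] by (intro mult) auto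
    next
      case (add f g)
      have "(f - s f) + (g - s g) \<in> P" using add ideal_add[OF P] by blast
      then show ?case by (simp add: s_def algebra_simps)
    qed
    have "s f = 0" if "f \<in> P" for f
    proof -
      have "f \<in> Pol V" using that ideal_subset[OF P] by blast
      then have "s f \<in> Pol {}" "f - s f \<in> P" using slice_in_Pol[of f V V "point x"] all by (auto simp: s_def)
      moreover from this have "s f \<in> P" using ideal_diff_iff[OF P] that by blast
      ultimately show ?thesis using Pol_empty[of "s f"] prime_cst[OF less.prems(1)] by auto
    qed
    moreover have "s h \<noteq> 0"
    proof
      assume "s h = 0"
      then show False using all[OF less.prems(2)] less.prems(3) by simp
    qed
    ultimately show ?thesis unfolding s_def by blast
  qed
qed

section \<open>Dimension of a sum\<close>

text \<open>
  If \<open>f \<in> \<bbbk>[U]\<close> lies in \<open>I + J\<close>, its slices along \<open>Y\<close> lie in \<open>I \<inter> \<bbbk>[U \<inter> X] = 0\<close>, so \<open>f\<close> lies in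
  \<open>0 + J\<close>. Then its slices along \<open>X\<close> lie in \<open>J \<inter> \<bbbk>[U \<inter> Y] = 0\<close>, and \<open>f = 0\<close>.
\<close>

lemma indep_vars_ideal_join:
  fixes I J :: "('v, 'k::field) mpolynomial set"
  assumes XY: "X \<inter> Y = {}" and I: "ideal I (mpoly_ring X)" and J: "ideal J (mpoly_ring Y)" and U: "U \<subseteq> X \<union> Y"
  shows "indep_vars (ideal_join X Y I J) U \<longleftrightarrow> indep_vars I (U \<inter> X) \<and> indep_vars J (U \<inter> Y)"
proof
  assume *: "indep_vars (ideal_join X Y I J) U"
  show "indep_vars I (U \<inter> X) \<and> indep_vars J (U \<inter> Y)"
    using indep_vars_antimono[OF indep_vars_subset[OF *, of "U \<inter> X"] ideal_join_superset(1)[OF XY I J]]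
      indep_vars_antimono[OF indep_vars_subset[OF *, of "U \<inter> Y"] ideal_join_superset(2)[OF XY I J]] by auto
next
  assume ind: "indep_vars I (U \<inter> X) \<and> indep_vars J (U \<inter> Y)"
  have YX: "Y \<inter> X = {}" using XY by auto
  have "f = 0" if f: "f \<in> Pol U" "f \<in> ideal_join X Y I J" for f
  proof -
    have fXY: "f \<in> Pol (X \<union> Y)" using f(1) U by (rule Pol_mono')
    have sX: "slice Y \<xi> f \<in> Pol (U \<inter> X)" for \<xi>
      using slice_in_Pol[OF f(1), of Y \<xi>] by (rule Pol_mono') (use U in auto)
    have sY: "slice X \<xi> f \<in> Pol (U \<inter> Y)" for \<xi>
      using slice_in_Pol[OF f(1), of X \<xi>] by (rule Pol_mono') (use U in auto)
    have "f \<in> ideal_join X Y {0} J"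
      by (rule ideal_joinI[OF XY ideal_singleton_zero J fXY])
         (use slice_ideal_join[OF XY I J f(2)] sX ind in \<open>auto dest: indep_varsD\<close>)
    then have f': "f \<in> ideal_join Y X J {0}" by (simp only: ideal_join_commute)
    have "slice X \<xi> f = 0" for \<xi>
      using slice_ideal_join[OF YX J ideal_singleton_zero f', of \<xi>] sY[of \<xi>] ind by (auto dest: indep_varsD)
    then have "f \<in> ideal_join Y X {0} {0}"
      using fXY by (intro ideal_joinI[OF YX ideal_singleton_zero ideal_singleton_zero]) (auto simp: Un_commute)
    moreover have "ideal_join Y X {0} {0} \<subseteq> {0 :: ('v, 'k) mpolynomial}" by (rule idl_minimal[OF ideal_singleton_zero]) auto
    ultimately show ?thesis by blast
  qed
  then show "indep_vars (ideal_join X Y I J) U" by (auto simp: indep_vars_def)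
qed

lemma vdim_ideal_join:
  fixes I J :: "('v, 'k::field) mpolynomial set"
  assumes fin: "finite X" "finite Y" and XY: "X \<inter> Y = {}"
    and I: "ideal I (mpoly_ring X)" "1 \<notin> I" and J: "ideal J (mpoly_ring Y)" "1 \<notin> J"
  shows "vdim (X \<union> Y) (ideal_join X Y I J) = vdim X I + vdim Y J"
proof (rule antisym)
  have fXY: "finite (X \<union> Y)" using fin by simp
  note iff = indep_vars_ideal_join[OF XY I(1) J(1)]
  obtain U where U: "U \<subseteq> X \<union> Y" "indep_vars (ideal_join X Y I J) U" "card U = vdim (X \<union> Y) (ideal_join X Y I J)"
    using vdim_attained[OF fXY ideal_ideal_join[OF XY I(1) J(1)] ideal_join_proper[OF XY I(1) J(1) I(2) J(2)]] .
  have "card U = card (U \<inter> X) + card (U \<inter> Y)"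
  proof -
    have "U = (U \<inter> X) \<union> (U \<inter> Y)" using U(1) by blast
    moreover have "card ((U \<inter> X) \<union> (U \<inter> Y)) = card (U \<inter> X) + card (U \<inter> Y)"
      by (rule card_Un_disjoint) (use fin XY in auto)
    ultimately show ?thesis by simp
  qed
  moreover have "card (U \<inter> X) \<le> vdim X I" "card (U \<inter> Y) \<le> vdim Y J"
    using iff[OF U(1)] U(2) by (auto intro!: card_le_vdim fin)
  ultimately show "vdim (X \<union> Y) (ideal_join X Y I J) \<le> vdim X I + vdim Y J" using U(3) by simp
  obtain A where A: "A \<subseteq> X" "indep_vars I A" "card A = vdim X I" using vdim_attained[OF fin(1) I] .
  obtain B where B: "B \<subseteq> Y" "indep_vars J B" "card B = vdim Y J" using vdim_attained[OF fin(2) J] .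
  have "(A \<union> B) \<inter> X = A" "(A \<union> B) \<inter> Y = B" using A(1) B(1) XY by auto
  then have "indep_vars (ideal_join X Y I J) (A \<union> B)" using iff[of "A \<union> B"] A B by auto
  then have "card (A \<union> B) \<le> vdim (X \<union> Y) (ideal_join X Y I J)"
    using A(1) B(1) by (intro card_le_vdim[OF fXY]) auto
  moreover have "card (A \<union> B) = card A + card B"
    by (rule card_Un_disjoint) (use A(1) B(1) XY fin finite_subset in auto)
  ultimately show "vdim X I + vdim Y J \<le> vdim (X \<union> Y) (ideal_join X Y I J)" using A(3) B(3) by simp
qed

section \<open>Associated primes of a sum\<close>

text \<open>
  If \<open>f\<close> and \<open>g\<close> do not lie in \<open>P + Q\<close>, they have slices \<open>a, b \<notin> P\<close>, and some point of \<open>P\<close> is no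
  zero of \<open>a b\<close>. Evaluating \<open>f g \<in> P + Q\<close> at this point gives an element of \<open>Q\<close>, hence one of the
  factors becomes a member of \<open>Q\<close>. Its slice, the value of \<open>a\<close> or \<open>b\<close>, is then zero.
\<close>

lemma prime_ideal_join:
  fixes P Q :: "('v, 'k::{alg_closed_field, field_char_0}) mpolynomial set"
  assumes X: "finite X" and XY: "X \<inter> Y = {}"
    and P: "primeideal P (mpoly_ring X)" and Q: "primeideal Q (mpoly_ring Y)"
  shows "primeideal (ideal_join X Y P Q) (mpoly_ring (X \<union> Y))"
proof -
  note Pi = prime_ideal[OF P] and Qi = prime_ideal[OF Q]
  have YX: "Y \<inter> X = {}" using XY by auto
  have "f \<in> ideal_join X Y P Q \<or> g \<in> ideal_join X Y P Q"
    if fg: "f \<in> Pol (X \<union> Y)" "g \<in> Pol (X \<union> Y)" "f * g \<in> ideal_join X Y P Q" for f g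
  proof (rule ccontr)
    assume "\<not> ?thesis"
    then obtain \<xi> \<psi> where \<xi>: "kills Y \<xi> Q" "slice Y \<xi> f \<notin> P" and \<psi>: "kills Y \<psi> Q" "slice Y \<psi> g \<notin> P"
      using ideal_joinI[OF XY Pi Qi] fg(1,2) by metis
    have in_X: "slice Y \<xi> f \<in> Pol X" "slice Y \<psi> g \<in> Pol X"
      using slice_Pol_left fg(1,2) by auto
    have "slice Y \<xi> f * slice Y \<psi> g \<notin> P" using prime_mult[OF P _ in_X] \<xi>(2) \<psi>(2) by blast
    from nullstellensatz[OF X P Pol_mult[OF in_X] this] obtain x where
      x: "\<forall>p\<in>P. slice X (point x) p = 0" "slice X (point x) (slice Y \<xi> f * slice Y \<psi> g) \<noteq> 0" by blast
    let ?E = "slice X (point x)"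
    have "f * g \<in> ideal_join Y X Q P" using fg(3) by (simp only: ideal_join_commute)
    then have "?E (f * g) \<in> Q" using x(1) by (rule slice_ideal_join[OF YX Qi Pi])
    then have "?E f * ?E g \<in> Q" by (simp add: slice_mult)
    moreover have "?E f \<in> Pol Y" "?E g \<in> Pol Y"
      using slice_Pol_left[of f Y X] slice_Pol_left[of g Y X] fg(1,2) by (auto simp: Un_commute)
    ultimately have "?E f \<in> Q \<or> ?E g \<in> Q" by (rule prime_mult[OF Q])
    then have "slice Y \<xi> (?E f) = 0 \<or> slice Y \<psi> (?E g) = 0" using \<xi>(1) \<psi>(1) by blast
    then have "?E (slice Y \<xi> f) = 0 \<or> ?E (slice Y \<psi> g) = 0" by (simp only: slice_commute[OF YX])
    then show False using x(2) by (auto simp: slice_mult)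
  qed
  then show ?thesis
    using ideal_ideal_join[OF XY Pi Qi] ideal_join_proper[OF XY Pi Qi prime_one[OF P] prime_one[OF Q]]
    by (simp add: primeideal_iff)
qed

definition colon :: "'v set \<Rightarrow> ('v, 'k::field) mpolynomial set \<Rightarrow> ('v, 'k) mpolynomial \<Rightarrow> ('v, 'k) mpolynomial set" where
  "colon V I t = {r \<in> Pol V. r * t \<in> I}"

lemma ideal_colon:
  assumes I: "ideal I (mpoly_ring V)" shows "ideal (colon V I t) (mpoly_ring V)"
  unfolding ideal_iff colon_def
  using ideal_add[OF I] ideal_mult[OF I] ideal_zero[OF I]
  by (auto simp: distrib_right mult.assoc)

lemma colon_superset:
  assumes I: "ideal I (mpoly_ring V)" and "t \<in> Pol V" shows "I \<subseteq> colon V I t"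
  using ideal_subset[OF I] ideal_mult'[OF I assms(2)] by (auto simp: colon_def)

lemma associated_primes_iff:
  assumes I: "ideal I (mpoly_ring V)"
  shows "P \<in> associated_primes (mpoly_ring V) I \<longleftrightarrow> primeideal P (mpoly_ring V) \<and> (\<exists>t\<in>Pol V. P = colon V I t)"
proof -
  have "{r \<in> Pol V. (I +>\<^bsub>mpoly_ring V\<^esub> r) \<otimes>\<^bsub>mpoly_ring V Quot I\<^esub> (I +>\<^bsub>mpoly_ring V\<^esub> t) = \<zero>\<^bsub>mpoly_ring V Quot I\<^esub>} = colon V I t"
    if "t \<in> Pol V" for t
    unfolding colon_def
    by (rule Collect_cong) (use coset_zero_iff[OF I Pol_mult[OF _ that]] in \<open>simp add: Quot_mult[OF I _ that] cong: conj_cong\<close>)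
  then show ?thesis unfolding associated_primes_def Quot_carrier[OF I] by auto
qed

lemma associated_prime_superset:
  assumes I: "ideal I (mpoly_ring V)" and P: "P \<in> associated_primes (mpoly_ring V) I"
  shows "I \<subseteq> P"
proof -
  obtain t where "t \<in> Pol V" "P = colon V I t" using P associated_primes_iff[OF I] by auto
  then show ?thesis using colon_superset[OF I] by auto
qed

text \<open>
  A maximal element among the annihilators of nonzero elements of \<open>\<bbbk>[V]/I\<close> is prime.
\<close>

lemma ex_associated_prime:
  fixes I :: "('v, 'k::field) mpolynomial set"
  assumes V: "finite V" and I: "ideal I (mpoly_ring V)" and I1: "1 \<notin> I"
  shows "\<exists>P. P \<in> associated_primes (mpoly_ring V) I"
proof -
  let ?A = "{colon V I t |t. t \<in> Pol V \<and> t \<notin> I}"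
  have ne: "?A \<noteq> {}" using I1 Pol_one by blast
  have "\<exists>P\<in>?A. \<forall>L\<in>?A. P \<subseteq> L \<longrightarrow> L = P"
    by (rule ideals_maximal_element[OF V ne]) (use ideal_colon[OF I] in blast)
  then obtain P where "P \<in> ?A" and maxP: "\<And>L. L \<in> ?A \<Longrightarrow> P \<subseteq> L \<Longrightarrow> L = P" by meson
  then obtain t where t: "t \<in> Pol V" "t \<notin> I" and P: "P = colon V I t" by blast
  have max: "colon V I s = colon V I t" if "s \<in> Pol V" "s \<notin> I" "colon V I t \<subseteq> colon V I s" for s
    by (rule maxP[unfolded P]) (use that in auto)
  have "a \<in> colon V I t \<or> b \<in> colon V I t" if ab: "a \<in> Pol V" "b \<in> Pol V" "a * b \<in> colon V I t" for a b
  proof (rule ccontr)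
    assume "\<not> ?thesis"
    then have na: "a \<notin> colon V I t" and "b * t \<notin> I" using ab by (auto simp: colon_def)
    moreover have "colon V I t \<subseteq> colon V I (b * t)"
    proof
      fix x assume "x \<in> colon V I t"
      then have "x \<in> Pol V" "b * (x * t) \<in> I" using ideal_mult[OF I ab(2)] by (auto simp: colon_def)
      then show "x \<in> colon V I (b * t)" by (simp add: colon_def mult.left_commute)
    qed
    moreover have "a \<in> colon V I (b * t)" using ab by (auto simp: colon_def mult.assoc)
    ultimately show False using max[of "b * t"] ab(2) t(1) by blast
  qed
  then have "primeideal (colon V I t) (mpoly_ring V)"
    using ideal_colon[OF I, of t] t(2) by (auto simp: primeideal_iff colon_def)
  then show ?thesis using associated_primes_iff[OF I] t(1) by blast
qed

lemma colon_ideal_join: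
  fixes I J :: "('v, 'k::field) mpolynomial set"
  assumes XY: "X \<inter> Y = {}" and I: "ideal I (mpoly_ring X)" and J: "ideal J (mpoly_ring Y)" and t: "t \<in> Pol X"
  shows "colon (X \<union> Y) (ideal_join X Y I J) t = ideal_join X Y (colon X I t) J"
proof
  note join = ideal_ideal_join[OF XY I J] and sup = ideal_join_superset[OF XY I J]
  have tXY: "t \<in> Pol (X \<union> Y)" using t by (rule Pol_mono') auto
  show "ideal_join X Y (colon X I t) J \<subseteq> colon (X \<union> Y) (ideal_join X Y I J) t"
  proof (rule idl_minimal[OF ideal_colon[OF join]], rule Un_least)
    show "colon X I t \<subseteq> colon (X \<union> Y) (ideal_join X Y I J) t"
      using sup(1) Pol_mono[of X "X \<union> Y"] by (auto simp: colon_def)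
    show "J \<subseteq> colon (X \<union> Y) (ideal_join X Y I J) t"
      using sup(2) colon_superset[OF join tXY] by blast
  qed
  show "colon (X \<union> Y) (ideal_join X Y I J) t \<subseteq> ideal_join X Y (colon X I t) J"
  proof
    fix f assume f: "f \<in> colon (X \<union> Y) (ideal_join X Y I J) t"
    then have fV: "f \<in> Pol (X \<union> Y)" and "t * f \<in> ideal_join X Y I J" by (auto simp: colon_def mult.commute)
    show "f \<in> ideal_join X Y (colon X I t) J"
    proof (rule ideal_joinI[OF XY ideal_colon[OF I] J fV])
      fix \<xi> assume "kills Y \<xi> J"
      then have "slice Y \<xi> (t * f) \<in> I" by (rule slice_ideal_join[OF XY I J \<open>t * f \<in> _\<close>])
      then show "slice Y \<xi> f \<in> colon X I t"
        using slice_linear_left[OF t XY] slice_Pol_left[OF fV] by (simp add: colon_def mult.commute)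
    qed
  qed
qed

text \<open>
  If \<open>P\<close> and \<open>Q\<close> are the annihilators of the classes of \<open>t\<close> and \<open>s\<close>, then \<open>P + Q\<close> is that of \<open>s t\<close>.
\<close>

lemma associated_prime_ideal_join:
  fixes I J :: "('v, 'k::{alg_closed_field, field_char_0}) mpolynomial set"
  assumes X: "finite X" and XY: "X \<inter> Y = {}" and I: "ideal I (mpoly_ring X)" and J: "ideal J (mpoly_ring Y)"
    and P: "P \<in> associated_primes (mpoly_ring X) I" and Q: "Q \<in> associated_primes (mpoly_ring Y) J"
  shows "ideal_join X Y P Q \<in> associated_primes (mpoly_ring (X \<union> Y)) (ideal_join X Y I J)"
proof -
  have YX: "Y \<inter> X = {}" using XY by auto
  obtain t where t: "t \<in> Pol X" "P = colon X I t" and pP: "primeideal P (mpoly_ring X)"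
    using P associated_primes_iff[OF I] by blast
  obtain s where s: "s \<in> Pol Y" "Q = colon Y J s" and pQ: "primeideal Q (mpoly_ring Y)"
    using Q associated_primes_iff[OF J] by blast
  have "colon (X \<union> Y) (ideal_join X Y I J) (s * t) = colon (X \<union> Y) (colon (X \<union> Y) (ideal_join X Y I J) t) s"
    using s(1) Pol_mono[of Y "X \<union> Y"] by (auto simp: colon_def mult.assoc)
  also have "colon (X \<union> Y) (ideal_join X Y I J) t = ideal_join X Y P J"
    unfolding t(2) by (rule colon_ideal_join[OF XY I J t(1)])
  also have "colon (X \<union> Y) (ideal_join X Y P J) s = ideal_join X Y P Q"
    using colon_ideal_join[OF YX J prime_ideal[OF pP] s(1)] by (simp add: s(2) Un_commute)
  finally have "ideal_join X Y P Q = colon (X \<union> Y) (ideal_join X Y I J) (s * t)" ..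
  moreover have "s * t \<in> Pol (X \<union> Y)"
    using s(1) t(1) Pol_mono[of X "X \<union> Y"] Pol_mono[of Y "X \<union> Y"] by blast
  ultimately show ?thesis
    using associated_primes_iff[OF ideal_ideal_join[OF XY I J]] prime_ideal_join[OF X XY pP pQ] by blast
qed

lemma prime_contract:
  assumes "primeideal P (mpoly_ring V)" "U \<subseteq> V"
  shows "primeideal (P \<inter> Pol U) (mpoly_ring U)"
  unfolding primeideal_iff
proof (intro conjI ballI impI)
  show "ideal (P \<inter> Pol U) (mpoly_ring U)" by (rule ideal_contract[OF prime_ideal[OF assms(1)] assms(2)])
  show "1 \<notin> P \<inter> Pol U" using prime_one[OF assms(1)] by blast
  fix a b assume ab: "a \<in> Pol U" "b \<in> Pol U" "a * b \<in> P \<inter> Pol U"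
  then have "a \<in> P \<or> b \<in> P" using prime_mult[OF assms(1), of a b] Pol_mono[OF assms(2)] by blast
  then show "a \<in> P \<inter> Pol U \<or> b \<in> P \<inter> Pol U" using ab by blast
qed

text \<open>
  Otherwise the product of elements \<open>r b \<in> C b - P\<close> lies in all the ideals \<open>C b\<close> but not in \<open>P\<close>.
\<close>

lemma prime_finite_Inter:
  assumes P: "primeideal P (mpoly_ring V)" and "finite B"
    and C: "\<And>b. b \<in> B \<Longrightarrow> ideal (C b) (mpoly_ring V)" and sub: "\<And>r. r \<in> Pol V \<Longrightarrow> \<forall>b\<in>B. r \<in> C b \<Longrightarrow> r \<in> P"
  shows "\<exists>b\<in>B. C b \<subseteq> P"
proof (rule ccontr)
  assume "\<not> ?thesis"
  then have "\<forall>b\<in>B. \<exists>r. r \<in> C b \<and> r \<notin> P" by blast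
  then obtain r where r: "\<And>b. b \<in> B \<Longrightarrow> r b \<in> C b \<and> r b \<notin> P" by metis
  have rV: "r b \<in> Pol V" if "b \<in> B" for b using r[OF that] ideal_subset[OF C[OF that]] by blast
  have "A \<subseteq> B \<Longrightarrow> prod r A \<notin> P" if "finite A" for A
    using that
  proof (induct A rule: finite_induct)
    case (insert b A)
    have "r b \<in> Pol V" "prod r A \<in> Pol V" using insert rV by auto
    then show ?case using insert r[of b] prime_mult[OF P, of "r b" "prod r A"] by auto
  qed (simp add: prime_one[OF P])
  then have "prod r B \<notin> P" using assms(2) by blast
  moreover have "prod r B \<in> C b" if "b \<in> B" for b
  proof -
    have "prod r (B - {b}) \<in> Pol V" using rV by (intro Pol_prod) auto
    then show ?thesis
      using ideal_mult'[OF C[OF that], of "prod r (B - {b})" "r b"] r[OF that] prod.remove[OF assms(2) that, of r] by simp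
  qed
  moreover have "prod r B \<in> Pol V" using rV by blast
  ultimately show False using sub by blast
qed

text \<open>
  An element of \<open>\<bbbk>[X]\<close> annihilates the class of \<open>t\<close> if and only if it annihilates those of the finitely
  many slices in \<open>slice_decomposition\<close>. So the contracted prime is a finite intersection of annihilators,
  and equals one of them.
\<close>

lemma associated_prime_contract:
  fixes I J :: "('v, 'k::field) mpolynomial set"
  assumes XY: "X \<inter> Y = {}" and I: "ideal I (mpoly_ring X)" and J: "ideal J (mpoly_ring Y)"
    and p: "p \<in> associated_primes (mpoly_ring (X \<union> Y)) (ideal_join X Y I J)"
  shows "p \<inter> Pol X \<in> associated_primes (mpoly_ring X) I"
proof -
  note join = ideal_ideal_join[OF XY I J]
  obtain t where t: "t \<in> Pol (X \<union> Y)" "p = colon (X \<union> Y) (ideal_join X Y I J) t" and pp: "primeideal p (mpoly_ring (X \<union> Y))"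
    using p associated_primes_iff[OF join] by blast
  have prime: "primeideal (p \<inter> Pol X) (mpoly_ring X)" by (rule prime_contract[OF pp]) auto
  obtain B \<xi> where B: "finite B" "B \<subseteq> Pol Y" "\<forall>b\<in>B. kills Y (\<xi> b) J"
    "t - (\<Sum>b\<in>B. slice Y (\<xi> b) t * b) \<in> idl (X \<union> Y) J"
    using slice_decomposition[OF J t(1)] by blast
  let ?a = "\<lambda>b. slice Y (\<xi> b) t"
  have aX: "?a b \<in> Pol X" for b using slice_Pol_left[OF t(1)] .
  have BV: "b \<in> Pol (X \<union> Y)" if "b \<in> B" for b using that B(2) Pol_mono[of Y "X \<union> Y"] by blast
  have diff: "t - (\<Sum>b\<in>B. ?a b * b) \<in> ideal_join X Y I J"
    using B(4) idl_mono[of J "I \<union> J" "X \<union> Y"] ideal_join_subset[OF XY I J] by blast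
  have XV: "r \<in> Pol (X \<union> Y)" if "r \<in> Pol X" for r :: "('v, 'k) mpolynomial" using that by (rule Pol_mono') auto
  have in_p: "r \<in> p \<inter> Pol X" if r: "r \<in> Pol X" "\<forall>b\<in>B. r \<in> colon X I (?a b)" for r
  proof -
    have "r * (t - (\<Sum>b\<in>B. ?a b * b)) \<in> ideal_join X Y I J" by (rule ideal_mult[OF join XV[OF r(1)] diff])
    then have "r * t - (\<Sum>b\<in>B. (r * ?a b) * b) \<in> ideal_join X Y I J"
      by (simp add: right_diff_distrib sum_distrib_left mult.assoc)
    moreover have "(r * ?a b) * b \<in> ideal_join X Y I J" if "b \<in> B" for b
      using ideal_join_superset(1)[OF XY I J] r(2) that by (intro ideal_mult'[OF join BV[OF that]]) (auto simp: colon_def)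
    then have "(\<Sum>b\<in>B. (r * ?a b) * b) \<in> ideal_join X Y I J" by (rule ideal_sum[OF join])
    ultimately have "r * t \<in> ideal_join X Y I J" using ideal_diff_iff[OF join] by blast
    then show ?thesis using r(1) XV[OF r(1)] by (simp add: t(2) colon_def)
  qed
  obtain b where b: "b \<in> B" "colon X I (?a b) \<subseteq> p \<inter> Pol X"
    using prime_finite_Inter[OF prime B(1), of "\<lambda>b. colon X I (?a b)"] ideal_colon[OF I] in_p by blast
  have "p \<inter> Pol X \<subseteq> colon X I (?a b)"
  proof
    fix r assume r: "r \<in> p \<inter> Pol X"
    then have "r * t \<in> ideal_join X Y I J" by (auto simp: t(2) colon_def)
    then have "slice Y (\<xi> b) (r * t) \<in> I" using B(3) b(1) by (intro slice_ideal_join[OF XY I J]) auto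
    then show "r \<in> colon X I (?a b)" using slice_linear_left[of r X Y] XY r by (simp add: colon_def)
  qed
  then have "p \<inter> Pol X = colon X I (?a b)" using b(2) by blast
  then show ?thesis using associated_primes_iff[OF I] prime aX by blast
qed

text \<open>
  For ideals this means being radical; squares suffice, as any power divides an iterated square.
\<close>

definition semiprime :: "'v set \<Rightarrow> ('v, 'k::field) mpolynomial set \<Rightarrow> bool" where
  "semiprime V I \<longleftrightarrow> (\<forall>f\<in>Pol V. f * f \<in> I \<longrightarrow> f \<in> I)"

text \<open>
  Let \<open>p\<close> be the annihilator of the class of \<open>t\<close>. As \<open>I + J\<close> is radical, \<open>t \<notin> p\<close>. For \<open>f \<in> p\<close> the product
  \<open>f t\<close> lies in \<open>I + J\<close>, hence in the prime ideal spanned by the two contractions of \<open>p\<close>, which does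
  not contain \<open>t\<close>.
\<close>

lemma associated_prime_of_ideal_join:
  fixes I J :: "('v, 'k::{alg_closed_field, field_char_0}) mpolynomial set"
  assumes X: "finite X" and XY: "X \<inter> Y = {}" and I: "ideal I (mpoly_ring X)" and J: "ideal J (mpoly_ring Y)"
    and semi: "semiprime (X \<union> Y) (ideal_join X Y I J)"
    and p: "p \<in> associated_primes (mpoly_ring (X \<union> Y)) (ideal_join X Y I J)"
  shows "p = ideal_join X Y (p \<inter> Pol X) (p \<inter> Pol Y)"
proof
  note join = ideal_ideal_join[OF XY I J]
  obtain t where t: "t \<in> Pol (X \<union> Y)" "p = colon (X \<union> Y) (ideal_join X Y I J) t" and pp: "primeideal p (mpoly_ring (X \<union> Y))"
    using p associated_primes_iff[OF join] by blast
  let ?P = "p \<inter> Pol X" and ?Q = "p \<inter> Pol Y"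
  have P: "primeideal ?P (mpoly_ring X)" and Q: "primeideal ?Q (mpoly_ring Y)"
    using prime_contract[OF pp] by auto
  have PQp: "ideal_join X Y ?P ?Q \<subseteq> p" by (rule idl_minimal[OF prime_ideal[OF pp]]) auto
  then show "ideal_join X Y ?P ?Q \<subseteq> p" .
  have "I \<union> J \<subseteq> p" using ideal_join_superset[OF XY I J] colon_superset[OF join t(1)] t(2) by blast
  then have sub: "ideal_join X Y I J \<subseteq> ideal_join X Y ?P ?Q"
    using ideal_subset[OF I] ideal_subset[OF J]
    by (intro idl_mono ideal_join_subset[OF XY prime_ideal[OF P] prime_ideal[OF Q]]) blast
  have tp: "t \<notin> p"
  proof
    assume "t \<in> p"
    then have "t \<in> ideal_join X Y I J" using semi t by (auto simp: semiprime_def colon_def)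
    then have "1 \<in> p" by (simp add: t(2) colon_def)
    then show False using prime_one[OF pp] by blast
  qed
  show "p \<subseteq> ideal_join X Y ?P ?Q"
  proof
    fix f assume f: "f \<in> p"
    then have "f \<in> Pol (X \<union> Y)" "f * t \<in> ideal_join X Y ?P ?Q" using sub by (auto simp: t(2) colon_def)
    then show "f \<in> ideal_join X Y ?P ?Q"
      using prime_mult[OF prime_ideal_join[OF X XY P Q], of f t] t(1) tp PQp by blast
  qed
qed

section \<open>Unmixed sums\<close>

lemma unmixed_iff:
  fixes I :: "('v, 'k::field_char_0) mpolynomial set"
  assumes V: "finite V" and I: "ideal I (mpoly_ring V)" "1 \<notin> I"
  shows "unmixed (mpoly_ring V) I \<longleftrightarrow> (\<forall>P\<in>associated_primes (mpoly_ring V) I. vdim V P = vdim V I)"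
proof -
  have "krull_dim (mpoly_ring V Quot P) = ereal (real (vdim V P))"
    if "P \<in> associated_primes (mpoly_ring V) I" for P
  proof -
    have "primeideal P (mpoly_ring V)" using that by (simp add: associated_primes_def)
    then show ?thesis by (intro krull_dim_Quot[OF V] prime_ideal prime_one)
  qed
  then show ?thesis
    unfolding unmixed_def krull_dim_Quot[OF V I] by auto
qed

context
  fixes X Y :: "'v set" and I J :: "('v, 'k::{alg_closed_field, field_char_0}) mpolynomial set"
  assumes fin: "finite X" "finite Y" and XY: "X \<inter> Y = {}"
    and I: "ideal I (mpoly_ring X)" "1 \<notin> I" and J: "ideal J (mpoly_ring Y)" "1 \<notin> J"
begin

private lemma join_facts: "finite (X \<union> Y)" "ideal (ideal_join X Y I J) (mpoly_ring (X \<union> Y))" "1 \<notin> ideal_join X Y I J"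
  using fin ideal_ideal_join[OF XY I(1) J(1)] ideal_join_proper[OF XY I(1) J(1) I(2) J(2)] by auto

lemma unmixed_ideal_join:
  assumes uI: "unmixed (mpoly_ring X) I" and uJ: "unmixed (mpoly_ring Y) J"
    and semi: "semiprime (X \<union> Y) (ideal_join X Y I J)"
  shows "unmixed (mpoly_ring (X \<union> Y)) (ideal_join X Y I J)"
  unfolding unmixed_iff[OF join_facts]
proof
  fix p assume p: "p \<in> associated_primes (mpoly_ring (X \<union> Y)) (ideal_join X Y I J)"
  have YX: "Y \<inter> X = {}" using XY by auto
  have p': "p \<in> associated_primes (mpoly_ring (Y \<union> X)) (ideal_join Y X J I)"
    using p by (simp only: Un_commute)
  have aP: "p \<inter> Pol X \<in> associated_primes (mpoly_ring X) I" by (rule associated_prime_contract[OF XY I(1) J(1) p])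
  have aQ: "p \<inter> Pol Y \<in> associated_primes (mpoly_ring Y) J" by (rule associated_prime_contract[OF YX J(1) I(1) p'])
  have P: "primeideal (p \<inter> Pol X) (mpoly_ring X)" and Q: "primeideal (p \<inter> Pol Y) (mpoly_ring Y)"
    using aP aQ by (simp_all add: associated_primes_def)
  have "vdim (X \<union> Y) p = vdim (X \<union> Y) (ideal_join X Y (p \<inter> Pol X) (p \<inter> Pol Y))"
    using associated_prime_of_ideal_join[OF fin(1) XY I(1) J(1) semi p] by simp
  also have "\<dots> = vdim X (p \<inter> Pol X) + vdim Y (p \<inter> Pol Y)"
    by (rule vdim_ideal_join[OF fin XY prime_ideal[OF P] prime_one[OF P] prime_ideal[OF Q] prime_one[OF Q]])
  also have "\<dots> = vdim X I + vdim Y J"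
    using uI uJ aP aQ unmixed_iff[OF fin(1) I] unmixed_iff[OF fin(2) J] by auto
  finally show "vdim (X \<union> Y) p = vdim (X \<union> Y) (ideal_join X Y I J)"
    using vdim_ideal_join[OF fin XY I J] by simp
qed

text \<open>
  For \<open>P\<close> and \<open>Q\<close> associated to \<open>I\<close> and \<open>J\<close>, the dimensions of \<open>P\<close> and \<open>Q\<close> add up to those of \<open>I\<close> and
  \<open>J\<close>, and neither exceeds its counterpart.
\<close>

lemma unmixed_ideal_joinD:
  assumes u: "unmixed (mpoly_ring (X \<union> Y)) (ideal_join X Y I J)"
  shows "unmixed (mpoly_ring X) I"
  unfolding unmixed_iff[OF fin(1) I]
proof
  fix P assume aP: "P \<in> associated_primes (mpoly_ring X) I"
  obtain Q where aQ: "Q \<in> associated_primes (mpoly_ring Y) J" using ex_associated_prime[OF fin(2) J] by blast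
  have P: "primeideal P (mpoly_ring X)" and Q: "primeideal Q (mpoly_ring Y)"
    using aP aQ by (simp_all add: associated_primes_def)
  have "I \<subseteq> P" "J \<subseteq> Q"
    by (rule associated_prime_superset[OF I(1) aP], rule associated_prime_superset[OF J(1) aQ])
  then have "vdim X P \<le> vdim X I" "vdim Y Q \<le> vdim Y J"
    using vdim_antimono[OF fin(1) prime_ideal[OF P] prime_one[OF P]] vdim_antimono[OF fin(2) prime_ideal[OF Q] prime_one[OF Q]] by auto
  moreover have "vdim X P + vdim Y Q = vdim X I + vdim Y J"
    using u associated_prime_ideal_join[OF fin(1) XY I(1) J(1) aP aQ] unmixed_iff[OF join_facts]
      vdim_ideal_join[OF fin XY I J]
      vdim_ideal_join[OF fin XY prime_ideal[OF P] prime_one[OF P] prime_ideal[OF Q] prime_one[OF Q]] by simp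
  ultimately show "vdim X P = vdim X I" by simp
qed

end

section \<open>Semiprimeness and the two base cases\<close>

text \<open>
  Suppose \<open>f\<^sup>2 \<in> I\<close>. The square of the leading coefficient of \<open>f\<close> lies in the radical ideal \<open>C\<close>, and so does
  the coefficient itself; it is then the leading coefficient of some \<open>g \<in> I\<close> of \<open>y\<close>-degree at most one.
  Subtracting a multiple of \<open>g\<close> lowers the \<open>y\<close>-degree of \<open>f\<close>, until \<open>f \<in> \<bbbk>[V - {y}]\<close> and \<open>N\<close> applies.
\<close>

lemma semiprime_decompose:
  fixes I :: "('v, 'k::field) mpolynomial set"
  assumes I: "ideal I (mpoly_ring V)" and y: "y \<in> V" and one: "degree_one_leads y I"
    and C: "semiprime (V - {y}) (all_lead_coeffs y I)" and N: "semiprime (V - {y}) (I \<inter> Pol (V - {y}))"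
  shows "semiprime V I"
proof -
  have "f \<in> Pol V \<Longrightarrow> y_le y d f \<Longrightarrow> f * f \<in> I \<Longrightarrow> f \<in> I" for f d
  proof (induct d arbitrary: f)
    case 0
    then have f: "f \<in> Pol (V - {y})" by (intro y_le_0_Pol)
    then show ?case using N 0 by (auto simp: semiprime_def)
  next
    case (Suc d)
    let ?D = "Suc d"
    let ?c = "y_coeff y f ?D"
    have "y_coeff y (f * f) (?D + ?D) = ?c * ?c" by (rule y_coeff_top_mult[OF Suc.prems(2,2)])
    then have "?c * ?c \<in> lead_coeffs y I (?D + ?D)"
      using Suc.prems by (intro lead_coeffsI[of "f * f"] y_le_mult) auto
    then have "?c * ?c \<in> all_lead_coeffs y I" by (rule subsetD[OF lead_coeffs_subset])
    then have "?c \<in> all_lead_coeffs y I"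
      using C y_coeff_in_Pol[OF Suc.prems(1), of y ?D] by (auto simp: semiprime_def)
    then have "?c \<in> lead_coeffs y I 1" using one by (auto simp: degree_one_leads_def)
    then obtain g where g: "g \<in> I" "y_le y 1 g" "?c = y_coeff y g 1" by (rule lead_coeffsE)
    \<comment> \<open>g has y-degree at most 1, so multiplying by y ^ d matches the leading term of f\<close>
    let ?g = "mvar y ^ d * g"
    let ?f = "f - ?g"
    have ydV: "mvar y ^ d \<in> Pol V" using y by auto
    have gI: "?g \<in> I" using g(1) ydV by (rule ideal_mult[OF I, rotated])
    then have gV: "?g \<in> Pol V" using ideal_subset[OF I] by blast
    have fV: "?f \<in> Pol V" using Suc.prems(1) gV by blast
    have "y_le y ?D ?g" using y_le_mult[OF y_le_mvar_power[of y d] g(2)] by simp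
    then have "y_le y ?D ?f" using Suc.prems(2) by blast
    moreover have "y_coeff y ?f ?D = 0" using y_coeff_shift[of y d g 1] g(3) by simp
    ultimately have "y_le y d ?f" by (rule y_le_Suc)
    moreover have "?f * ?f \<in> I"
    proof -
      have "f * f - f * ?g - ?g * ?f \<in> I"
        by (rule ideal_diff[OF I ideal_diff[OF I Suc.prems(3) ideal_mult[OF I Suc.prems(1) gI]] ideal_mult'[OF I fV gI]])
      then show ?thesis by (simp add: algebra_simps)
    qed
    ultimately have "?f \<in> I" by (rule Suc.hyps[OF fV])
    then show ?case using gI ideal_diff_iff[OF I] by blast
  qed
  then show ?thesis using y_le_ex[of y] unfolding semiprime_def by blast
qed

text \<open>
  As a functional this is evaluation at the origin, with \<open>0\<^sup>0 = 1\<close>.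
\<close>

definition origin :: "'v monomial \<Rightarrow> 'k::field" where
  "origin m = (if m = 0 then 1 else 0)"

lemma multiplicative_origin [simp]: "multiplicative origin"
proof -
  have "m + n = 0 \<longleftrightarrow> m = 0 \<and> n = 0" for m n :: "'v monomial"
    by (auto simp: poly_mapping_eq_iff fun_eq_iff lookup_add)
  then show ?thesis by (auto simp: multiplicative_def origin_def)
qed

lemma variables_in_Pol: "B \<subseteq> V \<Longrightarrow> mvar ` B \<subseteq> Pol V"
  by auto

text \<open>
  Every polynomial is congruent to its value at \<open>0\<close> in the variables of \<open>B\<close>. So the ideal is the
  kernel of a homomorphism into an integral domain, which also shows that it is prime.
\<close>

lemma variable_ideal_iff:
  fixes f :: "('v, 'k::field) mpolynomial"
  assumes B: "B \<subseteq> V"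
  shows "f \<in> idl V (mvar ` B) \<longleftrightarrow> f \<in> Pol V \<and> slice B origin f = 0"
proof
  let ?I = "idl V (mvar ` B) :: ('v, 'k) mpolynomial set"
  have id: "ideal ?I (mpoly_ring V)" by (rule ideal_idl[OF variables_in_Pol[OF B]])
  have "ideal {f \<in> Pol V. slice B origin f = (0 :: ('v, 'k) mpolynomial)} (mpoly_ring V)"
    unfolding ideal_iff by (auto simp: slice_mult)
  moreover have "slice B origin (mvar b) = (0 :: ('v, 'k) mpolynomial)" if "b \<in> B" for b
  proof -
    have "single b (1 :: nat) \<noteq> 0" by (metis lookup_single_eq lookup_zero one_neq_zero)
    moreover have "mres B (single b (1 :: nat)) = single b 1" by (rule mres_id) (use that in auto)
    ultimately show ?thesis by (simp add: mvar_def origin_def)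
  qed
  then have "mvar ` B \<subseteq> {f \<in> Pol V. slice B origin f = (0 :: ('v, 'k) mpolynomial)}" using B by auto
  ultimately have "?I \<subseteq> {f \<in> Pol V. slice B origin f = 0}" by (rule idl_minimal)
  then show "f \<in> Pol V \<and> slice B origin f = 0" if "f \<in> ?I" using that by blast
  have "f - slice B origin f \<in> ?I" if "f \<in> Pol V" for f
    using that
  proof (induct rule: Pol_induct)
    case zero
    then show ?case using ideal_zero[OF id] by simp
  next
    case (single m c)
    show ?case
    proof (cases "mres B m = 0")
      case True
      then have "mres (- B) m = m" using mres_split(1)[of B m] by simp
      then show ?thesis using True ideal_zero[OF id] by (simp add: origin_def)
    next
      case False
      then obtain b where "b \<in> keys (mres B m)" by (metis ex_in_conv keys_eq_empty)
      then have b: "b \<in> keys m" "b \<in> B" by auto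
      let ?m = "m - single b 1"
      have m: "m = ?m + single b 1"
        by (rule poly_mapping_eqI) (use b in \<open>auto simp: lookup_add lookup_minus lookup_single when_def in_keys_iff\<close>)
      have "keys ?m \<subseteq> V" using single m keys_add_monomial[of ?m "single b 1"] by auto
      moreover have "mvar b \<in> ?I" using idl_superset[OF variables_in_Pol[OF B]] b by blast
      ultimately have "single ?m c * mvar b \<in> ?I" by (intro ideal_mult[OF id] Pol_single)
      moreover have "single ?m c * mvar b = single m c" using m by (simp add: mvar_def mult_single)
      ultimately show ?thesis using False by (simp add: origin_def)
    qed
  next
    case (add f g)
    have "(f - slice B origin f) + (g - slice B origin g) \<in> ?I" using add ideal_add[OF id] by blast
    then show ?case by (simp add: algebra_simps)
  qed
  then show "f \<in> ?I" if "f \<in> Pol V \<and> slice B origin f = 0" using that by (metis diff_zero)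
qed

lemma ideal_variables: "B \<subseteq> V \<Longrightarrow> ideal (idl V (mvar ` B)) (mpoly_ring V)"
  by (rule ideal_idl[OF variables_in_Pol])

lemma prime_variables:
  assumes "finite V" "B \<subseteq> V"
  shows "primeideal (idl V (mvar ` B)) (mpoly_ring V)"
  unfolding primeideal_iff variable_ideal_iff[OF assms(2)]
proof (intro conjI ballI impI)
  show "ideal (idl V (mvar ` B)) (mpoly_ring V)" by (rule ideal_variables[OF assms(2)])
  fix a b :: "('a, 'b) mpolynomial"
  assume ab: "a \<in> Pol V" "b \<in> Pol V" "a * b \<in> Pol V \<and> slice B origin (a * b) = 0"
  have "slice B origin a * slice B origin b = 0" using ab(3) by (simp add: slice_mult)
  then have "slice B origin a = 0 \<or> slice B origin b = 0"
    by (rule Pol_no_zero_divisors[of "V - B", rotated 3]) (use ab assms(1) in auto)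
  then show "a \<in> Pol V \<and> slice B origin a = 0 \<or> b \<in> Pol V \<and> slice B origin b = 0" using ab by blast
qed simp

lemma unmixed_prime:
  assumes P: "primeideal P (mpoly_ring V)"
  shows "unmixed (mpoly_ring V) P"
proof -
  note Pi = prime_ideal[OF P]
  have "Q = P" if "Q \<in> associated_primes (mpoly_ring V) P" for Q
  proof -
    have "primeideal Q (mpoly_ring V) \<and> (\<exists>t\<in>Pol V. Q = colon V P t)"
      using that by (simp only: associated_primes_iff[OF Pi])
    then obtain t where t: "t \<in> Pol V" "Q = colon V P t" and Q: "primeideal Q (mpoly_ring V)" by blast
    have "t \<notin> P" using prime_one[OF Q] t by (auto simp: colon_def)
    then have "colon V P t \<subseteq> P" using prime_mult[OF P _ _ t(1)] by (auto simp: colon_def)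
    then show ?thesis using colon_superset[OF Pi t(1)] t(2) by blast
  qed
  then show ?thesis by (auto simp: unmixed_def)
qed

lemma gvd_variables: "finite V \<Longrightarrow> B \<subseteq> V \<Longrightarrow> geom_vertex_decomp V (idl V (mvar ` B))"
  by (rule geom_vertex_decomp.variables) (auto intro: ideal_variables unmixed_prime prime_variables)

lemma gvd_unit: "geom_vertex_decomp V (Pol V :: ('v, 'k::field) mpolynomial set)"
proof (rule geom_vertex_decomp.unit)
  let ?I = "Pol V :: ('v, 'k) mpolynomial set"
  show id: "ideal ?I (mpoly_ring V)" by (auto simp: ideal_iff)
  have "colon V ?I t = ?I" if "t \<in> ?I" for t using that by (auto simp: colon_def)
  then have "associated_primes (mpoly_ring V) ?I = {}"
    using associated_primes_iff[OF id] prime_one Pol_one by (metis equals0I)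
  then show "unmixed (mpoly_ring V) ?I" by (simp add: unmixed_def)
  show "?I = idl V {1}" by (rule idl_one[symmetric])
qed

lemma semiprime_prime: "primeideal P (mpoly_ring V) \<Longrightarrow> semiprime V P"
  by (auto simp: semiprime_def dest: prime_mult)

lemma gvd_semiprime:
  assumes "geom_vertex_decomp V I" "finite V"
  shows "semiprime V I"
  using assms
proof (induct rule: gvd_induct)
  case (unit V)
  then show ?case by (simp add: semiprime_def)
next
  case (variables V B)
  then show ?case by (intro semiprime_prime prime_variables)
next
  case (decompose V y I)
  then show ?case by (intro semiprime_decompose[of I V y])
qed

section \<open>Sums of geometrically vertex decomposable ideals\<close>

lemma ideal_join_unit:
  assumes "ideal J (mpoly_ring Y)"
  shows "ideal_join X Y (Pol X) J = Pol (X \<union> Y)"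
proof -
  have sub: "Pol X \<union> J \<subseteq> Pol (X \<union> Y)"
    using ideal_subset[OF assms] Pol_mono[of X "X \<union> Y"] Pol_mono[of Y "X \<union> Y"] by blast
  have "1 \<in> ideal_join X Y (Pol X) J" using idl_superset[OF sub] by auto
  then show ?thesis using ideal_unit_iff[OF ideal_idl[OF sub]] by blast
qed

lemma ideal_join_variables:
  assumes B: "B \<subseteq> X" and C: "C \<subseteq> Y"
  shows "ideal_join X Y (idl X (mvar ` B)) (idl Y (mvar ` C)) = idl (X \<union> Y) (mvar ` (B \<union> C))"
proof
  have BC: "mvar ` (B \<union> C) \<subseteq> Pol (X \<union> Y)" using B C by auto
  show "ideal_join X Y (idl X (mvar ` B)) (idl Y (mvar ` C)) \<subseteq> idl (X \<union> Y) (mvar ` (B \<union> C))"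
  proof (rule idl_minimal[OF ideal_idl[OF BC]], rule Un_least)
    show "idl X (mvar ` B) \<subseteq> idl (X \<union> Y) (mvar ` (B \<union> C))"
      using idl_subset_larger[OF variables_in_Pol[OF B], of "X \<union> Y"] idl_mono[OF _ BC, of "mvar ` B"] by auto
    show "idl Y (mvar ` C) \<subseteq> idl (X \<union> Y) (mvar ` (B \<union> C))"
      using idl_subset_larger[OF variables_in_Pol[OF C], of "X \<union> Y"] idl_mono[OF _ BC, of "mvar ` C"] by auto
  qed
  have "idl X (mvar ` B) \<union> idl Y (mvar ` C) \<subseteq> Pol (X \<union> Y)"
    using ideal_subset[OF ideal_variables[OF B]] ideal_subset[OF ideal_variables[OF C]]
      Pol_mono[of X "X \<union> Y"] Pol_mono[of Y "X \<union> Y"] by blast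
  then show "idl (X \<union> Y) (mvar ` (B \<union> C)) \<subseteq> ideal_join X Y (idl X (mvar ` B)) (idl Y (mvar ` C))"
    using idl_superset[OF variables_in_Pol[OF B]] idl_superset[OF variables_in_Pol[OF C]]
    by (intro idl_mono) (auto simp: image_Un)
qed

text \<open>
  Any decomposition of \<open>I\<close> can be carried out in the presence of \<open>J\<close>, provided that its end results,
  ideals generated by variables, stay decomposable when \<open>J\<close> is added. Radicality of \<open>I + J\<close>, needed for
  unmixedness, comes from the ideals \<open>C\<close> and \<open>N\<close> of \<open>I + J\<close>, decomposable by induction.
\<close>

lemma gvd_ideal_join_from_base:
  fixes I J :: "('v, 'k::{alg_closed_field, field_char_0}) mpolynomial set"
  assumes Y: "finite Y" and J: "ideal J (mpoly_ring Y)" "1 \<notin> J" and uJ: "unmixed (mpoly_ring Y) J"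
    and base: "\<And>X B. finite X \<Longrightarrow> X \<inter> Y = {} \<Longrightarrow> B \<subseteq> X \<Longrightarrow>
      geom_vertex_decomp (X \<union> Y) (ideal_join X Y (idl X (mvar ` B)) J)"
    and "geom_vertex_decomp X I" "finite X"
  shows "X \<inter> Y = {} \<Longrightarrow> geom_vertex_decomp (X \<union> Y) (ideal_join X Y I J)"
  using assms(6,7)
proof (induct rule: gvd_induct)
  case (unit V)
  then show ?case using gvd_unit[of "V \<union> Y"] by (simp add: ideal_join_unit[OF J(1)])
next
  case (variables V B)
  then show ?case by (intro base)
next
  case (decompose V y I)
  show ?case
  proof (cases "1 \<in> I")
    case True
    then have "I = Pol V" using ideal_unit_iff[OF decompose(2)] by blast
    then show ?thesis using gvd_unit[of "V \<union> Y"] by (simp add: ideal_join_unit[OF J(1)])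
  next
    case False
    have VY': "(V - {y}) \<inter> Y = {}" "V \<union> Y - {y} = (V - {y}) \<union> Y" "y \<in> V \<union> Y" "finite (V \<union> Y)"
      using decompose.prems decompose(1,4) Y by auto
    note ctx = decompose.prems decompose(2) J(1) decompose(4)
    let ?S = "ideal_join V Y I J"
    have id: "ideal ?S (mpoly_ring (V \<union> Y))" by (rule ideal_ideal_join[OF ctx(1-3)])
    have C: "geom_vertex_decomp (V \<union> Y - {y}) (all_lead_coeffs y ?S)"
      using decompose(8)[OF VY'(1)] by (simp add: all_lead_coeffs_ideal_join[OF ctx] VY'(2))
    have N: "geom_vertex_decomp (V \<union> Y - {y}) (?S \<inter> Pol (V \<union> Y - {y}))"
      unfolding ideal_join_restrict[OF ctx] using decompose(9)[OF VY'(1)] by (simp add: VY'(2))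
    have one: "degree_one_leads y ?S"
      using degree_one_leads_ideal_join[OF ctx J(2)] decompose(5) by simp
    have "semiprime (V \<union> Y) ?S"
      by (rule semiprime_decompose[OF id VY'(3) one]) (use gvd_semiprime[OF C] gvd_semiprime[OF N] VY'(4) in auto)
    then have "unmixed (mpoly_ring (V \<union> Y)) ?S"
      by (rule unmixed_ideal_join[OF decompose(1) Y decompose.prems decompose(2) False J decompose(3) uJ])
    then show ?thesis by (rule gvd_decomposeI[OF VY'(4) id _ VY'(3) one C N])
  qed
qed

text \<open>
  The preceding lemma is used twice: first with \<open>J\<close> generated by variables, where the base case is
  trivial; with the roles of the two ideals exchanged this result is the base case for general \<open>J\<close>.
\<close>

lemma gvd_ideal_join:
  fixes I J :: "('v, 'k::{alg_closed_field, field_char_0}) mpolynomial set"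
  assumes fin: "finite X" "finite Y" and XY: "X \<inter> Y = {}" and J1: "1 \<notin> J"
    and gI: "geom_vertex_decomp X I" and gJ: "geom_vertex_decomp Y J"
  shows "geom_vertex_decomp (X \<union> Y) (ideal_join X Y I J)"
proof -
  have vars: "geom_vertex_decomp (X \<union> Y) (ideal_join X Y I (idl Y (mvar ` B)))"
    if "finite X" "finite Y" "X \<inter> Y = {}" "B \<subseteq> Y" "geom_vertex_decomp X I"
    for X Y B and I :: "('v, 'k) mpolynomial set"
  proof (rule gvd_ideal_join_from_base[OF that(2) _ _ _ _ that(5,1,3)])
    note prime = prime_variables[OF that(2,4)]
    show "ideal (idl Y (mvar ` B)) (mpoly_ring Y)" "1 \<notin> idl Y (mvar ` B)" "unmixed (mpoly_ring Y) (idl Y (mvar ` B))"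
      using prime_ideal[OF prime] prime_one[OF prime] unmixed_prime[OF prime] .
    show "geom_vertex_decomp (X' \<union> Y) (ideal_join X' Y (idl X' (mvar ` C)) (idl Y (mvar ` B)))"
      if "finite X'" "X' \<inter> Y = {}" "C \<subseteq> X'" for X' C
      unfolding ideal_join_variables[OF that(3) \<open>B \<subseteq> Y\<close>]
      by (rule gvd_variables) (use that \<open>finite Y\<close> \<open>B \<subseteq> Y\<close> in auto)
  qed
  show ?thesis
  proof (rule gvd_ideal_join_from_base[OF fin(2) gvd_ideal[OF gJ] J1 gvd_unmixed[OF gJ] _ gI fin(1) XY])
    show "geom_vertex_decomp (X' \<union> Y) (ideal_join X' Y (idl X' (mvar ` B)) J)"
      if "finite X'" "X' \<inter> Y = {}" "B \<subseteq> X'" for X' B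
      using vars[OF fin(2) that(1) _ that(3) gJ] that(2) by (simp add: Un_commute Int_commute)
  qed
qed

lemma variables_contract:
  assumes B: "B \<subseteq> V" and XV: "X \<subseteq> V"
  shows "idl V (mvar ` B) \<inter> Pol X = (idl X (mvar ` (B \<inter> X)) :: ('v, 'k::field) mpolynomial set)"
proof -
  have "slice B origin f = slice (B \<inter> X) origin f" if "f \<in> Pol X" for f :: "('v, 'k) mpolynomial"
    using that
  proof (induct rule: Pol_induct)
    case (single m c)
    have "mres B m = mres (B \<inter> X) m" "mres (- B) m = mres (- (B \<inter> X)) m"
      by (rule poly_mapping_eqI, use single in \<open>auto simp: in_keys_iff\<close>)+
    then show ?case by simp
  qed auto
  then show ?thesis
    using Pol_mono[OF XV] by (auto simp: variable_ideal_iff[OF B] variable_ideal_iff[of "B \<inter> X" X])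
qed

text \<open>
  By induction on the decomposition of \<open>H = I + J\<close>, for all splittings of the variables at once: the
  variable of the first step may belong to either side.
\<close>

lemma gvd_ideal_joinD:
  fixes H :: "('v, 'k::{alg_closed_field, field_char_0}) mpolynomial set"
  assumes "geom_vertex_decomp Z H" "finite Z"
  shows "Z = X \<union> Y \<Longrightarrow> X \<inter> Y = {} \<Longrightarrow> H = ideal_join X Y I J \<Longrightarrow>
    ideal I (mpoly_ring X) \<Longrightarrow> 1 \<notin> I \<Longrightarrow> ideal J (mpoly_ring Y) \<Longrightarrow> 1 \<notin> J \<Longrightarrow>
    geom_vertex_decomp X I \<and> geom_vertex_decomp Y J"
  using assms
proof (induct arbitrary: X Y I J rule: gvd_induct)
  case (unit V)
  then show ?case using ideal_join_proper[OF unit(3,5,7,6,8)] by (metis Pol_one)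
next
  case (variables V B)
  have YX: "Y \<inter> X = {}" using variables by auto
  have "I = idl X (mvar ` (B \<inter> X))"
    using ideal_join_contract[OF variables(4,6,8,9)] variables_contract[OF variables(2), of X] variables(3,5) by auto
  moreover have "J = idl Y (mvar ` (B \<inter> Y))"
    using ideal_join_contract[OF YX variables(8,6,7)] variables_contract[OF variables(2), of Y] variables(3,5)
    by (auto simp: Un_commute)
  ultimately show ?case
    using variables(1,3) by (auto intro!: gvd_variables)
next
  case (decompose V y H)
  note IH = decompose(8,9)
  have main: "geom_vertex_decomp X I \<and> geom_vertex_decomp Y J"
    if V: "V = X \<union> Y" and XY: "X \<inter> Y = {}" and H: "H = ideal_join X Y I J" and I: "ideal I (mpoly_ring X)" "1 \<notin> I"
      and J: "ideal J (mpoly_ring Y)" "1 \<notin> J" and y: "y \<in> X"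
    for X Y and I J :: "('v, 'k) mpolynomial set"
  proof -
    have fin: "finite X" "finite Y" using decompose(1) V by auto
    have V': "V - {y} = (X - {y}) \<union> Y" "(X - {y}) \<inter> Y = {}" using V XY y by auto
    note ctx = XY I(1) J(1) y
    have C: "all_lead_coeffs y H = ideal_join (X - {y}) Y (all_lead_coeffs y I) J"
      unfolding H by (rule all_lead_coeffs_ideal_join[OF ctx])
    have N: "H \<inter> Pol (V - {y}) = ideal_join (X - {y}) Y (I \<inter> Pol (X - {y})) J"
      unfolding H V by (rule ideal_join_restrict[OF ctx])
    note idN = ideal_contract[OF I(1), of "X - {y}", OF Diff_subset]
    note idC = ideal_all_lead_coeffs[OF I(1) y]
    have gN: "geom_vertex_decomp (X - {y}) (I \<inter> Pol (X - {y})) \<and> geom_vertex_decomp Y J"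
      using I(2) by (intro IH(2)[OF V' N idN _ J]) auto
    have gC: "geom_vertex_decomp (X - {y}) (all_lead_coeffs y I)"
    \<comment> \<open>the ideal of leading coefficients may be the unit ideal although I is proper\<close>
    proof (cases "1 \<in> all_lead_coeffs y I")
      case True
      then show ?thesis using ideal_unit_iff[OF idC] gvd_unit by metis
    next
      case False
      then show ?thesis using IH(1)[OF V' C idC _ J] by blast
    qed
    have "unmixed (mpoly_ring X) I"
      by (rule unmixed_ideal_joinD[OF fin XY I J]) (use decompose(3) V H in simp)
    moreover have "degree_one_leads y I"
      using degree_one_leads_ideal_join[OF ctx J(2)] decompose(5) H by simp
    ultimately show ?thesis using gvd_decomposeI[OF fin(1) I(1) _ y _ gC] gN by blast
  qed
  consider "y \<in> X" | "y \<in> Y" using decompose(4) decompose.prems(1) by blast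
  then show ?case
  proof cases
    case 1
    then show ?thesis using main decompose.prems by blast
  next
    case 2
    have "V = Y \<union> X" "Y \<inter> X = {}" "H = ideal_join Y X J I"
      using decompose.prems by (auto simp: Un_commute)
    then show ?thesis using main[of Y X J I] decompose.prems 2 by blast
  qed
qed

theorem theorem1p1:
  fixes X Y :: "'v set"
    and I J :: "('v, 'k :: {alg_closed_field, field_char_0}) mpolynomial set"
  assumes "finite X" and "finite Y" and "X \<inter> Y = {}"
    and "ideal I (mpoly_ring X)" and "I \<noteq> carrier (mpoly_ring X)"
    and "ideal J (mpoly_ring Y)" and "J \<noteq> carrier (mpoly_ring Y)"
  shows "geom_vertex_decomp X I \<and> geom_vertex_decomp Y J \<longleftrightarrow>
         geom_vertex_decomp (X \<union> Y) (Idl\<^bsub>mpoly_ring (X \<union> Y)\<^esub> (I \<union> J))"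
proof -
  have "1 \<notin> I" "1 \<notin> J" using assms ideal_unit_iff by blast+
  then show ?thesis
    using gvd_ideal_join[OF assms(1-3)] gvd_ideal_joinD[of "X \<union> Y" "ideal_join X Y I J" X Y I J] assms
    by (metis finite_UnI)
qed

end
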